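(* Let $\mathcal{P}$ be an $n$-partition of $\mathbb{R}^d$. Then the realization space $\mathcal{C}_{\mathcal{P}}(\mathbb{R}^d,n)$, consisting of all $n$-partitions of $\mathbb{R}^d$ with the same combinatorial type as $\mathcal{P}$, is a semialgebraic set.
   Context: **Partitions.** Let $d,n\ge1$. An $n$-partition of $\mathbb{R}^d$ is an ordered list $\mathcal{P}=(P_1,\dots,P_n)$ of non-empty open convex pairwise disjoint subsets of $\mathbb{R}^d$ with $\bigcup_i\overline{P_i}=\mathbb{R}^d$. $\mathcal{C}(\mathbb{R}^d,n)$ is the set of all of these. **Spherical representation.** Write $S^d\subset\mathbb{R}^{d+1}$ for the unit sphere with coordinates $(v_0,\dots,v_d)$, and $S^d_\pm=\{\mathbf{v}\in S^d:\pm v_0>0\}$. For $\mathbf{x}\in\mathbb{R}^d$ let $\widehat{\mathbf{x}}=\binom{1}{\mathbf{x}}/\sqrt{1+\|\mathbf{x}\|^2}\in S^d_+$. Put $\widehat P_i=\{\widehat{\mathbf{x}}:\mathbf{x}\in P_i\}$ and $\widehat P_\infty=S^d_-$. For $X\subseteq S^d$, $\mathrm{cone}(X)$ is the set of non-negative linear combinations of elements of $X$ (with $\mathrm{cone}(\emptyset)=\{\mathbf{0}\}$), and the spherical convex hull of $X$ is $S^d\cap\mathrm{cone}(X)$. Let $C_i=\mathrm{cone}(\overline{\widehat P_i})$ for $i\in\{1,\dots,n,\infty\}$. **Faces.** For $\mathbf{x}\in\mathbb{R}^{d+1}$ let $I(\mathbf{x})=\{i\in\{1,\dots,n,\infty\}:\mathbf{x}\in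 C_i\}$. Let $\mathcal{I}(\mathcal{P})=\{I(\mathbf{x}):\mathbf{x}\in\mathbb{R}^{d+1}\}\setminus\{\{\infty\}\}$. The faces of $\mathcal{P}$ are the sets $F_I=\bigcap_{i\in I}\overline{\widehat P_i}\subseteq S^d$, $I\in\mathcal{I}(\mathcal{P})$; put $C_I=\mathrm{cone}(F_I)$ and $\dim F_I=\dim C_I-1$. The minimal face is $F_{I(\mathbf{0})}$, with $I(\mathbf{0})=\{1,\dots,n,\infty\}$; its cone $C_{I(\mathbf{0})}$ is a linear subspace, and it is the only face whose cone is linear. $\mathcal{P}$ is essential if $F_{I(\mathbf{0})}=\emptyset$. A face is half-linear if it is the intersection of $S^d$ with a linear subspace $L$ of $\mathbb{R}^{d+1}$ and one closed linear halfspace (not containing $L$). **Node systems.** If $\mathcal{P}$ is essential, a node system $N$ of $\mathcal{P}$ is a set of points $\mathbf{v}_F$, one in the relative interior of each half-linear face $F$. If $\mathcal{P}$ is non-essential with $\dim F_{I(\mathbf{0})}=k\ge0$, a node system consists of one point $\mathbf{v}_F$ in the relative interior of each half-linear face $F$ together with an ordered sequence $\mathbf{v}_1,\dots,\mathbf{v}_{k+2}$ of points of $F_{I(\mathbf{0})}$ that positively span $C_{I(\mathbf{0})}$. The points are called nodes. **The complex $\mathcal{P}_N$.** Its faces are obtained recursively: (1) for each set $S$ of nodes in $F_{I(\mathbf{0})}$ with $|S|\le k+1$ ($k=\dim F_{I(\mathbf{0})}$), the spherical convex hull of $S$ (only $\emptyset$ if $\mathcal{P}$ is essential); (2) for every half-linear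 face $F$ whose relative boundary is already covered by faces of $\mathcal{P}_N$, the spherical convex hull of $G\cup\{\mathbf{v}_F\}$ for every face $G$ of $\mathcal{P}_N$ (including $\emptyset$) contained in the relative boundary of $F$; (3) all faces of $\mathcal{P}$ that are neither linear nor half-linear. **Node frames and orientation.** A node frame of $N$ is a list $(\mathbf{v}_0,\dots,\mathbf{v}_d)$ of $d+1$ distinct nodes for which there are faces $G_0\subset\cdots\subset G_d$ of $\mathcal{P}_N$ with $\dim G_k=k$ and $\mathbf{v}_0,\dots,\mathbf{v}_k\in G_k$ for all $k\le d$. The orientation of $\mathcal{P}$ is given by the signs of $\det(\mathbf{v}_0,\dots,\mathbf{v}_d)$ (in $\{+,-,0\}$) for all node frames of a node system of $\mathcal{P}$. **Combinatorial type.** Two $n$-partitions $\mathcal{P},\mathcal{P}'$ have the same combinatorial type (are combinatorially equivalent) if $\mathcal{I}(\mathcal{P})=\mathcal{I}(\mathcal{P}')$; for each $I\in\mathcal{I}(\mathcal{P})$, $F_I(\mathcal{P})$ is half-linear iff $F_I(\mathcal{P}')$ is; and they have the same orientation, i.e. there are node systems $N$ of $\mathcal{P}$ and $N'$ of $\mathcal{P}'$ such that corresponding node frames have determinants of the same sign (including zero). Here nodes of half-linear faces with the same index $I$ correspond, and the $i$-th nodes in the minimal faces correspond. **Coordinates.** $\mathcal{C}_{\mathcal{P}}(\mathbb{R}^d,n)$ is viewed as a subset of $\mathbb{R}^{h(d+1)}$ as follows. Let $h$ be the number of pairs $i<j$ in $\{1,\dots,n\}$ with $\{i,j\}\in\mathcal{I}(\mathcal{P})$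 (equivalently, $\overline{P_i}\cap\overline{P_j}$ is $(d-1)$-dimensional). A partition $\mathcal{P}'$ is represented by the vectors $\mathbf{c}_{ij}\in S^d$ for these pairs, where $\mathbf{c}_{ij}$ is the unique unit vector with $\mathbf{c}_{ij}\cdot\binom{1}{\mathbf{x}}<0$ on $P'_i$ and $\mathbf{c}_{ij}\cdot\binom{1}{\mathbf{x}}>0$ on $P'_j$. These vectors determine $\mathcal{P}'$ within the realization space. A subset of $\mathbb{R}^m$ is semialgebraic if it is a finite union of solution sets of systems of finitely many polynomial equations and strict polynomial inequalities. *)

theory Defs
  imports "HOL-Analysis.Analysis" "HOL-Library.Extended_Nat"
begin

section \<open>Partitions and their spherical representation\<close>

text \<open>A list of length \<open>n\<close> is indexed by \<open>0, \<dots>, n - 1\<close> instead of \<open>1, \<dots>, n\<close>.\<close>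

definition convex_partitions :: "nat \<Rightarrow> (real^'d) set list set" where
  "convex_partitions n = {P. length P = n
     \<and> (\<forall>i<n. P ! i \<noteq> {} \<and> open (P ! i) \<and> convex (P ! i))
     \<and> (\<forall>i<n. \<forall>j<n. i \<noteq> j \<longrightarrow> P ! i \<inter> P ! j = {})
     \<and> (\<Union>i<n. closure (P ! i)) = UNIV}"

text \<open>The space \<open>\<real>\<^sup>d\<^sup>+\<^sup>1\<close> is \<open>real^('d option)\<close>; \<open>None\<close> is the coordinate with number \<open>0\<close>.\<close>

definition homog :: "real^'d \<Rightarrow> real^('d option)" where
  "homog x = (\<chi> l. case l of None \<Rightarrow> 1 | Some k \<Rightarrow> x $ k)"

definition hat :: "real^'d \<Rightarrow> real^('d option)" where
  "hat x = homog x /\<^sub>R sqrt (1 + (norm x)\<^sup>2)"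

abbreviation unit_sphere :: "(real^('d::finite option)) set" where
  "unit_sphere \<equiv> sphere 0 1"

text \<open>The non-negative linear combinations of elements of \<open>X\<close>; for \<open>X = {}\<close> this is \<open>{0}\<close>.\<close>

abbreviation pos_cone :: "(real^('d::finite option)) set \<Rightarrow> (real^('d option)) set" where
  "pos_cone X \<equiv> convex_cone hull X"

definition spherical_hull :: "(real^('d::finite option)) set \<Rightarrow> (real^('d option)) set" where
  "spherical_hull X = unit_sphere \<inter> pos_cone X"

definition sdim :: "(real^('d::finite option)) set \<Rightarrow> int" where
  "sdim X = int (dim (pos_cone X)) - 1"

text \<open>Relative interior and boundary of a spherically convex set inside the great subsphere it spans.\<close>

definition srel_interior :: "(real^('d::finite option)) set \<Rightarrow> (real^('d option)) set" where
  "srel_interior X = unit_sphere \<inter> rel_interior (pos_cone X)"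

definition srel_boundary :: "(real^('d::finite option)) set \<Rightarrow> (real^('d option)) set" where
  "srel_boundary X = X - srel_interior X"

section \<open>Faces\<close>

definition cell_indices :: "(real^'d) set list \<Rightarrow> enat set" where
  "cell_indices P = insert \<infinity> (enat ` {..<length P})"

definition hat_cell :: "(real^'d) set list \<Rightarrow> enat \<Rightarrow> (real^('d option)) set" where
  "hat_cell P i = (case i of enat k \<Rightarrow> hat ` (P ! k) | \<infinity> \<Rightarrow> {v \<in> unit_sphere. v $ None < 0})"

definition cell_cone :: "(real^'d) set list \<Rightarrow> enat \<Rightarrow> (real^('d option)) set" where
  "cell_cone P i = pos_cone (closure (hat_cell P i))"

definition cells_at :: "(real^'d) set list \<Rightarrow> real^('d option) \<Rightarrow> enat set" where
  "cells_at P x = {i \<in> cell_indices P. x \<in> cell_cone P i}"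

definition face_indices :: "(real^'d) set list \<Rightarrow> enat set set" where
  "face_indices P = range (cells_at P) - {{\<infinity>}}"

definition face :: "(real^'d) set list \<Rightarrow> enat set \<Rightarrow> (real^('d option)) set" where
  "face P I = (\<Inter>i\<in>I. closure (hat_cell P i))"

definition min_face :: "(real^'d) set list \<Rightarrow> (real^('d option)) set" where
  "min_face P = face P (cells_at P 0)"

definition essential :: "(real^'d) set list \<Rightarrow> bool" where
  "essential P \<longleftrightarrow> min_face P = {}"

definition linear_face :: "(real^('d::finite option)) set \<Rightarrow> bool" where
  "linear_face F \<longleftrightarrow> subspace (pos_cone F)"

definition half_linear :: "(real^('d::finite option)) set \<Rightarrow> bool" where
  "half_linear F \<longleftrightarrow> (\<exists>L a. subspace L \<and> \<not> L \<subseteq> {x. a \<bullet> x \<ge> 0}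
     \<and> F = unit_sphere \<inter> L \<inter> {x. a \<bullet> x \<ge> 0})"

section \<open>Node systems\<close>

text \<open>Nodes carry labels that do not refer to the geometry, so that nodes of different partitions
  correspond iff they have the same label: \<open>Half_Node I\<close> is the node of the half-linear face with
  index \<open>I\<close>, and \<open>Min_Node i\<close> the \<open>i\<close>-th node in the minimal face (counted from \<open>0\<close>).\<close>

datatype node_label = Half_Node "enat set" | Min_Node nat

definition half_linear_indices :: "(real^'d) set list \<Rightarrow> enat set set" where
  "half_linear_indices P = {I \<in> face_indices P. half_linear (face P I)}"

definition min_node_labels :: "(real^'d) set list \<Rightarrow> node_label set" where
  "min_node_labels P =
     (if essential P then {} else Min_Node ` {i. int i < sdim (min_face P) + 2})"

definition node_labels :: "(real^'d) set list \<Rightarrow> node_label set" where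
  "node_labels P = Half_Node ` half_linear_indices P \<union> min_node_labels P"

definition node_system :: "(real^'d) set list \<Rightarrow> (node_label \<Rightarrow> real^('d option)) \<Rightarrow> bool" where
  "node_system P N \<longleftrightarrow>
     (\<forall>I \<in> half_linear_indices P. N (Half_Node I) \<in> srel_interior (face P I))
     \<and> (\<not> essential P \<longrightarrow> N ` min_node_labels P \<subseteq> min_face P
          \<and> pos_cone (N ` min_node_labels P) = pos_cone (min_face P))"

text \<open>The recursive construction is read as a least fixed point: \<open>cone_over\<close> applies to a half-linear
  face as soon as its relative boundary is covered by faces obtained so far. With \<open>S = {}\<close>, the first
  rule yields the empty face.\<close>

inductive_set node_complex ::
    "(real^'d) set list \<Rightarrow> (node_label \<Rightarrow> real^('d option)) \<Rightarrow> (real^('d option)) set set"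
  for P :: "(real^'d) set list" and N :: "node_label \<Rightarrow> real^('d option)" where
  minimal: "\<lbrakk>S \<subseteq> N ` node_labels P \<inter> min_face P; finite S; int (card S) \<le> sdim (min_face P) + 1\<rbrakk>
     \<Longrightarrow> spherical_hull S \<in> node_complex P N"
| cone_over: "\<lbrakk>I \<in> half_linear_indices P;
      \<And>x. x \<in> srel_boundary (face P I) \<Longrightarrow> \<exists>G'. G' \<in> node_complex P N \<and> x \<in> G';
      G \<in> node_complex P N; G \<subseteq> srel_boundary (face P I)\<rbrakk>
     \<Longrightarrow> spherical_hull (insert (N (Half_Node I)) G) \<in> node_complex P N"
| other: "\<lbrakk>I \<in> face_indices P; \<not> linear_face (face P I); \<not> half_linear (face P I)\<rbrakk>
     \<Longrightarrow> face P I \<in> node_complex P N"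

section \<open>Orientation and combinatorial type\<close>

definition node_frame ::
    "(real^'d) set list \<Rightarrow> (node_label \<Rightarrow> real^('d option)) \<Rightarrow> node_label list \<Rightarrow> bool" where
  "node_frame P N ls \<longleftrightarrow>
     length ls = CARD('d) + 1 \<and> set ls \<subseteq> node_labels P \<and> distinct (map N ls)
     \<and> (\<exists>G :: nat \<Rightarrow> (real^('d option)) set.
          (\<forall>k \<le> CARD('d). G k \<in> node_complex P N \<and> sdim (G k) = int k
             \<and> (\<forall>i \<le> k. N (ls ! i) \<in> G k))
          \<and> (\<forall>k < CARD('d). G k \<subset> G (Suc k)))"

text \<open>The determinant of \<open>d + 1\<close> vectors. The coordinates are numbered by the fixed
  enumeration \<open>to_nat_on UNIV\<close> of the index type, a bijection onto \<open>{..<d + 1}\<close>. Another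
  enumeration multiplies all determinants by the same sign, which has no effect on whether
  the signs of two determinants agree.\<close>

definition list_det :: "(real^('d::finite option)) list \<Rightarrow> real" where
  "list_det vs = det (\<chi> l. vs ! to_nat_on (UNIV :: 'd option set) l)"

definition same_orientation :: "(real^'d) set list \<Rightarrow> (real^'d) set list \<Rightarrow> bool" where
  "same_orientation P P' \<longleftrightarrow>
     (\<exists>N N'. node_system P N \<and> node_system P' N'
        \<and> (\<forall>ls. node_frame P N ls \<and> node_frame P' N' ls \<longrightarrow>
              sgn (list_det (map N ls)) = sgn (list_det (map N' ls))))"

definition comb_equivalent :: "(real^'d) set list \<Rightarrow> (real^'d) set list \<Rightarrow> bool" where
  "comb_equivalent P P' \<longleftrightarrow> face_indices P = face_indices P'
     \<and> (\<forall>I \<in> face_indices P. half_linear (face P I) \<longleftrightarrow> half_linear (face P' I))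
     \<and> same_orientation P P'"

definition realization_space :: "nat \<Rightarrow> (real^'d) set list \<Rightarrow> (real^'d) set list set" where
  "realization_space n P = {P' \<in> convex_partitions n. comb_equivalent P P'}"

section \<open>Coordinates\<close>

definition adjacent_pairs :: "(real^'d) set list \<Rightarrow> (nat \<times> nat) set" where
  "adjacent_pairs P = {(i, j). i < j \<and> j < length P \<and> {enat i, enat j} \<in> face_indices P}"

definition wall_normal :: "(real^'d) set list \<Rightarrow> nat \<Rightarrow> nat \<Rightarrow> real^('d option)" where
  "wall_normal P i j = (THE c. norm c = 1
     \<and> (\<forall>x \<in> P ! i. c \<bullet> homog x < 0) \<and> (\<forall>x \<in> P ! j. c \<bullet> homog x > 0))"

text \<open>The coordinate space \<open>\<real>\<^sup>m\<close> with \<open>m = h (d + 1)\<close> consists of the extensional functions on a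
  set of \<open>m\<close> indices.\<close>

definition coord_set :: "(real^'d) set list \<Rightarrow> ((nat \<times> nat) \<times> 'd option) set" where
  "coord_set P = adjacent_pairs P \<times> UNIV"

definition coords ::
    "(real^'d) set list \<Rightarrow> (real^'d) set list \<Rightarrow> (nat \<times> nat) \<times> 'd option \<Rightarrow> real" where
  "coords P P' = (\<lambda>((i, j), l) \<in> coord_set P. wall_normal P' i j $ l)"

section \<open>Semialgebraic sets\<close>

inductive mpoly_fun :: "'i set \<Rightarrow> (('i \<Rightarrow> real) \<Rightarrow> real) \<Rightarrow> bool" for J :: "'i set" where
  const: "mpoly_fun J (\<lambda>x. c)"
| var: "i \<in> J \<Longrightarrow> mpoly_fun J (\<lambda>x. x i)"
| add: "\<lbrakk>mpoly_fun J f; mpoly_fun J g\<rbrakk> \<Longrightarrow> mpoly_fun J (\<lambda>x. f x + g x)"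
| mult: "\<lbrakk>mpoly_fun J f; mpoly_fun J g\<rbrakk> \<Longrightarrow> mpoly_fun J (\<lambda>x. f x * g x)"

definition semialgebraic :: "'i set \<Rightarrow> ('i \<Rightarrow> real) set \<Rightarrow> bool" where
  "semialgebraic J S \<longleftrightarrow>
     (\<exists>\<S> :: ((('i \<Rightarrow> real) \<Rightarrow> real) set \<times> (('i \<Rightarrow> real) \<Rightarrow> real) set) set.
        finite \<S>
        \<and> (\<forall>(E, G) \<in> \<S>. finite E \<and> finite G \<and> (\<forall>f \<in> E \<union> G. mpoly_fun J f))
        \<and> S = (\<Union>(E, G) \<in> \<S>. {x \<in> J \<rightarrow>\<^sub>E UNIV. (\<forall>f \<in> E. f x = 0) \<and> (\<forall>g \<in> G. g x > 0)}))"

end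

theory Submission
  imports Defs "HOL-Computational_Algebra.Polynomial"
begin

text \<open>Every cell of a convex partition is the intersection of open halfspaces separating it from
  the other cells, so partitions can be parametrized by finitely many vectors. In these parameters
  everything in the definition of the combinatorial type is first-order over the ordered field of
  real numbers: cones are handled through Caratheodory's theorem, and the faces of
  \<open>\<P>\<^sub>N\<close> are described by finitely many symbols, which turns the recursive
  construction into a finite condition. The coordinates are the unit normals of adjacent cells,
  which are unique. Hence the realization space is the projection of a first-order definable set, and
  the Tarski-Seidenberg theorem applies. The latter is proved by Cohen's method: by induction on the
  degree, the roots of a polynomial are effective functions of its coefficients, that is,
  substituting them preserves quantifier-free definability.\<close>

section \<open>Quantifier-free definable predicates\<close>

text \<open>Definability is a property of predicates, not of formulas: \<open>qf\<close> and
  \<open>eff\<close> are closed under the needed operations, and environments are infinite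
  sequences, so no arities are tracked and a bound variable is simply put in front by
  \<open>case_nat\<close>. The induction on the degree closes for the following reason. A root lying
  strictly between two neighbouring critical points, or beyond the last one, can be compared with
  any number by looking at one sign, and the critical points are roots of the derivative, which has
  lower degree. A multiple root is itself a critical point. The other obstacle is that the
  definitions range over objects that are not tuples of reals: sets, dimensions, chains of faces,
  and node systems, which are functions on an infinite type of labels. For a fixed dimension and a
  fixed number of cells, each is reduced to finitely many cases or finitely many vectors. The
  coordinates list only the normals of adjacent cells; the separating vectors for all ordered pairs
  are auxiliary parameters, far from unique, and only quantified existentially.\<close>

type_synonym env = "nat \<Rightarrow> real"

abbreviation PT :: "(env \<Rightarrow> real) \<Rightarrow> bool" where
  "PT \<equiv> mpoly_fun UNIV"

named_theorems PT_rules

lemma PT_const [PT_rules]: "PT (\<lambda>e. c)"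
  by (rule mpoly_fun.const)

lemma PT_var [PT_rules]: "PT (\<lambda>e. e i)"
  by (rule mpoly_fun.var) simp

lemma PT_add [PT_rules]: "PT f \<Longrightarrow> PT g \<Longrightarrow> PT (\<lambda>e. f e + g e)"
  by (rule mpoly_fun.add)

lemma PT_mult [PT_rules]: "PT f \<Longrightarrow> PT g \<Longrightarrow> PT (\<lambda>e. f e * g e)"
  by (rule mpoly_fun.mult)

lemma PT_minus [PT_rules]: "PT f \<Longrightarrow> PT (\<lambda>e. - f e)"
  using PT_mult[OF PT_const[of "-1"], of f] by simp

lemma PT_diff [PT_rules]: "PT f \<Longrightarrow> PT g \<Longrightarrow> PT (\<lambda>e. f e - g e)"
  using PT_add[OF _ PT_minus, of f g] by simp

lemma PT_power [PT_rules]: "PT f \<Longrightarrow> PT (\<lambda>e. f e ^ n)"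
  by (induction n) (auto intro: PT_rules)

lemma PT_sum [PT_rules]: "(\<And>i. i \<in> I \<Longrightarrow> PT (f i)) \<Longrightarrow> PT (\<lambda>e. \<Sum>i\<in>I. f i e)"
  by (induction I rule: infinite_finite_induct) (auto intro: PT_rules)

lemma PT_prod [PT_rules]: "(\<And>i. i \<in> I \<Longrightarrow> PT (f i)) \<Longrightarrow> PT (\<lambda>e. \<Prod>i\<in>I. f i e)"
  by (induction I rule: infinite_finite_induct) (auto intro: PT_rules)

lemma PT_case_nat [PT_rules]:
  "PT f \<Longrightarrow> (\<And>k. PT (s k)) \<Longrightarrow> PT (\<lambda>e. case i of 0 \<Rightarrow> f e | Suc k \<Rightarrow> s k e)"
  by (cases i) auto

lemma PT_subst: "PT f \<Longrightarrow> (\<And>i. PT (s i)) \<Longrightarrow> PT (\<lambda>e. f (\<lambda>i. s i e))"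
  by (induction rule: mpoly_fun.induct) (auto intro: PT_rules)

text \<open>Strict positivity is the only kind of atom, equations being obtained by negating two
  inequalities. Every induction over \<open>qf\<close> thus has a single base case: the sign of one
  polynomial.\<close>

inductive qf :: "(env \<Rightarrow> bool) \<Rightarrow> bool" where
  pos: "PT f \<Longrightarrow> qf (\<lambda>e. f e > 0)"
| neg: "qf A \<Longrightarrow> qf (\<lambda>e. \<not> A e)"
| conj: "qf A \<Longrightarrow> qf B \<Longrightarrow> qf (\<lambda>e. A e \<and> B e)"

lemma qf_disj: "qf A \<Longrightarrow> qf B \<Longrightarrow> qf (\<lambda>e. A e \<or> B e)"
  using qf.neg[OF qf.conj[OF qf.neg qf.neg], of A B] by simp

lemma qf_imp: "qf A \<Longrightarrow> qf B \<Longrightarrow> qf (\<lambda>e. A e \<longrightarrow> B e)"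
  using qf_disj[OF qf.neg, of A B] by simp

lemma qf_iff: "qf A \<Longrightarrow> qf B \<Longrightarrow> qf (\<lambda>e. A e \<longleftrightarrow> B e)"
  using qf.conj[OF qf_imp qf_imp, of A B B A] by (simp add: iff_conv_conj_imp[symmetric])

lemma qf_less: "PT f \<Longrightarrow> PT g \<Longrightarrow> qf (\<lambda>e. f e < g e)"
  using qf.pos[OF PT_diff, of g f] by simp

lemma qf_le: "PT f \<Longrightarrow> PT g \<Longrightarrow> qf (\<lambda>e. f e \<le> g e)"
  using qf.neg[OF qf_less, of g f] by (simp add: not_less)

lemma qf_eq: "PT f \<Longrightarrow> PT g \<Longrightarrow> qf (\<lambda>e. f e = g e)"
  using qf.conj[OF qf_le qf_le, of f g g f] by (simp add: eq_iff)

lemma qf_const: "qf (\<lambda>e. c)"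
  using qf_less[of "\<lambda>e. 0" "\<lambda>e. of_bool c"] by (cases c) (auto intro: PT_rules)

lemma qf_ball_finite: "finite I \<Longrightarrow> (\<And>i. i \<in> I \<Longrightarrow> qf (A i)) \<Longrightarrow> qf (\<lambda>e. \<forall>i\<in>I. A i e)"
  by (induction I rule: finite_induct) (auto intro: qf.conj qf_const)

lemma qf_bex_finite: "finite I \<Longrightarrow> (\<And>i. i \<in> I \<Longrightarrow> qf (A i)) \<Longrightarrow> qf (\<lambda>e. \<exists>i\<in>I. A i e)"
  using qf.neg[OF qf_ball_finite[of I "\<lambda>i e. \<not> A i e"]] by (auto intro: qf.neg)

lemmas qf_rules = qf.neg qf.conj qf_disj qf_imp qf_iff qf_less qf_le qf_eq qf_const
  qf_ball_finite qf_bex_finite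

lemma qf_subst: "qf A \<Longrightarrow> (\<And>i. PT (s i)) \<Longrightarrow> qf (\<lambda>e. A (\<lambda>i. s i e))"
proof (induction rule: qf.induct)
  case (pos f)
  show ?case by (rule qf.pos, rule PT_subst) (fact pos)+
next
  case (neg A)
  then show ?case by (intro qf.neg) simp
next
  case (conj A B)
  then show ?case by (intro qf.conj) simp_all
qed


section \<open>Effective functions\<close>

text \<open>The substitution \<open>s\<close> makes the notion stable under further parameters, so that
  several effective functions can be substituted one after the other.\<close>

definition eff :: "(env \<Rightarrow> real) \<Rightarrow> bool" where
  "eff \<xi> \<longleftrightarrow> (\<forall>A s. qf A \<longrightarrow> (\<forall>i. PT (s i)) \<longrightarrow> qf (\<lambda>e. A (case_nat (\<xi> (\<lambda>i. s i e)) e)))"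

text \<open>The form in which effectiveness is applied: \<open>B\<close> has to be definable with
  the substituted value as variable 0 and the other parameters shifted up by one.\<close>

lemma eff_subst1:
  assumes "eff \<xi>" "\<And>i. PT (s i)" "qf (\<lambda>e. B (e 0) (\<lambda>i. e (Suc i)))"
  shows "qf (\<lambda>e. B (\<xi> (\<lambda>i. s i e)) e)"
  using assms(1)[unfolded eff_def, rule_format, OF assms(3,2)] by simp

lemma eff_subst:
  assumes "eff \<xi>" "qf (\<lambda>e. B (e 0) (\<lambda>i. e (Suc i)))"
  shows "qf (\<lambda>e. B (\<xi> e) e)"
  using eff_subst1[OF assms(1) PT_var assms(2)] by simp

lemma eff_subst2:
  assumes "eff \<xi>" "eff \<eta>" "qf (\<lambda>e. B (e 0) (e (Suc 0)) (\<lambda>i. e (Suc (Suc i))))"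
  shows "qf (\<lambda>e. B (\<xi> e) (\<eta> e) e)"
  by (rule eff_subst[OF assms(2), where B = "\<lambda>y e. B (\<xi> e) y e"],
      rule eff_subst1[OF assms(1) PT_var, where B = "\<lambda>x e. B x (e 0) (\<lambda>i. e (Suc i))"],
      rule assms(3))

lemma eff_comp:
  assumes "eff \<xi>" "\<And>i. PT (s i)"
  shows "eff (\<lambda>e. \<xi> (\<lambda>i. s i e))"
  unfolding eff_def
proof (intro allI impI)
  fix A and t :: "nat \<Rightarrow> env \<Rightarrow> real" assume "qf A" "\<forall>i. PT (t i)"
  then show "qf (\<lambda>e. A (case_nat (\<xi> (\<lambda>i. s i (\<lambda>j. t j e))) e))"
    using assms(1)[unfolded eff_def, rule_format, of A "\<lambda>i e. s i (\<lambda>j. t j e)"]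
    by (simp add: PT_subst assms(2))
qed

lemma qf_case_nat_subst:
  assumes "qf A" "PT f" "\<And>i. PT (s i)"
  shows "qf (\<lambda>e. A (case_nat (f e) (\<lambda>i. s i e)))"
proof -
  have "qf (\<lambda>e. A (\<lambda>i. case i of 0 \<Rightarrow> f e | Suc k \<Rightarrow> s k e))"
    by (rule qf_subst[OF assms(1)]) (auto intro: PT_rules assms)
  then show ?thesis by simp
qed

lemma eff_PT: "PT f \<Longrightarrow> eff f"
  unfolding eff_def by (intro allI impI qf_case_nat_subst PT_var, assumption, rule PT_subst) auto

text \<open>Constant coefficients cover everything that is built from roots: midpoints and unit
  translates for the sample points, negatives for reflected roots.\<close>

lemma eff_affine:
  assumes "eff \<xi>" "eff \<eta>"
  shows "eff (\<lambda>e. a * \<xi> e + b * \<eta> e + c)"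
  unfolding eff_def
proof (intro allI impI)
  fix A and s :: "nat \<Rightarrow> env \<Rightarrow> real" assume A: "qf A" and s: "\<forall>i. PT (s i)"
  show "qf (\<lambda>e. A (case_nat (a * \<xi> (\<lambda>i. s i e) + b * \<eta> (\<lambda>i. s i e) + c) e))"
    by (rule eff_subst2[OF eff_comp eff_comp, OF assms(1) _ assms(2),
          where B = "\<lambda>x y e. A (case_nat (a * x + b * y + c) e)"])
      (auto intro!: s[rule_format] qf_case_nat_subst A PT_rules)
qed

lemma eff_mid: "eff \<xi> \<Longrightarrow> eff \<eta> \<Longrightarrow> eff (\<lambda>e. (\<xi> e + \<eta> e) / 2)"
  using eff_affine[of \<xi> \<eta> "1/2" "1/2" 0] by (simp add: add_divide_distrib)

lemma eff_add_const: "eff \<xi> \<Longrightarrow> eff (\<lambda>e. \<xi> e + c)"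
  using eff_affine[of \<xi> \<xi> 1 0 c] by simp

lemma eff_uminus: "eff \<xi> \<Longrightarrow> eff (\<lambda>e. - \<xi> e)"
  using eff_affine[of \<xi> \<xi> "-1" 0 0] by simp

lemma qf_eff_less:
  assumes "eff \<xi>" "eff \<eta>"
  shows "qf (\<lambda>e. \<xi> e < \<eta> e)"
  by (rule eff_subst2[OF assms, where B = "\<lambda>x y e. x < y"]) (intro qf_rules PT_rules)


section \<open>Families of univariate polynomials\<close>

text \<open>The degree is only bounded by \<open>N\<close>, since the leading coefficient depends on
  the parameters and may vanish for some of them.\<close>

definition pfam :: "nat \<Rightarrow> (env \<Rightarrow> real poly) \<Rightarrow> bool" where
  "pfam N q \<longleftrightarrow> (\<forall>i. PT (\<lambda>e. coeff (q e) i)) \<and> (\<forall>e. degree (q e) \<le> N)"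

lemma poly_eq_sum_le:
  fixes p :: "real poly"
  assumes "degree p \<le> N"
  shows "poly p x = (\<Sum>i\<le>N. coeff p i * x ^ i)"
  unfolding poly_altdef using assms
  by (intro sum.mono_neutral_left) (auto simp: coeff_eq_0)

lemma PT_poly:
  assumes "pfam N q" "PT t" "\<And>i. PT (s i)"
  shows "PT (\<lambda>e. poly (q (\<lambda>i. s i e)) (t e))"
proof -
  have "(\<lambda>e. poly (q (\<lambda>i. s i e)) (t e)) = (\<lambda>e. \<Sum>i\<le>N. coeff (q (\<lambda>i. s i e)) i * t e ^ i)"
    using assms(1) by (auto simp: pfam_def poly_eq_sum_le)
  moreover have "PT (\<lambda>e. coeff (q (\<lambda>i. s i e)) i)" for i
    by (rule PT_subst[of "\<lambda>e. coeff (q e) i"]) (use assms in \<open>auto simp: pfam_def\<close>)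
  ultimately show ?thesis
    by (auto intro!: PT_rules assms(2))
qed

lemma pfam_coeff: "pfam N q \<Longrightarrow> (\<And>i. PT (s i)) \<Longrightarrow> PT (\<lambda>e. coeff (q (\<lambda>i. s i e)) i)"
  by (rule PT_subst[of "\<lambda>e. coeff (q e) i"]) (auto simp: pfam_def)

text \<open>Isolates the variable to be eliminated, which \<open>case_nat\<close> puts in front,
  from the parameters, which go into the coefficients.\<close>

lemma PT_pfam:
  assumes "PT f"
  shows "\<exists>N q. pfam N q \<and> (\<forall>x e. f (case_nat x e) = poly (q e) x)"
  using assms
proof (induction rule: mpoly_fun.induct)
  case (const c)
  have "pfam 0 (\<lambda>e. [:c:])"
    by (auto simp: pfam_def intro: PT_rules)
  then show ?case by (intro exI[of _ 0] exI[of _ "\<lambda>e. [:c:]"]) auto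
next
  case (var i)
  show ?case
  proof (cases i)
    case 0
    have "pfam 1 (\<lambda>e. [:0, 1:])"
      by (auto simp: pfam_def intro: PT_rules)
    then show ?thesis using 0 by (intro exI[of _ 1] exI[of _ "\<lambda>e. [:0,1:]"]) auto
  next
    case (Suc k)
    have "pfam 0 (\<lambda>e. [:e k:])"
      by (auto simp: pfam_def coeff_pCons intro: PT_rules split: nat.split)
    then show ?thesis using Suc by (intro exI[of _ 0] exI[of _ "\<lambda>e. [:e k:]"]) auto
  qed
next
  case (add f g)
  then obtain N q M r where "pfam N q" "\<forall>x e. f (case_nat x e) = poly (q e) x"
    "pfam M r" "\<forall>x e. g (case_nat x e) = poly (r e) x" by blast
  then show ?case
    by (intro exI[of _ "max N M"] exI[of _ "\<lambda>e. q e + r e"])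
      (auto simp: pfam_def intro!: PT_rules order.trans[OF degree_add_le_max max.mono])
next
  case (mult f g)
  then obtain N q M r where "pfam N q" "\<forall>x e. f (case_nat x e) = poly (q e) x"
    "pfam M r" "\<forall>x e. g (case_nat x e) = poly (r e) x" by blast
  then show ?case
    by (intro exI[of _ "N + M"] exI[of _ "\<lambda>e. q e * r e"])
      (auto simp: pfam_def coeff_mult intro!: PT_rules order.trans[OF degree_mult_le] add_mono)
qed


section \<open>Sample points\<close>

text \<open>Meets every piece into which the values of \<open>\<Xi>\<close> cut the line: the values
  themselves (midpoints with \<xi> = \<eta>), the gaps between neighbours and the two unbounded
  ends. All pairs are taken because the order of the values, hence the neighbours, changes with
  \<open>e\<close>.\<close>

definition samples :: "(env \<Rightarrow> real) set \<Rightarrow> (env \<Rightarrow> real) set" where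
  "samples \<Xi> = (\<Union>\<xi>\<in>\<Xi>. \<Union>\<eta>\<in>\<Xi>. {\<lambda>e. (\<xi> e + \<eta> e) / 2, \<lambda>e. \<xi> e + 1, \<lambda>e. \<xi> e + (-1)})"

definition same_position :: "(env \<Rightarrow> real) set \<Rightarrow> env \<Rightarrow> real \<Rightarrow> real \<Rightarrow> bool" where
  "same_position \<Xi> e x t \<longleftrightarrow> (\<forall>h\<in>\<Xi>. (x < h e \<longleftrightarrow> t < h e) \<and> (h e < x \<longleftrightarrow> h e < t))"

lemma finite_samples: "finite \<Xi> \<Longrightarrow> finite (samples \<Xi>)"
  by (simp add: samples_def)

lemma eff_samples: "(\<And>\<xi>. \<xi> \<in> \<Xi> \<Longrightarrow> eff \<xi>) \<Longrightarrow> t \<in> samples \<Xi> \<Longrightarrow> eff t"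
  by (auto simp: samples_def intro: eff_mid eff_add_const eff_add_const[of _ "-1", simplified])

lemma samples_mid: "\<xi> \<in> \<Xi> \<Longrightarrow> \<eta> \<in> \<Xi> \<Longrightarrow> (\<lambda>e. (\<xi> e + \<eta> e) / 2) \<in> samples \<Xi>"
  and samples_plus: "\<xi> \<in> \<Xi> \<Longrightarrow> (\<lambda>e. \<xi> e + 1) \<in> samples \<Xi>"
  and samples_minus: "\<xi> \<in> \<Xi> \<Longrightarrow> (\<lambda>e. \<xi> e + (-1)) \<in> samples \<Xi>"
  unfolding samples_def by blast+

text \<open>The four cases use, in this order, the value itself as a degenerate midpoint, a unit
  step below the least value, a unit step above the greatest value, and the midpoint of the two
  neighbours of \<open>x\<close>.\<close>

lemma ex_sample:
  assumes "finite \<Xi>" "\<Xi> \<noteq> {}"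
  shows "\<exists>t\<in>samples \<Xi>. same_position \<Xi> e x (t e)"
proof -
  define H where "H = (\<lambda>h. h e) ` \<Xi>"
  define L where "L = {h \<in> H. h < x}"
  define U where "U = {h \<in> H. x < h}"
  have fin: "finite H" "H \<noteq> {}" "finite L" "finite U"
    using assms by (auto simp: H_def L_def U_def)
  consider "x \<in> H" | "x \<notin> H" "L = {}" | "x \<notin> H" "U = {}" | "x \<notin> H" "L \<noteq> {}" "U \<noteq> {}"
    by blast
  then show ?thesis
  proof cases
    case 1
    then obtain h where "h \<in> \<Xi>" "x = h e" by (auto simp: H_def)
    then show ?thesis
      by (intro bexI[OF _ samples_mid[of h \<Xi> h]]) (auto simp: same_position_def)
  next
    case 2
    have *: "x < h e" if "h \<in> \<Xi>" for h
    proof -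
      have "h e \<in> H" using that by (simp add: H_def)
      then have "h e \<noteq> x" "\<not> h e < x" using 2 by (auto simp: L_def)
      then show ?thesis by simp
    qed
    have "Min H \<in> H" using fin by simp
    then obtain m where m: "m \<in> \<Xi>" "Min H = m e" by (auto simp: H_def)
    have le: "m e \<le> h e" if "h \<in> \<Xi>" for h
      using Min_le[OF fin(1), of "h e"] that m(2) by (simp add: H_def)
    have "same_position \<Xi> e x (m e + (-1))"
      unfolding same_position_def
    proof
      fix h assume "h \<in> \<Xi>"
      then show "(x < h e) = (m e + (-1) < h e) \<and> (h e < x) = (h e < m e + (-1))"
        using *[of h] le[of h] by linarith
    qed
    then show ?thesis
      by (rule bexI[OF _ samples_minus[OF m(1)]])
  next
    case 3
    have *: "h e < x" if "h \<in> \<Xi>" for h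
    proof -
      have "h e \<in> H" using that by (simp add: H_def)
      then have "h e \<noteq> x" "\<not> x < h e" using 3 by (auto simp: U_def)
      then show ?thesis by simp
    qed
    have "Max H \<in> H" using fin by simp
    then obtain m where m: "m \<in> \<Xi>" "Max H = m e" by (auto simp: H_def)
    have le: "h e \<le> m e" if "h \<in> \<Xi>" for h
      using Max_ge[OF fin(1), of "h e"] that m(2) by (simp add: H_def)
    have "same_position \<Xi> e x (m e + 1)"
      unfolding same_position_def
    proof
      fix h assume "h \<in> \<Xi>"
      then show "(x < h e) = (m e + 1 < h e) \<and> (h e < x) = (h e < m e + 1)"
        using *[of h] le[of h] by linarith
    qed
    then show ?thesis
      by (rule bexI[OF _ samples_plus[OF m(1)]])
  next
    case 4
    have "Max L \<in> L" "Min U \<in> U" using fin 4 by auto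
    then obtain a b where a: "a \<in> \<Xi>" "Max L = a e" "a e < x" and b: "b \<in> \<Xi>" "Min U = b e" "x < b e"
      by (auto simp: L_def U_def H_def)
    have pos: "h e \<le> a e \<and> h e < x \<or> b e \<le> h e \<and> x < h e" if "h \<in> \<Xi>" for h
    proof -
      have "h e \<in> L \<or> h e \<in> U"
        using 4(1) that by (auto simp: L_def U_def H_def)
      then show ?thesis
        using Max_ge[OF fin(3), of "h e"] Min_le[OF fin(4), of "h e"] a b
        by (auto simp: L_def U_def)
    qed
    have "same_position \<Xi> e x ((a e + b e) / 2)"
      unfolding same_position_def
    proof
      fix h assume "h \<in> \<Xi>"
      have "a e < (a e + b e) / 2" "(a e + b e) / 2 < b e" using a(3) b(3) by simp_all
      with pos[OF \<open>h \<in> \<Xi>\<close>]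
      show "(x < h e) = ((a e + b e) / 2 < h e) \<and> (h e < x) = (h e < (a e + b e) / 2)"
        by linarith
    qed
    then show ?thesis
      by (rule bexI[OF _ samples_mid[OF a(1) b(1)]])
  qed
qed


section \<open>Roots of polynomial families are effective\<close>

definition captures :: "(env \<Rightarrow> real) set \<Rightarrow> (env \<Rightarrow> real poly) \<Rightarrow> bool" where
  "captures \<Xi> q \<longleftrightarrow> finite \<Xi> \<and> (\<forall>\<xi>\<in>\<Xi>. eff \<xi>)
     \<and> (\<forall>e x. q e \<noteq> 0 \<longrightarrow> poly (q e) x = 0 \<longrightarrow> (\<exists>\<xi>\<in>\<Xi>. x = \<xi> e))"

definition roots_effective :: "nat \<Rightarrow> bool" where
  "roots_effective d \<longleftrightarrow> (\<forall>q. pfam d q \<longrightarrow> (\<exists>\<Xi>. captures \<Xi> q))"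

text \<open>A change of sign between \<open>x\<close> and \<open>t\<close> forces a root between
  them by the intermediate value theorem. This root is the value of some member of
  \<open>\<Xi>\<close>, which would then tell the two points apart.\<close>

lemma captures_sign:
  assumes "captures \<Xi> q" "same_position \<Xi> e x t"
  shows "poly (q e) x > 0 \<longleftrightarrow> poly (q e) t > 0"
proof (rule ccontr)
  assume neq: "\<not> ?thesis"
  then have q: "q e \<noteq> 0" by auto
  have False if "same_position \<Xi> e x t" "x < t"
      "poly (q e) x > 0 \<longleftrightarrow> \<not> poly (q e) t > 0" for x t
  proof -
    \<comment> \<open>Only positive and non-positive values are distinguished, so the root may be
      one of the end points; hence the weak inequalities.\<close>
    have "\<exists>r. x \<le> r \<and> r \<le> t \<and> poly (q e) r = 0"
      using poly_IVT_pos[OF that(2), of "q e"] poly_IVT_neg[OF that(2), of "q e"] that(2,3)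
      by (metis less_eq_real_def linorder_neqE_linordered_idom)
    then obtain r where r: "x \<le> r" "r \<le> t" "poly (q e) r = 0" by blast
    then obtain \<xi> where "\<xi> \<in> \<Xi>" "r = \<xi> e"
      using assms(1) q unfolding captures_def by blast
    with that r show False
      by (force simp: same_position_def)
  qed
  note * = this
  have "same_position \<Xi> e t x" using assms(2) by (auto simp: same_position_def)
  with * neq assms(2) show False
    by (metis linorder_neqE_linordered_idom)
qed

text \<open>A root \<open>\<xi>\<close> of \<open>p\<close> is effective once it can be compared with
  parameters: the sign of \<open>q\<close> at \<open>\<xi>\<close> does not change when
  \<open>q\<close> is replaced by its pseudo-remainder modulo \<open>p\<close>, whose roots are
  effective because of its lower degree; it remains to locate \<open>\<xi>\<close> among these.\<close>

lemma eff_rootI: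
  assumes RD: "roots_effective d" and p: "pfam (Suc d) p" and B: "qf B"
    and root: "\<And>e. B e \<Longrightarrow> coeff (p e) (Suc d) \<noteq> 0 \<and> poly (p e) (\<xi> e) = 0"
    and less: "qf (\<lambda>e. B (\<lambda>i. e (Suc i)) \<and> e 0 < \<xi> (\<lambda>i. e (Suc i)))"
    and greater: "qf (\<lambda>e. B (\<lambda>i. e (Suc i)) \<and> \<xi> (\<lambda>i. e (Suc i)) < e 0)"
    and zero: "\<And>e. \<not> B e \<Longrightarrow> \<xi> e = 0"
    and A: "qf A"
  shows "qf (\<lambda>e. A (case_nat (\<xi> e) e))"
proof -
  have claim: "qf (\<lambda>e. B e \<and> 0 < poly (q e) (\<xi> e))" if "pfam N q" for N q
    using that
  proof (induction N arbitrary: q rule: less_induct)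
    case (less N)
    show ?case
    proof (cases "N \<le> d")
      case True
      then have "pfam d q" using less.prems by (auto simp: pfam_def intro: order.trans)
      then obtain \<Xi>0 where \<Xi>0: "captures \<Xi>0 q" using RD by (auto simp: roots_effective_def)
      \<comment> \<open>The added function makes the set non-empty, as \<open>ex_sample\<close>
        demands.\<close>
      define \<Xi> where "\<Xi> = insert (\<lambda>e. 0) \<Xi>0"
      have \<Xi>: "captures \<Xi> q" "\<Xi> \<noteq> {}"
        using \<Xi>0 by (auto simp: captures_def \<Xi>_def intro: eff_PT PT_rules)
      then have fin: "finite \<Xi>" and ef: "\<And>\<xi>. \<xi> \<in> \<Xi> \<Longrightarrow> eff \<xi>"
        by (auto simp: captures_def)
      \<comment> \<open>Comparisons with the root are only known to be definable in conjunction with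
        \<open>B\<close>, so \<open>B\<close> is repeated inside the description of the
        position.\<close>
      have eq: "(B e \<and> 0 < poly (q e) (\<xi> e)) \<longleftrightarrow> (\<exists>t\<in>samples \<Xi>. B e \<and> (\<forall>h\<in>\<Xi>.
          ((B e \<and> \<xi> e < h e) \<longleftrightarrow> t e < h e) \<and> ((B e \<and> h e < \<xi> e) \<longleftrightarrow> h e < t e)) \<and> 0 < poly (q e) (t e))"
        for e
      proof -
        have "(B e \<and> 0 < poly (q e) (\<xi> e)) \<longleftrightarrow> (\<exists>t\<in>samples \<Xi>. B e \<and> same_position \<Xi> e (\<xi> e) (t e)
            \<and> 0 < poly (q e) (t e))"
          using captures_sign[OF \<Xi>(1)] ex_sample[OF fin \<Xi>(2)] by blast
        then show ?thesis unfolding same_position_def by (simp cong: conj_cong)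
      qed
      have "qf (\<lambda>e. B e \<and> \<xi> e < h e)" if "h \<in> \<Xi>" for h
        by (rule eff_subst[OF ef[OF that], where B = "\<lambda>x e. B e \<and> \<xi> e < x"]) (rule greater)
      moreover have "qf (\<lambda>e. B e \<and> h e < \<xi> e)" if "h \<in> \<Xi>" for h
        by (rule eff_subst[OF ef[OF that], where B = "\<lambda>x e. B e \<and> x < \<xi> e"]) (rule assms(5))
      moreover have "qf (\<lambda>e. 0 < poly (q e) (t e))" if "t \<in> samples \<Xi>" for t
        by (rule eff_subst[OF eff_samples[OF ef that], where B = "\<lambda>x e. 0 < poly (q e) x"])
          (auto intro!: qf_rules PT_rules PT_poly[OF less.prems])
      moreover have "qf (\<lambda>e. t e < h e)" if "t \<in> samples \<Xi>" "h \<in> \<Xi>" for t h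
        by (rule qf_eff_less[OF eff_samples[OF ef that(1)] ef[OF that(2)]])
      moreover have "qf (\<lambda>e. h e < t e)" if "t \<in> samples \<Xi>" "h \<in> \<Xi>" for t h
        by (rule qf_eff_less[OF ef[OF that(2)] eff_samples[OF ef that(1)]])
      ultimately have "qf (\<lambda>e. B e \<and> (\<forall>h\<in>\<Xi>. ((B e \<and> \<xi> e < h e) \<longleftrightarrow> t e < h e)
          \<and> ((B e \<and> h e < \<xi> e) \<longleftrightarrow> h e < t e)) \<and> 0 < poly (q e) (t e))" if "t \<in> samples \<Xi>" for t
        using that by (intro qf.conj[OF B qf.conj] qf_ball_finite[OF fin] qf.conj[OF qf_iff qf_iff])
      with eq show ?thesis
        by (simp only: eq) (rule qf_bex_finite[OF finite_samples[OF fin]])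
    next
      case False
      then obtain M where M: "N = Suc M" "d \<le> M" by (cases N) auto
      \<comment> \<open>One step of pseudo-division. The square of the leading coefficient keeps the
        sign, the subtracted multiple of \<open>p\<close> vanishes at the root, and the coefficients
        of degree \<open>N\<close> cancel.\<close>
      define q1 where "q1 = (\<lambda>e. smult ((coeff (p e) (Suc d))^2) (q e)
        - smult (coeff (p e) (Suc d) * coeff (q e) N) (monom 1 (M - d) * p e))"
      have "pfam M q1"
        unfolding pfam_def
      proof (intro conjI allI)
        show "PT (\<lambda>e. coeff (q1 e) i)" for i
          using less.prems p by (cases "i < M - d") (auto simp: q1_def coeff_monom_mult pfam_def intro!: PT_rules)
        show "degree (q1 e) \<le> M" for e
        proof (rule degree_le, intro allI impI)
          fix i assume i: "M < i"
          have dq: "degree (q e) \<le> Suc M" "degree (p e) \<le> Suc d"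
            using less.prems p M by (auto simp: pfam_def)
          show "coeff (q1 e) i = 0"
          proof (cases "i = Suc M")
            case True
            then show ?thesis using M
              by (simp add: q1_def coeff_monom_mult power2_eq_square Suc_diff_le)
          next
            case False
            then have "coeff (q e) i = 0" "coeff (p e) (i - (M - d)) = 0"
              using dq i M by (auto intro!: coeff_eq_0)
            then show ?thesis by (simp add: q1_def coeff_monom_mult)
          qed
        qed
      qed
      from less.IH[OF _ this] have "qf (\<lambda>e. B e \<and> 0 < poly (q1 e) (\<xi> e))"
        using M by simp
      moreover have "(B e \<and> 0 < poly (q1 e) (\<xi> e)) \<longleftrightarrow> (B e \<and> 0 < poly (q e) (\<xi> e))" for e
        using root[of e] by (auto simp: q1_def zero_less_mult_iff)
      ultimately show ?thesis by simp
    qed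
  qed
  show ?thesis
    using A
  proof (induction rule: qf.induct)
    case (pos f)
    then obtain N q where q: "pfam N q" "\<And>x e. f (case_nat x e) = poly (q e) x"
      using PT_pfam by blast
    \<comment> \<open>Where \<open>B\<close> fails, \<xi> has its default value 0, and the sign is
      that of the constant coefficient.\<close>
    then have "0 < f (case_nat (\<xi> e) e) \<longleftrightarrow> (B e \<and> 0 < poly (q e) (\<xi> e)) \<or> (\<not> B e \<and> 0 < poly (q e) 0)" for e
      using zero[of e] by (cases "B e") auto
    moreover have "qf (\<lambda>e. 0 < poly (q e) 0)"
      using PT_poly[OF q(1) PT_const PT_var] by (rule qf.pos)
    ultimately show ?case
      by (simp only:) (rule qf_disj[OF claim[OF q(1)] qf.conj[OF qf.neg[OF B]]])
  next
    case (neg A)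
    then show ?case by (intro qf.neg)
  next
    case (conj A C)
    then show ?case by (intro qf.conj)
  qed
qed

text \<open>All hypotheses of \<open>eff_rootI\<close> are stable under a polynomial change of
  parameters. Applying it to the reparametrized data yields the extra substitution \<open>s\<close>
  that \<open>eff\<close> asks for.\<close>

lemma eff_rootI':
  assumes RD: "roots_effective d" and p: "pfam (Suc d) p" and B: "qf B"
    and root: "\<And>e. B e \<Longrightarrow> coeff (p e) (Suc d) \<noteq> 0 \<and> poly (p e) (\<xi> e) = 0"
    and less: "qf (\<lambda>e. B (\<lambda>i. e (Suc i)) \<and> e 0 < \<xi> (\<lambda>i. e (Suc i)))"
    and greater: "qf (\<lambda>e. B (\<lambda>i. e (Suc i)) \<and> \<xi> (\<lambda>i. e (Suc i)) < e 0)"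
    and zero: "\<And>e. \<not> B e \<Longrightarrow> \<xi> e = 0"
  shows "eff \<xi>"
  unfolding eff_def
proof (intro allI impI)
  fix A and s :: "nat \<Rightarrow> env \<Rightarrow> real" assume A: "qf A" and s: "\<forall>i. PT (s i)"
  have s': "PT (\<lambda>e. s i (\<lambda>k. e (Suc k)))" for i
    by (rule PT_subst[of "s i" "\<lambda>k e. e (Suc k)"]) (auto intro: s[rule_format] PT_var)
  show "qf (\<lambda>e. A (case_nat (\<xi> (\<lambda>i. s i e)) e))"
  proof (rule eff_rootI[OF RD, where p = "\<lambda>e. p (\<lambda>i. s i e)" and B = "\<lambda>e. B (\<lambda>i. s i e)"])
    show "pfam (Suc d) (\<lambda>e. p (\<lambda>i. s i e))"
      using p s by (auto simp: pfam_def intro: pfam_coeff[OF p])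
    show "qf (\<lambda>e. B (\<lambda>i. s i e))" by (rule qf_subst[OF B]) (use s in simp)
    show "qf (\<lambda>e. B (\<lambda>i. s i (\<lambda>i. e (Suc i))) \<and> e 0 < \<xi> (\<lambda>i. s i (\<lambda>i. e (Suc i))))"
      using qf_case_nat_subst[OF less, of "\<lambda>e. e 0" "\<lambda>i e. s i (\<lambda>k. e (Suc k))"] s'
      by (simp add: PT_var)
    show "qf (\<lambda>e. B (\<lambda>i. s i (\<lambda>i. e (Suc i))) \<and> \<xi> (\<lambda>i. s i (\<lambda>i. e (Suc i))) < e 0)"
      using qf_case_nat_subst[OF greater, of "\<lambda>e. e 0" "\<lambda>i e. s i (\<lambda>k. e (Suc k))"] s'
      by (simp add: PT_var)
  qed (use root zero A in auto)
qed

section \<open>Locating a root between consecutive critical points\<close>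

text \<open>Rolle: two different roots would enclose a zero of the derivative.\<close>

lemma root_unique:
  fixes p :: "real poly"
  assumes "\<And>x. a < x \<Longrightarrow> x < b \<Longrightarrow> poly (pderiv p) x \<noteq> 0"
    and "a \<le> r" "r \<le> b" "a \<le> s" "s \<le> b" "poly p r = 0" "poly p s = 0"
  shows "r = s"
proof (rule ccontr)
  assume "r \<noteq> s"
  have False if rs: "u < v" "a \<le> u" "v \<le> b" "poly p u = 0" "poly p v = 0" for u v
  proof -
    obtain x where "u < x" "x < v" "poly p v - poly p u = (v - u) * poly (pderiv p) x"
      using poly_MVT[OF rs(1), of p] by blast
    with assms(1)[of x] rs show False by auto
  qed
  with \<open>r \<noteq> s\<close> assms show False
    by (metis linorder_neqE_linordered_idom)
qed

text \<open>The last conjunct is the comparison criterion. By the intermediate value theorem on the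
  parts left and right of \<open>y\<close>, and by uniqueness, \<open>p\<close> keeps its sign at
  \<open>a\<close> exactly as long as the root has not been passed.\<close>

lemma root_between:
  fixes p :: "real poly"
  assumes crit: "\<And>x. a < x \<Longrightarrow> x < b \<Longrightarrow> poly (pderiv p) x \<noteq> 0"
    and ab: "a < b" and sign: "poly p a * poly p b < 0"
  shows "\<exists>r. a < r \<and> r < b \<and> poly p r = 0 \<and>
    (\<forall>y. a < y \<longrightarrow> y < b \<longrightarrow> (poly p y = 0 \<longrightarrow> y = r) \<and> (y < r \<longleftrightarrow> poly p y * poly p a > 0))"
proof -
  obtain r where r: "a < r" "r < b" "poly p r = 0"
    using poly_IVT[OF ab sign] by blast
  have uniq: "y = r" if "a < y" "y < b" "poly p y = 0" for y
    using root_unique[where a = a and b = b and p = p, OF crit, of y r] that r by simp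
  moreover have "y < r \<longleftrightarrow> poly p y * poly p a > 0" if y: "a < y" "y < b" for y
  proof
    assume "y < r"
    show "poly p y * poly p a > 0"
    proof (rule ccontr)
      assume "\<not> ?thesis"
      moreover have "poly p y \<noteq> 0" "poly p a \<noteq> 0"
        using uniq[of y] y \<open>y < r\<close> sign by auto
      ultimately have "poly p a * poly p y < 0"
        by (simp add: mult.commute less_le not_less)
      then obtain z where "a < z" "z < y" "poly p z = 0"
        using poly_IVT[OF y(1)] by blast
      then show False using uniq[of z] y \<open>y < r\<close> by simp
    qed
  next
    assume s: "poly p y * poly p a > 0"
    show "y < r"
    proof (rule ccontr)
      assume "\<not> y < r"
      with s r have "r < y" by (cases "y = r") auto
      have "poly p y * poly p b < 0"
        using s sign by (auto simp: zero_less_mult_iff mult_less_0_iff)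
      then obtain z where "y < z" "z < b" "poly p z = 0"
        using poly_IVT[OF y(2)] by blast
      then show False using uniq[of z] y \<open>r < y\<close> by simp
    qed
  qed
  ultimately show ?thesis using r by blast
qed

lemma poly_large_sign:
  fixes p :: "real poly"
  assumes "p \<noteq> 0"
  shows "\<exists>b0. \<forall>b\<ge>b0. lead_coeff p * poly p b > 0"
proof (cases "lead_coeff p > 0")
  case True
  then obtain n where n: "\<And>x. x \<ge> n \<Longrightarrow> poly p x \<ge> lead_coeff p"
    using poly_pinfty_gt_lc[of p] by blast
  have "lead_coeff p * poly p x > 0" if "x \<ge> n" for x
    using n[OF that] True by (intro mult_pos_pos) linarith+
  then show ?thesis by blast
next
  case False
  with assms have "lead_coeff (- p) > 0" by (simp add: less_le)
  then obtain n where n: "\<And>x. x \<ge> n \<Longrightarrow> poly (- p) x \<ge> lead_coeff (- p)"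
    using poly_pinfty_gt_lc[of "- p"] by blast
  have "lead_coeff p * poly p x > 0" if "x \<ge> n" for x
    using n[OF that] \<open>lead_coeff (- p) > 0\<close> by (intro mult_neg_neg) auto
  then show ?thesis by blast
qed

text \<open>The sign of the leading coefficient, taken by \<open>p\<close> far to the right,
  replaces the value at a right end point. Uniqueness identifies the roots obtained from different
  right end points.\<close>

lemma root_right:
  fixes p :: "real poly"
  assumes crit: "\<And>x. a < x \<Longrightarrow> poly (pderiv p) x \<noteq> 0"
    and sign: "lead_coeff p * poly p a < 0"
  shows "\<exists>r. a < r \<and> poly p r = 0 \<and>
    (\<forall>y. a < y \<longrightarrow> (poly p y = 0 \<longrightarrow> y = r) \<and> (y < r \<longleftrightarrow> poly p y * poly p a > 0))"
proof -
  have "p \<noteq> 0" using sign by auto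
  then obtain b0 where b0: "\<And>b. b \<ge> b0 \<Longrightarrow> lead_coeff p * poly p b > 0"
    using poly_large_sign by blast
  have s: "poly p a * poly p b < 0" if "b \<ge> b0" for b
    using b0[OF that] sign by (auto simp: zero_less_mult_iff mult_less_0_iff)
  have uniq: "y = r" if "a < y" "poly p y = 0" "a < r" "poly p r = 0" for y r
    using root_unique[of a "max y r" p y r] crit that by (auto simp: less_imp_le)
  define b1 where "b1 = max b0 (a + 1)"
  have "b1 \<ge> b0" "a < b1" by (auto simp: b1_def)
  then obtain r where r: "a < r" "poly p r = 0"
    using poly_IVT[OF _ s, of b1] by blast
  have "(poly p y = 0 \<longrightarrow> y = r) \<and> (y < r \<longleftrightarrow> poly p y * poly p a > 0)" if y: "a < y" for y
  proof -
    define b where "b = max b0 (max y r + 1)"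
    have b: "b \<ge> b0" "a < b" "y < b" "r < b" using y r by (auto simp: b_def)
    obtain r' where r': "a < r'" "poly p r' = 0"
      "\<forall>y. a < y \<longrightarrow> y < b \<longrightarrow> (poly p y = 0 \<longrightarrow> y = r') \<and> (y < r' \<longleftrightarrow> poly p y * poly p a > 0)"
      using root_between[where a = a and b = b and p = p, OF crit b(2) s[OF b(1)]] by blast
    have "r' = r" using uniq[OF r'(1,2) r] .
    with r'(3) y b show ?thesis by simp
  qed
  then show ?thesis using r by blast
qed

text \<open>Without zeros in the interval the derivative keeps its sign, so \<open>p\<close> takes
  values of opposite sign on the two sides of its root. This converse of \<open>root_between\<close>
  shows that a search by signs misses no root.\<close>

lemma root_between_sign:
  fixes p :: "real poly"
  assumes crit: "\<And>x. a < x \<Longrightarrow> x < b \<Longrightarrow> poly (pderiv p) x \<noteq> 0"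
    and r: "a < r" "r < b" "poly p r = 0"
  shows "poly p a * poly p b < 0"
proof -
  obtain u where u: "a < u" "u < r" "poly p r - poly p a = (r - a) * poly (pderiv p) u"
    using poly_MVT[OF r(1), of p] by blast
  obtain v where v: "r < v" "v < b" "poly p b - poly p r = (b - r) * poly (pderiv p) v"
    using poly_MVT[OF r(2), of p] by blast
  have "\<not> poly (pderiv p) u * poly (pderiv p) v < 0"
  proof
    assume "poly (pderiv p) u * poly (pderiv p) v < 0"
    then obtain z where "u < z" "z < v" "poly (pderiv p) z = 0"
      using poly_IVT[of u v "pderiv p"] u v by auto
    then show False using crit[of z] u v by auto
  qed
  moreover have "poly (pderiv p) u \<noteq> 0" "poly (pderiv p) v \<noteq> 0"
    using crit u v r by auto
  ultimately have "poly (pderiv p) u * poly (pderiv p) v > 0"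
    by (metis less_linear mult_eq_0_iff)
  moreover have "poly p a * poly p b = - ((r - a) * (b - r) * (poly (pderiv p) u * poly (pderiv p) v))"
  proof -
    have "poly p a = - ((r - a) * poly (pderiv p) u)" "poly p b = (b - r) * poly (pderiv p) v"
      using u v r by simp_all
    then show ?thesis by (simp only:) (simp add: algebra_simps)
  qed
  moreover have "(r - a) * (b - r) > 0" using r by simp
  ultimately show ?thesis by (simp add: mult_pos_pos)
qed

text \<open>The unbounded analogue, again with a sufficiently large right end point.\<close>

lemma root_right_sign:
  fixes p :: "real poly"
  assumes crit: "\<And>x. a < x \<Longrightarrow> poly (pderiv p) x \<noteq> 0"
    and r: "a < r" "poly p r = 0" and "p \<noteq> 0"
  shows "lead_coeff p * poly p a < 0"
proof -
  obtain b0 where b0: "\<And>b. b \<ge> b0 \<Longrightarrow> lead_coeff p * poly p b > 0"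
    using poly_large_sign[OF \<open>p \<noteq> 0\<close>] by blast
  define b where "b = max b0 (r + 1)"
  have "poly p a * poly p b < 0"
    using root_between_sign[of a b p r] crit r by (auto simp: b_def)
  moreover have "lead_coeff p * poly p b > 0" by (rule b0) (simp add: b_def)
  ultimately show ?thesis by (auto simp: zero_less_mult_iff mult_less_0_iff)
qed

text \<open>Adding the constant \<open>0\<close> to the critical points ensures that a positive root has a
  nearest point on its left. Negative roots are obtained by reflection.\<close>

lemma positive_roots_effective:
  assumes RD: "roots_effective d" and q: "pfam (Suc d) q"
  shows "\<exists>\<Xi>. finite \<Xi> \<and> (\<forall>\<xi>\<in>\<Xi>. eff \<xi>) \<and>
    (\<forall>e x. coeff (q e) (Suc d) \<noteq> 0 \<longrightarrow> x > 0 \<longrightarrow> poly (q e) x = 0 \<longrightarrow> (\<exists>\<xi>\<in>\<Xi>. x = \<xi> e))"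
proof -
  have "pfam d (\<lambda>e. pderiv (q e))"
    using q by (auto simp: pfam_def coeff_pderiv degree_pderiv le_diff_conv intro!: PT_mult PT_const)
  then obtain Z0 where Z0: "captures Z0 (\<lambda>e. pderiv (q e))"
    using RD by (auto simp: roots_effective_def)
  define Z where "Z = insert (\<lambda>e. 0) Z0"
  have Z: "finite Z" "\<And>z. z \<in> Z \<Longrightarrow> eff z" "(\<lambda>e. 0) \<in> Z"
    using Z0 by (auto simp: captures_def Z_def intro: eff_PT PT_rules)
  have Zcrit: "\<exists>z\<in>Z. x = z e" if "coeff (q e) (Suc d) \<noteq> 0" "poly (pderiv (q e)) x = 0" for e x
  proof -
    have "coeff (pderiv (q e)) d \<noteq> 0" using that by (simp add: coeff_pderiv)
    then have "pderiv (q e) \<noteq> 0" by (metis coeff_0)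
    then show ?thesis using Z0 that unfolding captures_def Z_def by blast
  qed
  have lc: "lead_coeff (q e) = coeff (q e) (Suc d)" if "coeff (q e) (Suc d) \<noteq> 0" for e
  proof -
    have "degree (q e) = Suc d" using q le_degree[OF that] by (simp add: pfam_def le_antisym)
    then show ?thesis by simp
  qed
  \<comment> \<open>The open interval from \<open>a e\<close> to \<open>b e\<close> is a bracket:
    free of critical points, with opposite signs at its ends. Which pairs form brackets depends on
    \<open>e\<close>, so every pair of \<open>Z\<close> gets its own root function.\<close>
  define Bb where "Bb a b e \<longleftrightarrow> coeff (q e) (Suc d) \<noteq> 0 \<and> a e < b e
      \<and> (\<forall>z\<in>Z. \<not> (a e < z e \<and> z e < b e)) \<and> poly (q e) (a e) * poly (q e) (b e) < 0" for a b e
  \<comment> \<open>The value 0 off the brackets is the default prescribed by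
    \<open>eff_rootI'\<close>.\<close>
  define rb where "rb a b e = (if Bb a b e then THE r. a e < r \<and> r < b e \<and> poly (q e) r = 0 else 0)" for a b e
  \<comment> \<open>The coefficient of degree \<open>Suc d\<close> stands in for the leading
    coefficient: it is polynomial in the parameters, and the two agree where it is nonzero.\<close>
  define Bu where "Bu a e \<longleftrightarrow> coeff (q e) (Suc d) \<noteq> 0
      \<and> (\<forall>z\<in>Z. \<not> a e < z e) \<and> coeff (q e) (Suc d) * poly (q e) (a e) < 0" for a e
  define ru where "ru a e = (if Bu a e then THE r. a e < r \<and> poly (q e) r = 0 else 0)" for a e
  have rb: "a e < rb a b e \<and> rb a b e < b e \<and> poly (q e) (rb a b e) = 0 \<and>
      (\<forall>y. a e < y \<longrightarrow> y < b e \<longrightarrow> (poly (q e) y = 0 \<longrightarrow> y = rb a b e) \<and> (y < rb a b e \<longleftrightarrow> poly (q e) y * poly (q e) (a e) > 0))"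
    if B: "Bb a b e" for a b e
  proof -
    have crit: "poly (pderiv (q e)) x \<noteq> 0" if "a e < x" "x < b e" for x
      using B Zcrit[of e x] that by (auto simp: Bb_def)
    have "a e < b e" "poly (q e) (a e) * poly (q e) (b e) < 0" using B by (auto simp: Bb_def)
    from root_between[OF crit this] obtain r where r: "a e < r" "r < b e" "poly (q e) r = 0"
        "\<forall>y. a e < y \<longrightarrow> y < b e \<longrightarrow> (poly (q e) y = 0 \<longrightarrow> y = r) \<and> (y < r \<longleftrightarrow> poly (q e) y * poly (q e) (a e) > 0)"
      by blast
    have "(THE r. a e < r \<and> r < b e \<and> poly (q e) r = 0) = r"
      by (rule the_equality) (use r(1-3) in \<open>simp\<close>, use r(4) in \<open>blast\<close>)
    then have rb_eq: "rb a b e = r" using B by (simp add: rb_def)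
    show ?thesis unfolding rb_eq by (intro conjI r)
  qed
  have ru: "a e < ru a e \<and> poly (q e) (ru a e) = 0 \<and>
      (\<forall>y. a e < y \<longrightarrow> (poly (q e) y = 0 \<longrightarrow> y = ru a e) \<and> (y < ru a e \<longleftrightarrow> poly (q e) y * poly (q e) (a e) > 0))"
    if B: "Bu a e" for a e
  proof -
    have crit: "poly (pderiv (q e)) x \<noteq> 0" if "a e < x" for x
      using B Zcrit[of e x] that by (auto simp: Bu_def)
    have "lead_coeff (q e) * poly (q e) (a e) < 0" using B lc[of e] by (auto simp: Bu_def)
    from root_right[OF crit this] obtain r where r: "a e < r" "poly (q e) r = 0"
        "\<forall>y. a e < y \<longrightarrow> (poly (q e) y = 0 \<longrightarrow> y = r) \<and> (y < r \<longleftrightarrow> poly (q e) y * poly (q e) (a e) > 0)"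
      by blast
    have "(THE r. a e < r \<and> poly (q e) r = 0) = r"
      by (rule the_equality) (use r(1-2) in \<open>simp\<close>, use r(3) in \<open>blast\<close>)
    then have ru_eq: "ru a e = r" using B by (simp add: ru_def)
    show ?thesis unfolding ru_eq by (intro conjI r)
  qed
  have qfBb: "qf (Bb a b)" if ab: "a \<in> Z" "b \<in> Z" for a b
  proof -
    have 1: "qf (\<lambda>e. coeff (q e) (Suc d) \<noteq> 0)"
      using pfam_coeff[OF q, of "\<lambda>i e. e i"] by (auto intro!: qf.neg qf_eq PT_rules)
    have 2: "qf (\<lambda>e. poly (q e) (a e) * poly (q e) (b e) < 0)"
      by (rule eff_subst2[OF Z(2)[OF ab(1)] Z(2)[OF ab(2)], where B = "\<lambda>x y e. poly (q e) x * poly (q e) y < 0"])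
        (intro qf_less PT_rules PT_poly[OF q])
    show ?thesis unfolding Bb_def
      by (rule qf.conj[OF 1 qf.conj[OF _ qf.conj[OF qf_ball_finite[OF Z(1) qf.neg[OF qf.conj]] 2]]])
        (auto intro: qf_eff_less Z ab)
  qed
  have qfBu: "qf (Bu a)" if a: "a \<in> Z" for a
  proof -
    have 1: "qf (\<lambda>e. coeff (q e) (Suc d) \<noteq> 0)"
      using pfam_coeff[OF q, of "\<lambda>i e. e i"] by (auto intro!: qf.neg qf_eq PT_rules)
    have 2: "qf (\<lambda>e. coeff (q e) (Suc d) * poly (q e) (a e) < 0)"
      by (rule eff_subst[OF Z(2)[OF a], where B = "\<lambda>x e. coeff (q e) (Suc d) * poly (q e) x < 0"])
        (intro qf_less PT_rules PT_poly[OF q] pfam_coeff[OF q])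
    show ?thesis unfolding Bu_def
      by (rule qf.conj[OF 1 qf.conj[OF qf_ball_finite[OF Z(1) qf.neg] 2]])
        (auto intro: qf_eff_less Z a)
  qed
  have effsh: "eff (\<lambda>e. z (\<lambda>i. e (Suc i)))" if "z \<in> Z" for z
    by (rule eff_comp[OF Z(2)[OF that]]) (rule PT_var)
  have eff0: "eff (\<lambda>e. e 0)" by (intro eff_PT PT_var)
  have P: "qf (\<lambda>e. 0 < poly (q (\<lambda>i. e (Suc i))) (e 0) * poly (q (\<lambda>i. e (Suc i))) (a (\<lambda>i. e (Suc i))))"
       "qf (\<lambda>e. poly (q (\<lambda>i. e (Suc i))) (e 0) * poly (q (\<lambda>i. e (Suc i))) (a (\<lambda>i. e (Suc i))) < 0)"
    if a: "a \<in> Z" for a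
  proof -
    have "qf (\<lambda>e. 0 < poly (q (\<lambda>i. e (Suc (Suc i)))) (e (Suc 0)) * poly (q (\<lambda>i. e (Suc (Suc i)))) (e 0))"
      "qf (\<lambda>e. poly (q (\<lambda>i. e (Suc (Suc i)))) (e (Suc 0)) * poly (q (\<lambda>i. e (Suc (Suc i)))) (e 0) < 0)"
      using PT_poly[OF q, where s = "\<lambda>i e. e (Suc (Suc i))"] by (auto intro!: qf_less PT_rules)
    note * = this
    show "qf (\<lambda>e. 0 < poly (q (\<lambda>i. e (Suc i))) (e 0) * poly (q (\<lambda>i. e (Suc i))) (a (\<lambda>i. e (Suc i))))"
      by (rule eff_subst[OF effsh[OF a], where B = "\<lambda>x e. 0 < poly (q (\<lambda>i. e (Suc i))) (e 0) * poly (q (\<lambda>i. e (Suc i))) x"])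
        (rule *(1))
    show "qf (\<lambda>e. poly (q (\<lambda>i. e (Suc i))) (e 0) * poly (q (\<lambda>i. e (Suc i))) (a (\<lambda>i. e (Suc i))) < 0)"
      by (rule eff_subst[OF effsh[OF a], where B = "\<lambda>x e. poly (q (\<lambda>i. e (Suc i))) (e 0) * poly (q (\<lambda>i. e (Suc i))) x < 0"])
        (rule *(2))
  qed
  have shift: "qf A \<Longrightarrow> qf (\<lambda>e. A (\<lambda>i. e (Suc i)))" for A
    by (erule qf_subst) (rule PT_var)
  have "eff (rb a b)" if ab: "a \<in> Z" "b \<in> Z" for a b
  proof (rule eff_rootI'[OF RD q qfBb[OF ab]])
    show "coeff (q e) (Suc d) \<noteq> 0 \<and> poly (q e) (rb a b e) = 0" if "Bb a b e" for e
      using rb[OF that] that by (auto simp: Bb_def)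
    \<comment> \<open>A number outside the bracket is compared with the root by comparing it with
      the end points; inside, the sign relative to the sign at \<open>a\<close> decides.\<close>
    have "(Bb a b (\<lambda>i. e (Suc i)) \<and> e 0 < rb a b (\<lambda>i. e (Suc i))) \<longleftrightarrow> Bb a b (\<lambda>i. e (Suc i)) \<and>
        (\<not> a (\<lambda>i. e (Suc i)) < e 0 \<or> e 0 < b (\<lambda>i. e (Suc i)) \<and>
          0 < poly (q (\<lambda>i. e (Suc i))) (e 0) * poly (q (\<lambda>i. e (Suc i))) (a (\<lambda>i. e (Suc i))))" for e
      using rb[of a b "\<lambda>i. e (Suc i)"] by (smt (verit))
    then show "qf (\<lambda>e. Bb a b (\<lambda>i. e (Suc i)) \<and> e 0 < rb a b (\<lambda>i. e (Suc i)))"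
      by (simp only:) (rule qf.conj[OF shift[OF qfBb[OF ab]] qf_disj[OF qf.neg qf.conj]];
        (rule qf_eff_less effsh ab eff0 P)+)
    have "(Bb a b (\<lambda>i. e (Suc i)) \<and> rb a b (\<lambda>i. e (Suc i)) < e 0) \<longleftrightarrow> Bb a b (\<lambda>i. e (Suc i)) \<and>
        (\<not> e 0 < b (\<lambda>i. e (Suc i)) \<or> a (\<lambda>i. e (Suc i)) < e 0 \<and>
          poly (q (\<lambda>i. e (Suc i))) (e 0) * poly (q (\<lambda>i. e (Suc i))) (a (\<lambda>i. e (Suc i))) < 0)" for e
      using rb[of a b "\<lambda>i. e (Suc i)"] unfolding Bb_def
      by (smt (verit) mult_eq_0_iff mult_less_0_iff)
    then show "qf (\<lambda>e. Bb a b (\<lambda>i. e (Suc i)) \<and> rb a b (\<lambda>i. e (Suc i)) < e 0)"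
      by (simp only:) (rule qf.conj[OF shift[OF qfBb[OF ab]] qf_disj[OF qf.neg qf.conj]];
        (rule qf_eff_less effsh ab eff0 P)+)
    show "rb a b e = 0" if "\<not> Bb a b e" for e using that by (simp add: rb_def)
  qed
  moreover have "eff (ru a)" if a: "a \<in> Z" for a
  proof (rule eff_rootI'[OF RD q qfBu[OF a]])
    show "coeff (q e) (Suc d) \<noteq> 0 \<and> poly (q e) (ru a e) = 0" if "Bu a e" for e
      using ru[OF that] that by (auto simp: Bu_def)
    have "(Bu a (\<lambda>i. e (Suc i)) \<and> e 0 < ru a (\<lambda>i. e (Suc i))) \<longleftrightarrow> Bu a (\<lambda>i. e (Suc i)) \<and>
        (\<not> a (\<lambda>i. e (Suc i)) < e 0 \<or>
          0 < poly (q (\<lambda>i. e (Suc i))) (e 0) * poly (q (\<lambda>i. e (Suc i))) (a (\<lambda>i. e (Suc i))))" for e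
      using ru[of a "\<lambda>i. e (Suc i)"] by (smt (verit))
    then show "qf (\<lambda>e. Bu a (\<lambda>i. e (Suc i)) \<and> e 0 < ru a (\<lambda>i. e (Suc i)))"
      by (simp only:) (rule qf.conj[OF shift[OF qfBu[OF a]] qf_disj[OF qf.neg]];
        (rule qf_eff_less effsh a eff0 P)+)
    have "(Bu a (\<lambda>i. e (Suc i)) \<and> ru a (\<lambda>i. e (Suc i)) < e 0) \<longleftrightarrow> Bu a (\<lambda>i. e (Suc i)) \<and>
        (a (\<lambda>i. e (Suc i)) < e 0 \<and>
          poly (q (\<lambda>i. e (Suc i))) (e 0) * poly (q (\<lambda>i. e (Suc i))) (a (\<lambda>i. e (Suc i))) < 0)" for e
      using ru[of a "\<lambda>i. e (Suc i)"] unfolding Bu_def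
      by (smt (verit) mult_eq_0_iff mult_less_0_iff)
    then show "qf (\<lambda>e. Bu a (\<lambda>i. e (Suc i)) \<and> ru a (\<lambda>i. e (Suc i)) < e 0)"
      by (simp only:) (rule qf.conj[OF shift[OF qfBu[OF a]] qf.conj];
        (rule qf_eff_less effsh a eff0 P)+)
    show "ru a e = 0" if "\<not> Bu a e" for e using that by (simp add: ru_def)
  qed
  \<comment> \<open>A root not in \<open>Z\<close> is enclosed by its nearest neighbours in
    \<open>Z\<close>, or has only a left one. The sign lemmas turn this into \<open>Bb\<close> or
    \<open>Bu\<close>, and uniqueness of the enclosed root finishes.\<close>
  moreover have "(\<exists>z\<in>Z. x = z e) \<or> (\<exists>a\<in>Z. \<exists>b\<in>Z. x = rb a b e) \<or> (\<exists>a\<in>Z. x = ru a e)"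
    if l: "coeff (q e) (Suc d) \<noteq> 0" and x: "x > 0" "poly (q e) x = 0" for e x
  proof (rule ccontr)
    assume neg: "\<not> ?thesis"
    have q0: "q e \<noteq> 0" using l by auto
    define L where "L = {h \<in> (\<lambda>z. z e) ` Z. h < x}"
    define U where "U = {h \<in> (\<lambda>z. z e) ` Z. x < h}"
    have fin: "finite L" "finite U" using Z by (auto simp: L_def U_def)
    have "0 \<in> L" using x Z(3) by (force simp: L_def)
    then have "Max L \<in> L" using fin by (intro Max_in) auto
    then obtain a where a: "a \<in> Z" "Max L = a e" "a e < x" by (auto simp: L_def)
    have amax: "z e \<le> a e" if "z \<in> Z" "z e < x" for z
      using Max_ge[OF fin(1), of "z e"] that a(2) by (simp add: L_def)
    have ne: "z e \<noteq> x" if "z \<in> Z" for z using neg that by auto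
    show False
    proof (cases "U = {}")
      case True
      have none: "\<not> a e < z e" if "z \<in> Z" for z
      proof -
        have "\<not> x < z e" using True that by (auto simp: U_def)
        then have "z e < x" using ne[OF that] by simp
        then show ?thesis using amax[OF that] by simp
      qed
      then have "poly (pderiv (q e)) y \<noteq> 0" if "a e < y" for y
        using Zcrit[OF l, of y] that by auto
      then have "lead_coeff (q e) * poly (q e) (a e) < 0"
        using root_right_sign[of "a e" "q e" x] a x q0 by auto
      then have "Bu a e" using l lc[OF l] none by (simp add: Bu_def)
      then have "x = ru a e" using ru[of a e] a x by blast
      with neg a show False by blast
    next
      case False
      then have "Min U \<in> U" using fin by (intro Min_in) auto
      then obtain b where b: "b \<in> Z" "Min U = b e" "x < b e" by (auto simp: U_def)
      have bmin: "b e \<le> z e" if "z \<in> Z" "x < z e" for z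
        using Min_le[OF fin(2), of "z e"] that b(2) by (simp add: U_def)
      have none: "\<not> (a e < z e \<and> z e < b e)" if "z \<in> Z" for z
        using amax[OF that] bmin[OF that] ne[OF that] by linarith
      then have "poly (pderiv (q e)) y \<noteq> 0" if "a e < y" "y < b e" for y
        using Zcrit[OF l, of y] that by auto
      then have "poly (q e) (a e) * poly (q e) (b e) < 0"
        using root_between_sign[of "a e" "b e" "q e" x] a b x by auto
      then have "Bb a b e" using l none a b by (auto simp: Bb_def)
      then have "x = rb a b e" using rb[of a b e] a b x by blast
      with neg a b show False by blast
    qed
  qed
  ultimately show ?thesis
    using Z by (intro exI[of _ "Z \<union> (\<Union>a\<in>Z. \<Union>b\<in>Z. {rb a b}) \<union> ru ` Z"])
      (simp, blast)
qed

text \<open>Where the coefficient of degree \<open>Suc d\<close> vanishes, the polynomial equals its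
  truncation and the induction hypothesis applies. Elsewhere the positive roots are known, the
  negative ones are positive roots of the reflected polynomial, and 0 is added by hand.\<close>

lemma roots_effective_all: "roots_effective d"
proof (induction d)
  case 0
  show ?case unfolding roots_effective_def
  proof (intro allI impI)
    fix q assume q: "pfam 0 q"
    have "captures {} q"
      unfolding captures_def
    proof (intro conjI allI impI ballI)
      fix e x assume "q e \<noteq> 0" "poly (q e) x = 0"
      moreover have "degree (q e) = 0" using q by (simp add: pfam_def)
      ultimately show "\<exists>\<xi>\<in>{}. x = \<xi> e" by (metis poly_all_0_iff_0 degree_eq_zeroE poly_pCons poly_0 mult_zero_right add_0_right)
    qed auto
    then show "\<exists>\<Xi>. captures \<Xi> q" by blast
  qed
next
  case (Suc d)
  show ?case unfolding roots_effective_def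
  proof (intro allI impI)
    fix q assume q: "pfam (Suc d) q"
    define q0 where "q0 = (\<lambda>e. q e - monom (coeff (q e) (Suc d)) (Suc d))"
    define q1 where "q1 = (\<lambda>e. pcompose (q e) [:0, -1:])"
    have "pfam d q0"
      unfolding pfam_def
    proof (intro conjI allI)
      show "PT (\<lambda>e. coeff (q0 e) i)" for i
        using q by (cases "i = Suc d") (auto simp: q0_def pfam_def intro!: PT_rules)
      show "degree (q0 e) \<le> d" for e
      proof (rule degree_le, intro allI impI)
        fix i assume "d < i"
        have "degree (q e) \<le> Suc d" using q by (simp add: pfam_def)
        then show "coeff (q0 e) i = 0"
          using \<open>d < i\<close> by (cases "i = Suc d") (auto simp: q0_def coeff_eq_0)
      qed
    qed
    then obtain \<Xi>0 where \<Xi>0: "captures \<Xi>0 q0" using Suc by (auto simp: roots_effective_def)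
    have q1: "pfam (Suc d) q1"
      using q by (auto simp: pfam_def q1_def coeff_pcompose_linear degree_pcompose intro!: PT_rules)
    obtain \<Xi>1 where \<Xi>1: "finite \<Xi>1" "\<forall>\<xi>\<in>\<Xi>1. eff \<xi>"
      "\<forall>e x. coeff (q e) (Suc d) \<noteq> 0 \<longrightarrow> x > 0 \<longrightarrow> poly (q e) x = 0 \<longrightarrow> (\<exists>\<xi>\<in>\<Xi>1. x = \<xi> e)"
      using positive_roots_effective[OF Suc q] by blast
    obtain \<Xi>2 where \<Xi>2: "finite \<Xi>2" "\<forall>\<xi>\<in>\<Xi>2. eff \<xi>"
      "\<forall>e x. coeff (q1 e) (Suc d) \<noteq> 0 \<longrightarrow> x > 0 \<longrightarrow> poly (q1 e) x = 0 \<longrightarrow> (\<exists>\<xi>\<in>\<Xi>2. x = \<xi> e)"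
      using positive_roots_effective[OF Suc q1] by blast
    define \<Xi> where "\<Xi> = \<Xi>0 \<union> \<Xi>1 \<union> (\<lambda>\<xi> e. - \<xi> e) ` \<Xi>2 \<union> {\<lambda>e. 0}"
    have "captures \<Xi> q"
      unfolding captures_def
    proof (intro conjI allI impI)
      show "finite \<Xi>" using \<Xi>0 \<Xi>1 \<Xi>2 by (auto simp: \<Xi>_def captures_def)
      show "\<forall>\<xi>\<in>\<Xi>. eff \<xi>"
        using \<Xi>0 \<Xi>1 \<Xi>2 by (auto simp: \<Xi>_def captures_def intro: eff_uminus eff_PT PT_rules)
      fix e x assume x: "q e \<noteq> 0" "poly (q e) x = 0"
      consider "coeff (q e) (Suc d) = 0" | "x = 0" | "coeff (q e) (Suc d) \<noteq> 0" "x > 0" | "coeff (q e) (Suc d) \<noteq> 0" "x < 0"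
        by linarith
      then show "\<exists>\<xi>\<in>\<Xi>. x = \<xi> e"
      proof cases
        case 1
        then have "q0 e = q e" by (simp add: q0_def)
        with x have "q0 e \<noteq> 0" "poly (q0 e) x = 0" by simp_all
        with \<Xi>0 have "\<exists>\<xi>\<in>\<Xi>0. x = \<xi> e" unfolding captures_def by blast
        then show ?thesis unfolding \<Xi>_def by blast
      next
        case 2
        then show ?thesis by (auto simp: \<Xi>_def)
      next
        case 3
        with x \<Xi>1(3) show ?thesis unfolding \<Xi>_def by blast
      next
        case 4
        then have "coeff (q1 e) (Suc d) \<noteq> 0" "- x > 0" "poly (q1 e) (- x) = 0"
          using x by (simp_all add: q1_def coeff_pcompose_linear poly_pcompose)
        then obtain \<xi> where "\<xi> \<in> \<Xi>2" "- x = \<xi> e" using \<Xi>2(3) by blast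
        then show ?thesis by (intro bexI[of _ "\<lambda>e. - \<xi> e"]) (auto simp: \<Xi>_def)
      qed
    qed
    then show "\<exists>\<Xi>. captures \<Xi> q" by blast
  qed
qed

section \<open>Quantifier elimination\<close>

text \<open>As a predicate of its first variable, \<open>A\<close> depends only on the position
  relative to finitely many effective functions. Hence it suffices to try the sample points, each of
  which may be substituted.\<close>

theorem qf_ex_case_nat:
  assumes "qf A"
  shows "qf (\<lambda>e. \<exists>x. A (case_nat x e))"
proof -
  have "\<exists>\<Xi>. finite \<Xi> \<and> (\<forall>\<xi>\<in>\<Xi>. eff \<xi>) \<and>
      (\<forall>e x y. same_position \<Xi> e x y \<longrightarrow> A (case_nat x e) = A (case_nat y e))"
    using assms
  proof (induction rule: qf.induct)
    case (pos f)
    then obtain N q where q: "pfam N q" "\<And>x e. f (case_nat x e) = poly (q e) x"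
      using PT_pfam by blast
    then obtain \<Xi> where "captures \<Xi> q" using roots_effective_all[of N] by (auto simp: roots_effective_def)
    then show ?case
      using captures_sign[of \<Xi> q] q by (intro exI[of _ \<Xi>]) (auto simp: captures_def)
  next
    case (neg A)
    then show ?case by simp
  next
    case (conj A B)
    then obtain X Y where X: "finite X" "\<forall>\<xi>\<in>X. eff \<xi>"
        "\<forall>e x y. same_position X e x y \<longrightarrow> A (case_nat x e) = A (case_nat y e)"
      and Y: "finite Y" "\<forall>\<xi>\<in>Y. eff \<xi>"
        "\<forall>e x y. same_position Y e x y \<longrightarrow> B (case_nat x e) = B (case_nat y e)"
      by blast
    have "same_position X e x y \<and> same_position Y e x y" if "same_position (X \<union> Y) e x y" for e x y
      using that by (auto simp: same_position_def)
    then show ?case using X Y by (intro exI[of _ "X \<union> Y"]) blast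
  qed
  then obtain X where X: "finite X" "\<And>\<xi>. \<xi> \<in> X \<Longrightarrow> eff \<xi>"
      "\<And>e x y. same_position X e x y \<Longrightarrow> A (case_nat x e) = A (case_nat y e)"
    by blast
  define \<Xi> where "\<Xi> = insert (\<lambda>e. 0) X"
  have \<Xi>: "finite \<Xi>" "\<Xi> \<noteq> {}" and ef: "\<And>\<xi>. \<xi> \<in> \<Xi> \<Longrightarrow> eff \<xi>"
    and same: "\<And>e x y. same_position \<Xi> e x y \<Longrightarrow> A (case_nat x e) = A (case_nat y e)"
    using X by (auto simp: \<Xi>_def same_position_def intro: eff_PT PT_rules)
  have "(\<exists>x. A (case_nat x e)) \<longleftrightarrow> (\<exists>t\<in>samples \<Xi>. A (case_nat (t e) e))" for e
    using ex_sample[OF \<Xi>] same by blast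
  moreover have "qf (\<lambda>e. A (case_nat (t e) e))" if "t \<in> samples \<Xi>" for t
    by (rule eff_subst[OF eff_samples[OF ef that], where B = "\<lambda>x e. A (case_nat x e)"])
      (auto intro: qf_case_nat_subst assms PT_var)
  ultimately show ?thesis
    by (simp only:) (rule qf_bex_finite[OF finite_samples[OF \<Xi>(1)]])
qed

section \<open>Definable families of vectors and sets\<close>

text \<open>A block of \<open>k\<close> variables at once. Only the first \<open>k\<close> entries
  of \<open>xs\<close> are read, so quantifying over an entire sequence amounts to quantifying over
  \<open>k\<close> reals.\<close>

lemma qf_ex_prefix:
  assumes "qf A"
  shows "qf (\<lambda>e. \<exists>xs. A (\<lambda>i. if i < k then xs i else e (i - k)))"
proof (induction k)
  case 0
  show ?case using assms by simp
next
  case (Suc k)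
  have "(\<exists>x xs. A (\<lambda>i. if i < k then xs i else case_nat x e (i - k)))
      \<longleftrightarrow> (\<exists>xs. A (\<lambda>i. if i < Suc k then xs i else e (i - Suc k)))" for e
  proof
    assume "\<exists>x xs. A (\<lambda>i. if i < k then xs i else case_nat x e (i - k))"
    then obtain x xs where "A (\<lambda>i. if i < k then xs i else case_nat x e (i - k))" by blast
    moreover have "(\<lambda>i. if i < k then xs i else case_nat x e (i - k))
        = (\<lambda>i. if i < Suc k then (xs(k := x)) i else e (i - Suc k))"
      by (auto split: nat.split simp: fun_eq_iff less_Suc_eq intro!: arg_cong[of _ _ e])
    ultimately show "\<exists>xs. A (\<lambda>i. if i < Suc k then xs i else e (i - Suc k))" by metis
  next
    assume "\<exists>xs. A (\<lambda>i. if i < Suc k then xs i else e (i - Suc k))"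
    then obtain xs where "A (\<lambda>i. if i < Suc k then xs i else e (i - Suc k))" by blast
    moreover have "(\<lambda>i. if i < k then xs i else case_nat (xs k) e (i - k))
        = (\<lambda>i. if i < Suc k then xs i else e (i - Suc k))"
      by (auto split: nat.split simp: fun_eq_iff less_Suc_eq intro!: arg_cong[of _ _ e])
    ultimately show "\<exists>x xs. A (\<lambda>i. if i < k then xs i else case_nat x e (i - k))" by metis
  qed
  with qf_ex_case_nat[OF Suc.IH] show ?case by simp
qed

text \<open>An arbitrary polynomial change of parameters, of which the shift caused by a new
  variable is an instance.\<close>

definition denv :: "(env \<Rightarrow> env) \<Rightarrow> bool" where
  "denv \<rho> \<longleftrightarrow> (\<forall>i. PT (\<lambda>e. \<rho> e i))"

definition pvec :: "(env \<Rightarrow> 'a::euclidean_space) \<Rightarrow> bool" where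
  "pvec x \<longleftrightarrow> (\<forall>b\<in>Basis. PT (\<lambda>e. x e \<bullet> b))"

lemma denv_id: "denv (\<lambda>e. e)"
  by (simp add: denv_def PT_var)

lemma PT_comp: "PT f \<Longrightarrow> denv \<rho> \<Longrightarrow> PT (\<lambda>e. f (\<rho> e))"
  using PT_subst[of f "\<lambda>i e. \<rho> e i"] by (simp add: denv_def)

lemma qf_comp: "qf A \<Longrightarrow> denv \<rho> \<Longrightarrow> qf (\<lambda>e. A (\<rho> e))"
  using qf_subst[of A "\<lambda>i e. \<rho> e i"] by (simp add: denv_def)

lemma denv_comp: "denv \<rho> \<Longrightarrow> denv \<sigma> \<Longrightarrow> denv (\<lambda>e. \<rho> (\<sigma> e))"
  unfolding denv_def[of \<rho>] denv_def[of "\<lambda>e. \<rho> (\<sigma> e)"] by (simp add: PT_comp[of "\<lambda>e. \<rho> e i" for i])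

lemma pvec_comp: "pvec x \<Longrightarrow> denv \<rho> \<Longrightarrow> pvec (\<lambda>e. x (\<rho> e))"
  by (simp add: pvec_def PT_comp[of "\<lambda>e. x e \<bullet> b" for b])

lemma pvec_real: "pvec x \<longleftrightarrow> PT x" for x :: "env \<Rightarrow> real"
  by (simp add: pvec_def)

lemma pvec_const: "pvec (\<lambda>e. c)"
  by (simp add: pvec_def PT_const)

lemma pvec_add: "pvec x \<Longrightarrow> pvec y \<Longrightarrow> pvec (\<lambda>e. x e + y e)"
  by (simp add: pvec_def inner_add_left PT_add)

lemma pvec_diff: "pvec x \<Longrightarrow> pvec y \<Longrightarrow> pvec (\<lambda>e. x e - y e)"
  by (simp add: pvec_def inner_diff_left PT_diff)

lemma pvec_minus: "pvec x \<Longrightarrow> pvec (\<lambda>e. - x e)"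
  by (simp add: pvec_def PT_minus)

lemma pvec_scaleR: "PT f \<Longrightarrow> pvec x \<Longrightarrow> pvec (\<lambda>e. f e *\<^sub>R x e)"
  by (simp add: pvec_def PT_mult)

lemma PT_inner: "pvec x \<Longrightarrow> pvec y \<Longrightarrow> PT (\<lambda>e. x e \<bullet> y e)"
  unfolding pvec_def by (subst euclidean_inner) (auto intro!: PT_sum PT_mult)

lemma PT_nth: "pvec x \<Longrightarrow> PT (\<lambda>e. x e $ i)" for x :: "env \<Rightarrow> real ^ 'n"
  by (simp add: pvec_def cart_eq_inner_axis axis_in_Basis_iff)

lemma pvec_vecI: "(\<And>i. PT (\<lambda>e. x e $ i)) \<Longrightarrow> pvec x" for x :: "env \<Rightarrow> real ^ 'n"
  by (auto simp: pvec_def Basis_vec_def inner_axis)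

lemma qf_vec_eq:
  assumes "pvec x" "pvec y"
  shows "qf (\<lambda>e. x e = y e)"
proof -
  have "(x e = y e) \<longleftrightarrow> (\<forall>b\<in>Basis. x e \<bullet> b = y e \<bullet> b)" for e
    by (auto intro: euclidean_eqI)
  with assms show ?thesis
    by (simp only: pvec_def) (intro qf_ball_finite qf_eq finite_Basis; blast)
qed

lemma qf_norm_less:
  assumes "pvec x" "PT f"
  shows "qf (\<lambda>e. norm (x e) < f e)"
  unfolding norm_lt_square
  by (intro qf_rules PT_rules PT_inner assms)

lemma qf_norm_eq_1:
  assumes "pvec x"
  shows "qf (\<lambda>e. norm (x e) = 1)"
  unfolding norm_eq_1
  by (intro qf_rules PT_rules PT_inner assms)

definition vec_of :: "env \<Rightarrow> 'a::euclidean_space" where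
  "vec_of e = (\<Sum>b\<in>Basis. e (to_nat_on Basis b) *\<^sub>R b)"

lemma vec_of_inner: "b \<in> Basis \<Longrightarrow> vec_of e \<bullet> b = e (to_nat_on Basis b)"
  by (simp add: vec_of_def)

lemma to_nat_on_less: "finite S \<Longrightarrow> x \<in> S \<Longrightarrow> to_nat_on S x < card S"
  using to_nat_on_finite[of S] by (auto simp: bij_betw_def)

lemma vec_of_cong: "(\<And>i. i < DIM('a) \<Longrightarrow> e i = e' i) \<Longrightarrow> (vec_of e :: 'a::euclidean_space) = vec_of e'"
  by (simp add: vec_of_def to_nat_on_less cong: sum.cong)

lemma vec_of_coeffs: "vec_of (\<lambda>i. x \<bullet> from_nat_into Basis i) = (x :: 'a::euclidean_space)"
  by (simp add: vec_of_def countable_finite euclidean_representation cong: sum.cong)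

text \<open>Since only the values on the finite set \<open>L\<close> matter, a function is coded by
  \<open>card L * DIM('a)\<close> reals. The last premise is stated for all polynomial families and
  changes of parameters, so that it can be discharged compositionally without seeing the
  coding.\<close>

lemma qf_ex_fun:
  fixes Q :: "('l \<Rightarrow> 'a::euclidean_space) \<Rightarrow> env \<Rightarrow> bool"
  assumes fin: "finite L"
    and indep: "\<And>N N' e. (\<And>l. l \<in> L \<Longrightarrow> N l = N' l) \<Longrightarrow> Q N e \<Longrightarrow> Q N' e"
    and Q: "\<And>\<nu> \<rho>. (\<And>l. pvec (\<lambda>e. \<nu> e l)) \<Longrightarrow> denv \<rho> \<Longrightarrow> qf (\<lambda>e. Q (\<nu> e) (\<rho> e))"
  shows "qf (\<lambda>e. \<exists>N. Q N e)"
proof -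
  define D where "D = DIM('a)"
  define m where "m = card L"
  define ix where "ix = to_nat_on L"
  have ix: "ix l < m" if "l \<in> L" for l
    using to_nat_on_less[OF fin that] by (simp add: ix_def m_def)
  \<comment> \<open>The value at \<open>l\<close> occupies the block of length \<open>D\<close> with
    number \<open>ix l\<close>; the old parameters follow after all blocks.\<close>
  define \<nu> :: "env \<Rightarrow> 'l \<Rightarrow> 'a" where
    "\<nu> = (\<lambda>e l. if l \<in> L then vec_of (\<lambda>i. e (ix l * D + i)) else 0)"
  define \<rho> :: "env \<Rightarrow> env" where "\<rho> = (\<lambda>e i. e (m * D + i))"
  have "qf (\<lambda>e. Q (\<nu> e) (\<rho> e))"
  proof (rule Q)
    show "pvec (\<lambda>e. \<nu> e l)" for l
      by (cases "l \<in> L") (auto simp: \<nu>_def pvec_def vec_of_inner PT_var PT_const)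
    show "denv \<rho>" by (simp add: denv_def \<rho>_def PT_var)
  qed
  from qf_ex_prefix[OF this, of "m * D"]
  have qf: "qf (\<lambda>e. \<exists>xs. Q (\<nu> (\<lambda>i. if i < m * D then xs i else e (i - m * D)))
      (\<rho> (\<lambda>i. if i < m * D then xs i else e (i - m * D))))" .
  have \<rho>: "\<rho> (\<lambda>i. if i < m * D then xs i else e (i - m * D)) = e" for xs e
    by (simp add: \<rho>_def)
  have "(\<exists>xs. Q (\<nu> (\<lambda>i. if i < m * D then xs i else e (i - m * D))) e) \<longleftrightarrow> (\<exists>N. Q N e)" for e
  proof
    assume "\<exists>N. Q N e"
    then obtain N where N: "Q N e" ..
    \<comment> \<open>Quotient and remainder by \<open>D\<close> recover the block and the
      coordinate inside it.\<close>
    define xs where "xs = (\<lambda>j. N (from_nat_into L (j div D)) \<bullet> from_nat_into Basis (j mod D))"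
    have eq: "\<nu> (\<lambda>i. if i < m * D then xs i else e (i - m * D)) l = N l" if l: "l \<in> L" for l
    proof -
      have "D > 0" by (simp add: D_def)
      have "ix l * D + i < m * D" if "i < D" for i
      proof -
        have "ix l * D + i < Suc (ix l) * D" using that by simp
        also have "\<dots> \<le> m * D" using ix[OF l] by (intro mult_le_mono1) simp
        finally show ?thesis .
      qed
      then have "\<nu> (\<lambda>i. if i < m * D then xs i else e (i - m * D)) l = vec_of (\<lambda>i. N l \<bullet> from_nat_into Basis i)"
        using l fin unfolding \<nu>_def
        by (simp, intro vec_of_cong) (simp add: xs_def ix_def D_def countable_finite)
      then show ?thesis by (simp add: vec_of_coeffs)
    qed
    show "\<exists>xs. Q (\<nu> (\<lambda>i. if i < m * D then xs i else e (i - m * D))) e"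
      by (rule exI[of _ xs], rule indep[OF _ N], rule eq[symmetric])
  qed blast
  with qf show ?thesis by (simp add: \<rho>)
qed

lemma qf_ex:
  fixes Q :: "'a::euclidean_space \<Rightarrow> env \<Rightarrow> bool"
  assumes "\<And>x \<rho>. pvec x \<Longrightarrow> denv \<rho> \<Longrightarrow> qf (\<lambda>e. Q (x e) (\<rho> e))"
  shows "qf (\<lambda>e. \<exists>x. Q x e)"
proof -
  have "qf (\<lambda>e. \<exists>N :: unit \<Rightarrow> 'a. Q (N ()) e)"
    by (rule qf_ex_fun[of "UNIV"]) (auto intro: assms)
  moreover have "(\<exists>N :: unit \<Rightarrow> 'a. Q (N ()) e) \<longleftrightarrow> (\<exists>x. Q x e)" for e
  proof
    assume "\<exists>x. Q x e"
    then obtain x where "Q x e" ..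
    then show "\<exists>N :: unit \<Rightarrow> 'a. Q (N ()) e" by (intro exI[of _ "\<lambda>_. x"])
  qed blast
  ultimately show ?thesis by simp
qed

lemma qf_all:
  fixes Q :: "'a::euclidean_space \<Rightarrow> env \<Rightarrow> bool"
  assumes "\<And>x \<rho>. pvec x \<Longrightarrow> denv \<rho> \<Longrightarrow> qf (\<lambda>e. Q (x e) (\<rho> e))"
  shows "qf (\<lambda>e. \<forall>x. Q x e)"
  using qf.neg[OF qf_ex[of "\<lambda>x e. \<not> Q x e"]] assms by (simp add: qf.neg)

lemmas qf_ex_real = qf_ex[where 'a = real, unfolded pvec_real]
lemmas qf_all_real = qf_all[where 'a = real, unfolded pvec_real]

text \<open>Testing membership along arbitrary points and reparametrizations avoids explicit variable
  shifts when quantifiers are introduced.\<close>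

definition dset :: "(env \<Rightarrow> 'a::euclidean_space set) \<Rightarrow> bool" where
  "dset S \<longleftrightarrow> (\<forall>x \<rho>. pvec x \<longrightarrow> denv \<rho> \<longrightarrow> qf (\<lambda>e. x e \<in> S (\<rho> e)))"

lemma dsetI: "(\<And>x \<rho>. pvec x \<Longrightarrow> denv \<rho> \<Longrightarrow> qf (\<lambda>e. x e \<in> S (\<rho> e))) \<Longrightarrow> dset S"
  by (simp add: dset_def)

lemma dset_comp: "dset S \<Longrightarrow> denv \<rho> \<Longrightarrow> dset (\<lambda>e. S (\<rho> e))"
  unfolding dset_def using denv_comp by blast

lemma qf_mem: "dset S \<Longrightarrow> pvec x \<Longrightarrow> qf (\<lambda>e. x e \<in> S e)"
  using denv_id unfolding dset_def by blast

lemma dset_Collect: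
  assumes "\<And>x \<rho>. pvec x \<Longrightarrow> denv \<rho> \<Longrightarrow> qf (\<lambda>e. Q (x e) (\<rho> e))"
  shows "dset (\<lambda>e. {x. Q x e})"
  by (rule dsetI) (simp add: assms)

lemma qf_bex:
  assumes "dset S" "\<And>x \<rho>. pvec x \<Longrightarrow> denv \<rho> \<Longrightarrow> qf (\<lambda>e. Q (x e) (\<rho> e))"
  shows "qf (\<lambda>e. \<exists>x\<in>S e. Q x e)"
  unfolding Bex_def by (rule qf_ex, rule qf.conj[OF qf_mem[OF dset_comp[OF assms(1)]] assms(2)])

lemma qf_ball:
  assumes "dset S" "\<And>x \<rho>. pvec x \<Longrightarrow> denv \<rho> \<Longrightarrow> qf (\<lambda>e. Q (x e) (\<rho> e))"
  shows "qf (\<lambda>e. \<forall>x\<in>S e. Q x e)"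
  unfolding Ball_def by (rule qf_all, rule qf_imp[OF qf_mem[OF dset_comp[OF assms(1)]] assms(2)])

lemma qf_subset: "dset S \<Longrightarrow> dset T \<Longrightarrow> qf (\<lambda>e. S e \<subseteq> T e)"
  unfolding subset_eq by (rule qf_ball, assumption, rule qf_mem[OF dset_comp])

lemma qf_set_eq: "dset S \<Longrightarrow> dset T \<Longrightarrow> qf (\<lambda>e. S e = T e)"
  unfolding set_eq_subset by (intro qf.conj qf_subset)

lemma qf_psubset: "dset S \<Longrightarrow> dset T \<Longrightarrow> qf (\<lambda>e. S e \<subset> T e)"
  unfolding psubset_eq by (intro qf.conj qf.neg qf_subset qf_set_eq)

lemma dset_empty: "dset (\<lambda>e. {})"
  by (rule dsetI) (simp add: qf_const)

lemma dset_UNIV: "dset (\<lambda>e. UNIV)"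
  by (rule dsetI) (simp add: qf_const)

lemma dset_Un: "dset S \<Longrightarrow> dset T \<Longrightarrow> dset (\<lambda>e. S e \<union> T e)"
  by (simp add: dset_def qf_disj)

lemma dset_Int: "dset S \<Longrightarrow> dset T \<Longrightarrow> dset (\<lambda>e. S e \<inter> T e)"
  by (simp add: dset_def qf.conj)

lemma dset_Diff: "dset S \<Longrightarrow> dset T \<Longrightarrow> dset (\<lambda>e. S e - T e)"
  by (simp add: dset_def qf.conj qf.neg)

lemma dset_insert: "pvec y \<Longrightarrow> dset T \<Longrightarrow> dset (\<lambda>e. insert (y e) (T e))"
  by (simp add: dset_def qf_disj qf_vec_eq pvec_comp)

lemma dset_INT_finite:
  "finite I \<Longrightarrow> (\<And>i. i \<in> I \<Longrightarrow> dset (S i)) \<Longrightarrow> dset (\<lambda>e. \<Inter>i\<in>I. S i e)"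
  by (simp add: dset_def qf_ball_finite)

lemma dset_UN_finite:
  "finite I \<Longrightarrow> (\<And>i. i \<in> I \<Longrightarrow> dset (S i)) \<Longrightarrow> dset (\<lambda>e. \<Union>i\<in>I. S i e)"
  by (simp add: dset_def qf_bex_finite)

section \<open>Closures, cones, spans and relative interiors\<close>

lemma dset_closure:
  assumes S: "dset S"
  shows "dset (\<lambda>e. closure (S e))"
proof (rule dsetI)
  fix x \<rho> assume x: "pvec (x :: env \<Rightarrow> 'a)" and \<rho>: "denv \<rho>"
  have "x e \<in> closure (S (\<rho> e)) \<longleftrightarrow> (\<forall>\<epsilon>. 0 < \<epsilon> \<longrightarrow> (\<exists>y\<in>S (\<rho> e). norm (y - x e) < \<epsilon>))" for e
    by (simp add: closure_approachable dist_norm)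
  moreover have "qf (\<lambda>e. \<forall>\<epsilon>. 0 < \<epsilon> \<longrightarrow> (\<exists>y\<in>S (\<rho> e). norm (y - x e) < \<epsilon>))"
    by (rule qf_all_real, rule qf_imp[OF qf_less[OF PT_const]], assumption,
        rule qf_bex[OF dset_comp[OF dset_comp[OF S \<rho>]]], assumption,
        rule qf_norm_less[OF pvec_diff[OF _ pvec_comp[OF pvec_comp[OF x]]] PT_comp])
  ultimately show "qf (\<lambda>e. x e \<in> closure (S (\<rho> e)))" by simp
qed

text \<open>Non-negative combinations of a fixed number of points can be written with a fixed number
  of quantifiers. Allowing 0 as a summand makes shorter sums available and gives \<open>{0}\<close>
  for empty \<open>X\<close>.\<close>

fun cone_sums :: "'a::euclidean_space set \<Rightarrow> nat \<Rightarrow> 'a set" where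
  "cone_sums X 0 = {0}"
| "cone_sums X (Suc k) = {x. \<exists>t. 0 \<le> t \<and> (\<exists>y\<in>insert 0 X. \<exists>s\<in>cone_sums X k. x = t *\<^sub>R y + s)}"

text \<open>A nonzero element of the cone is a multiple of a point of the convex hull, and
  Caratheodory writes that point with at most \<open>DIM('a) + 1\<close> elements of
  \<open>X\<close>. This bounds the length of the sums independently of \<open>X\<close>.\<close>

lemma convex_cone_hull_eq_cone_sums:
  "convex_cone hull X = cone_sums X (DIM('a) + 1)" for X :: "'a::euclidean_space set"
proof
  have "cone_sums X k \<subseteq> convex_cone hull X" for k
  proof (induction k)
    case 0
    show ?case by (simp add: convex_cone_hull_contains_0)
  next
    case (Suc k)
    have "y \<in> convex_cone hull X" if "y \<in> insert 0 X" for y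
      using that hull_subset[of X convex_cone] convex_cone_hull_contains_0[of X] by blast
    with Suc show ?case
      by (auto intro!: convex_cone_hull_add convex_cone_hull_mul)
  qed
  then show "cone_sums X (DIM('a) + 1) \<subseteq> convex_cone hull X" .
next
  \<comment> \<open>A summand with coefficient 0 pads a shorter sum.\<close>
  have mono: "cone_sums X k \<subseteq> cone_sums X (Suc k)" for k
  proof
    fix x assume "x \<in> cone_sums X k"
    then show "x \<in> cone_sums X (Suc k)"
      by (simp, intro exI[of _ 0] conjI) auto
  qed
  have sums: "(\<Sum>v\<in>S. u v *\<^sub>R v) \<in> cone_sums X k"
    if "finite S" "card S \<le> k" "S \<subseteq> X" "\<And>v. v \<in> S \<Longrightarrow> 0 \<le> u v" for S k u
    using that
  proof (induction S arbitrary: k rule: finite_induct)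
    case empty
    have "0 \<in> cone_sums X k"
    proof (induction k)
      case (Suc k)
      then show ?case using mono by blast
    qed simp
    then show ?case by simp
  next
    case (insert v S)
    then obtain k' where k: "k = Suc k'" "card S \<le> k'" by (cases k) auto
    have "(\<Sum>v\<in>S. u v *\<^sub>R v) \<in> cone_sums X k'" using insert k by auto
    moreover have "0 \<le> u v" "v \<in> insert 0 X" using insert by auto
    ultimately show ?case using insert k by (auto simp del: insert_iff)
  qed
  have zero: "0 \<in> cone_sums X (DIM('a) + 1)" using sums[of "{}" "DIM('a) + 1"] by (simp del: cone_sums.simps)
  have "c *\<^sub>R x \<in> cone_sums X (DIM('a) + 1)" if x: "x \<in> convex hull X" and c: "0 \<le> c" for x c
  proof -
    obtain S where S: "finite S" "S \<subseteq> X" "card S \<le> DIM('a) + 1" "x \<in> convex hull S"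
      using x unfolding caratheodory[of X] by blast
    have "\<exists>u. (\<forall>v\<in>S. 0 \<le> u v) \<and> sum u S = 1 \<and> (\<Sum>v\<in>S. u v *\<^sub>R v) = x"
      using S(4) unfolding convex_hull_finite[OF S(1)] by simp
    then obtain u where u: "\<forall>v\<in>S. 0 \<le> u v" "x = (\<Sum>v\<in>S. u v *\<^sub>R v)"
      by blast
    have "c *\<^sub>R x = (\<Sum>v\<in>S. (c * u v) *\<^sub>R v)" by (simp add: u scaleR_sum_right)
    then show ?thesis using sums[OF S(1,3,2), of "\<lambda>v. c * u v"] u c by (simp del: cone_sums.simps)
  qed
  then show "convex_cone hull X \<subseteq> cone_sums X (DIM('a) + 1)"
    using zero unfolding convex_cone_hull_convex_hull by (auto simp del: cone_sums.simps)
qed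

lemma dset_cone_sums:
  assumes S: "dset S"
  shows "dset (\<lambda>e. cone_sums (S e) k)"
proof (induction k)
  case 0
  show ?case using dset_insert[OF pvec_const dset_empty] by simp
next
  case (Suc k)
  show ?case unfolding cone_sums.simps
  proof (rule dset_Collect)
    fix x \<rho> assume x: "pvec (x :: env \<Rightarrow> 'a)" and \<rho>: "denv \<rho>"
    show "qf (\<lambda>e. \<exists>t. 0 \<le> t \<and> (\<exists>y\<in>insert 0 (S (\<rho> e)). \<exists>s\<in>cone_sums (S (\<rho> e)) k. x e = t *\<^sub>R y + s))"
    proof (rule qf_ex_real)
      fix t \<rho>1 assume t: "PT t" and \<rho>1: "denv \<rho>1"
      show "qf (\<lambda>e. 0 \<le> t e \<and> (\<exists>y\<in>insert 0 (S (\<rho> (\<rho>1 e))). \<exists>s\<in>cone_sums (S (\<rho> (\<rho>1 e))) k. x (\<rho>1 e) = t e *\<^sub>R y + s))"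
      proof (rule qf.conj[OF qf_le[OF PT_const t] qf_bex[OF dset_insert[OF pvec_const dset_comp[OF S denv_comp[OF \<rho> \<rho>1]]]]])
        fix y \<rho>2 assume y: "pvec (y :: env \<Rightarrow> 'a)" and \<rho>2: "denv \<rho>2"
        note \<rho>12 = denv_comp[OF \<rho>1 \<rho>2]
        show "qf (\<lambda>e. \<exists>s\<in>cone_sums (S (\<rho> (\<rho>1 (\<rho>2 e)))) k. x (\<rho>1 (\<rho>2 e)) = t (\<rho>2 e) *\<^sub>R y e + s)"
        proof (rule qf_bex[OF dset_comp[OF Suc denv_comp[OF \<rho> \<rho>12]]])
          fix s \<rho>3 assume s: "pvec (s :: env \<Rightarrow> 'a)" and \<rho>3: "denv \<rho>3"
          show "qf (\<lambda>e. x (\<rho>1 (\<rho>2 (\<rho>3 e))) = t (\<rho>2 (\<rho>3 e)) *\<^sub>R y (\<rho>3 e) + s e)"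
            by (rule qf_vec_eq[OF pvec_comp[OF x denv_comp[OF \<rho>12 \<rho>3]] pvec_add[OF pvec_scaleR[OF
                    PT_comp[OF t denv_comp[OF \<rho>2 \<rho>3]] pvec_comp[OF y \<rho>3]] s]])
        qed
      qed
    qed
  qed
qed

lemma dset_convex_cone_hull: "dset S \<Longrightarrow> dset (\<lambda>e. convex_cone hull (S e))"
  unfolding convex_cone_hull_eq_cone_sums by (rule dset_cone_sums)

lemma dset_differences:
  assumes S: "dset S" and T: "dset T"
  shows "dset (\<lambda>e. {x. \<exists>u\<in>S e. \<exists>v\<in>T e. x = u - v})"
  by (rule dset_Collect, rule qf_bex[OF dset_comp[OF S]], assumption,
      rule qf_bex[OF dset_comp[OF dset_comp[OF T]]], assumption+,
      rule qf_vec_eq[OF pvec_comp[OF pvec_comp] pvec_diff[OF pvec_comp]])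

text \<open>The differences already form a subspace: a negative scalar exchanges the roles of
  \<open>u\<close> and \<open>v\<close>. Two memberships in a cone thus replace linear combinations
  of arbitrary length.\<close>

lemma span_convex_cone:
  fixes K :: "'a::real_vector set"
  assumes "convex_cone K"
  shows "span K = {x. \<exists>u\<in>K. \<exists>v\<in>K. x = u - v}"
proof
  have 0: "0 \<in> K" and add: "\<And>x y. x \<in> K \<Longrightarrow> y \<in> K \<Longrightarrow> x + y \<in> K"
    and mul: "\<And>c x. x \<in> K \<Longrightarrow> 0 \<le> c \<Longrightarrow> c *\<^sub>R x \<in> K"
    using assms by (auto simp: convex_cone_iff)
  show "{x. \<exists>u\<in>K. \<exists>v\<in>K. x = u - v} \<subseteq> span K"
    by (auto intro: span_diff span_base)
  have "subspace {x. \<exists>u\<in>K. \<exists>v\<in>K. x = u - v}"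
  proof (rule subspaceI)
    show "0 \<in> {x. \<exists>u\<in>K. \<exists>v\<in>K. x = u - v}" using 0 by force
    fix x y assume "x \<in> {x. \<exists>u\<in>K. \<exists>v\<in>K. x = u - v}" "y \<in> {x. \<exists>u\<in>K. \<exists>v\<in>K. x = u - v}"
    then obtain u v u' v' where "u \<in> K" "v \<in> K" "u' \<in> K" "v' \<in> K" "x = u - v" "y = u' - v'" by blast
    then have "u + u' \<in> K" "v + v' \<in> K" "x + y = (u + u') - (v + v')" by (simp_all add: add)
    then show "x + y \<in> {x. \<exists>u\<in>K. \<exists>v\<in>K. x = u - v}" by blast
  next
    fix c x assume "x \<in> {x. \<exists>u\<in>K. \<exists>v\<in>K. x = u - v}"
    then obtain u v where uv: "u \<in> K" "v \<in> K" "x = u - v" by blast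
    show "c *\<^sub>R x \<in> {x. \<exists>u\<in>K. \<exists>v\<in>K. x = u - v}"
    proof (cases "c \<ge> 0")
      case True
      then have "c *\<^sub>R u \<in> K" "c *\<^sub>R v \<in> K" "c *\<^sub>R x = c *\<^sub>R u - c *\<^sub>R v"
        using uv mul by (auto simp: scaleR_diff_right)
      then show ?thesis by blast
    next
      case False
      then have "(- c) *\<^sub>R u \<in> K" "(- c) *\<^sub>R v \<in> K" "c *\<^sub>R x = (- c) *\<^sub>R v - (- c) *\<^sub>R u"
        using uv mul[of u "- c"] mul[of v "- c"] by (auto simp: scaleR_diff_right)
      then show ?thesis by blast
    qed
  qed
  moreover have "K \<subseteq> {x. \<exists>u\<in>K. \<exists>v\<in>K. x = u - v}"
    using 0 by force
  ultimately show "span K \<subseteq> {x. \<exists>u\<in>K. \<exists>v\<in>K. x = u - v}"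
    by (rule span_minimal[rotated])
qed

lemma span_convex_cone_hull: "span (convex_cone hull X) = span X"
proof
  have "convex_cone hull X \<subseteq> span X"
    by (intro hull_minimal span_superset convex_cone_span)
  then show "span (convex_cone hull X) \<subseteq> span X"
    by (intro span_minimal) auto
  show "span X \<subseteq> span (convex_cone hull X)"
    by (intro span_mono hull_subset)
qed

lemma span_eq_cone_differences:
  "span X = {x. \<exists>u\<in>convex_cone hull X. \<exists>v\<in>convex_cone hull X. x = u - v}"
  using span_convex_cone[OF convex_cone_convex_cone_hull[of X]] by (simp only: span_convex_cone_hull)

lemma dset_span: "dset S \<Longrightarrow> dset (\<lambda>e. span (S e))"
  unfolding span_eq_cone_differences by (intro dset_differences dset_convex_cone_hull)

text \<open>A cone contains 0, so its affine hull is its span. Relative interiority becomes a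
  condition on the points of a definable span at distance less than \<epsilon>.\<close>

lemma dset_rel_interior_convex_cone_hull:
  assumes S: "dset S"
  shows "dset (\<lambda>e. rel_interior (convex_cone hull S e))"
proof (rule dsetI)
  fix x \<rho> assume x: "pvec (x :: env \<Rightarrow> 'a)" and \<rho>: "denv \<rho>"
  have "x e \<in> rel_interior (convex_cone hull S (\<rho> e)) \<longleftrightarrow> x e \<in> convex_cone hull S (\<rho> e) \<and>
     (\<exists>\<epsilon>. 0 < \<epsilon> \<and> (\<forall>y\<in>span (S (\<rho> e)). norm (y - x e) < \<epsilon> \<longrightarrow> y \<in> convex_cone hull S (\<rho> e)))" for e
  proof -
    have "affine hull (convex_cone hull S (\<rho> e)) = span (S (\<rho> e))"
      by (subst affine_hull_span_0)
        (simp_all add: span_convex_cone_hull hull_inc convex_cone_hull_contains_0)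
    moreover have "ball (x e) \<epsilon> \<inter> A \<subseteq> C \<longleftrightarrow> (\<forall>y\<in>A. norm (y - x e) < \<epsilon> \<longrightarrow> y \<in> C)" for \<epsilon> A C
      by (auto simp: dist_norm norm_minus_commute)
    ultimately show ?thesis
      unfolding mem_rel_interior_ball by simp
  qed
  moreover have "qf (\<lambda>e. x e \<in> convex_cone hull S (\<rho> e) \<and>
     (\<exists>\<epsilon>. 0 < \<epsilon> \<and> (\<forall>y\<in>span (S (\<rho> e)). norm (y - x e) < \<epsilon> \<longrightarrow> y \<in> convex_cone hull S (\<rho> e))))"
  proof (rule qf.conj[OF qf_mem[OF dset_comp[OF dset_convex_cone_hull[OF S] \<rho>] x]], rule qf_ex_real)
    fix \<epsilon> \<rho>1 assume \<epsilon>: "PT \<epsilon>" and \<rho>1: "denv \<rho>1"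
    show "qf (\<lambda>e. 0 < \<epsilon> e \<and> (\<forall>y\<in>span (S (\<rho> (\<rho>1 e))). norm (y - x (\<rho>1 e)) < \<epsilon> e \<longrightarrow> y \<in> convex_cone hull S (\<rho> (\<rho>1 e))))"
    proof (rule qf.conj[OF qf_less[OF PT_const \<epsilon>] qf_ball[OF dset_comp[OF dset_span[OF S] denv_comp[OF \<rho> \<rho>1]]]])
      fix y \<rho>2 assume y: "pvec (y :: env \<Rightarrow> 'a)" and \<rho>2: "denv \<rho>2"
      note \<rho>12 = denv_comp[OF \<rho>1 \<rho>2]
      show "qf (\<lambda>e. norm (y e - x (\<rho>1 (\<rho>2 e))) < \<epsilon> (\<rho>2 e) \<longrightarrow> y e \<in> convex_cone hull S (\<rho> (\<rho>1 (\<rho>2 e))))"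
        by (rule qf_imp[OF qf_norm_less[OF pvec_diff[OF y pvec_comp[OF x \<rho>12]] PT_comp[OF \<epsilon> \<rho>2]]
              qf_mem[OF dset_comp[OF dset_convex_cone_hull[OF S] denv_comp[OF \<rho> \<rho>12]] y]])
    qed
  qed
  ultimately show "qf (\<lambda>e. x e \<in> rel_interior (convex_cone hull S (\<rho> e)))" by simp
qed

section \<open>Dimension as a first-order condition\<close>

text \<open>Encodes an upper bound on the dimension relative to \<open>L\<close>. Choosing the
  spanning vectors one at a time yields one vector quantifier per step, with the enlarged span again
  a definable set.\<close>

fun within_extension :: "nat \<Rightarrow> 'a::euclidean_space set \<Rightarrow> 'a set \<Rightarrow> bool" where
  "within_extension 0 S L \<longleftrightarrow> S \<subseteq> L"
| "within_extension (Suc k) S L \<longleftrightarrow> (\<exists>y. within_extension k S (span (insert y L)))"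

lemma within_extension_iff:
  "within_extension k S (span L) \<longleftrightarrow> (\<exists>B. finite B \<and> card B \<le> k \<and> S \<subseteq> span (B \<union> L))"
proof (induction k arbitrary: L)
  case 0
  show ?case by (auto intro!: exI[of _ "{}"])
next
  case (Suc k)
  have sp: "span (insert y (span L)) = span (insert y L)" for y
  proof
    have "insert y (span L) \<subseteq> span (insert y L)"
      using span_mono[of L "insert y L"] by (auto intro: span_base)
    then show "span (insert y (span L)) \<subseteq> span (insert y L)"
      by (rule span_minimal) simp
    show "span (insert y L) \<subseteq> span (insert y (span L))"
      using span_superset[of L] by (intro span_mono) auto
  qed
  have "within_extension (Suc k) S (span L) \<longleftrightarrow>
      (\<exists>y B. finite B \<and> card B \<le> k \<and> S \<subseteq> span (B \<union> insert y L))"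
    by (simp add: sp Suc)
  also have "\<dots> \<longleftrightarrow> (\<exists>B. finite B \<and> card B \<le> Suc k \<and> S \<subseteq> span (B \<union> L))"
  proof
    assume "\<exists>y B. finite B \<and> card B \<le> k \<and> S \<subseteq> span (B \<union> insert y L)"
    then obtain y B where B: "finite B" "card B \<le> k" "S \<subseteq> span (B \<union> insert y L)" by blast
    then have "finite (insert y B)" "card (insert y B) \<le> Suc k" "S \<subseteq> span (insert y B \<union> L)"
      by (auto simp: card_insert_if)
    then show "\<exists>B. finite B \<and> card B \<le> Suc k \<and> S \<subseteq> span (B \<union> L)" by blast
  next
    assume "\<exists>B. finite B \<and> card B \<le> Suc k \<and> S \<subseteq> span (B \<union> L)"
    then obtain B where B: "finite B" "card B \<le> Suc k" "S \<subseteq> span (B \<union> L)" by blast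
    show "\<exists>y B. finite B \<and> card B \<le> k \<and> S \<subseteq> span (B \<union> insert y L)"
    proof (cases "B = {}")
      case True
      \<comment> \<open>With no vector to split off from \<open>B\<close>, the quantified vector is
        taken to be 0.\<close>
      then have "S \<subseteq> span ({} \<union> insert 0 L)" using B by (simp add: span_insert_0)
      then show ?thesis by (intro exI[of _ 0] exI[of _ "{}"]) auto
    next
      case False
      then obtain y where y: "y \<in> B" by blast
      then have "B - {y} \<union> insert y L = B \<union> L" by auto
      with B y show ?thesis by (intro exI[of _ y] exI[of _ "B - {y}"]) auto
    qed
  qed
  finally show ?case .
qed

lemma dim_le_iff_within_extension: "dim S \<le> k \<longleftrightarrow> within_extension k S (span {})"
  for S :: "'a::euclidean_space set"
proof
  assume "dim S \<le> k"
  obtain B where "B \<subseteq> S" "independent B" "S \<subseteq> span B" "card B = dim S"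
    using basis_exists[of S] by blast
  with \<open>dim S \<le> k\<close> show "within_extension k S (span {})"
    unfolding within_extension_iff by (auto intro!: exI[of _ B] finiteI_independent)
next
  assume "within_extension k S (span {})"
  then obtain B where "finite B" "card B \<le> k" "S \<subseteq> span B"
    unfolding within_extension_iff by auto
  then show "dim S \<le> k" using dim_le_card[of S B] by simp
qed

lemma qf_within_extension:
  "dset S \<Longrightarrow> dset L \<Longrightarrow> qf (\<lambda>e. within_extension k (S e) (L e))"
proof (induction k arbitrary: S L)
  case 0
  then show ?case by (simp add: qf_subset)
next
  case (Suc k)
  show ?case unfolding within_extension.simps
    by (rule qf_ex, rule Suc.IH) (assumption | rule dset_comp[OF Suc.prems(1)] dset_comp[OF Suc.prems(2)] dset_span dset_insert)+
qed

lemma qf_dim_le: "dset S \<Longrightarrow> qf (\<lambda>e. dim (S e) \<le> k)"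
  unfolding dim_le_iff_within_extension
  by (intro qf_within_extension dset_span dset_empty)

lemma qf_dim_eq:
  assumes "dset S"
  shows "qf (\<lambda>e. dim (S e) = k)"
proof (cases k)
  case 0
  then show ?thesis using qf_dim_le[OF assms, of 0] by simp
next
  case (Suc j)
  then have "dim (S e) = k \<longleftrightarrow> dim (S e) \<le> Suc j \<and> \<not> dim (S e) \<le> j" for e by auto
  with qf_dim_le[OF assms] show ?thesis by (simp add: qf.conj qf.neg)
qed

section \<open>Definability of the combinatorial type\<close>

text \<open>The constant length makes the index set of the cells independent of the parameters, so
  that quantifiers over indices and sets of indices are finite.\<close>

definition dcells :: "nat \<Rightarrow> (env \<Rightarrow> (real^'d) set list) \<Rightarrow> bool" where
  "dcells n P \<longleftrightarrow> (\<forall>e. length (P e) = n) \<and> (\<forall>i<n. dset (\<lambda>e. P e ! i))"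

lemma dcells_comp: "dcells n P \<Longrightarrow> denv \<rho> \<Longrightarrow> dcells n (\<lambda>e. P (\<rho> e))"
  unfolding dcells_def using dset_comp[of "\<lambda>e. P e ! i" \<rho> for i] by blast

lemma homog_nth: "homog x $ None = 1" "homog x $ Some k = x $ k"
  by (simp_all add: homog_def)

lemma pvec_homog: "pvec x \<Longrightarrow> pvec (\<lambda>e. homog (x e))"
proof (rule pvec_vecI)
  fix i assume "pvec x"
  then show "PT (\<lambda>e. homog (x e) $ i)"
    by (cases i) (simp_all add: homog_nth PT_const PT_nth)
qed

lemma norm_homog: "norm (homog x) = sqrt (1 + (norm x)\<^sup>2)" for x :: "real^'d"
proof -
  have "(\<Sum>i\<in>(UNIV :: 'd option set). (homog x $ i)\<^sup>2) = 1 + (\<Sum>i\<in>UNIV. (x $ i)\<^sup>2)"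
    by (simp add: UNIV_option_conv homog_nth sum.reindex)
  then show ?thesis
    by (simp add: norm_vec_def L2_set_def sum_nonneg)
qed

lemma hat_altdef: "hat x = homog x /\<^sub>R norm (homog x)"
  by (simp add: hat_def norm_homog)

lemma homog_nonzero: "norm (homog x) > 0"
  by (metis homog_nth(1) zero_index zero_neq_one zero_less_norm_iff)

text \<open>Removes the square root from \<open>hat\<close>. Since \<open>homog x\<close> has 0-th
  coordinate 1, the scaling factor can be read off as \<open>v $ None\<close>, and only polynomial
  conditions remain.\<close>

lemma in_hat_image_iff:
  "v \<in> hat ` S \<longleftrightarrow> norm v = 1 \<and> v $ None > 0 \<and> (\<exists>x\<in>S. v = v $ None *\<^sub>R homog x)"
proof
  assume "v \<in> hat ` S"
  then obtain x where x: "x \<in> S" "v = homog x /\<^sub>R norm (homog x)" by (auto simp: hat_altdef)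
  moreover have "v $ None = inverse (norm (homog x))" by (simp add: x homog_nth)
  ultimately show "norm v = 1 \<and> v $ None > 0 \<and> (\<exists>x\<in>S. v = v $ None *\<^sub>R homog x)"
    using homog_nonzero[of x] by auto
next
  assume v: "norm v = 1 \<and> v $ None > 0 \<and> (\<exists>x\<in>S. v = v $ None *\<^sub>R homog x)"
  then obtain x where x: "x \<in> S" "v = v $ None *\<^sub>R homog x" by blast
  have "1 = norm (v $ None *\<^sub>R homog x)" using v x(2) by simp
  also have "\<dots> = v $ None * norm (homog x)" using v by simp
  finally have "v $ None = inverse (norm (homog x))"
    using homog_nonzero[of x] by (simp add: field_simps)
  with x have "v = hat x" by (simp add: hat_altdef)
  with x show "v \<in> hat ` S" by blast
qed

lemma dset_hat:
  fixes S :: "env \<Rightarrow> (real^'d) set"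
  assumes S: "dset S"
  shows "dset (\<lambda>e. hat ` S e)"
proof (rule dsetI)
  fix v \<rho> assume v: "pvec (v :: env \<Rightarrow> real^('d option))" and \<rho>: "denv \<rho>"
  show "qf (\<lambda>e. v e \<in> hat ` S (\<rho> e))"
    unfolding in_hat_image_iff
    by (rule qf.conj[OF qf_norm_eq_1[OF v] qf.conj[OF qf_less[OF PT_const PT_nth[OF v]]
          qf_bex[OF dset_comp[OF S \<rho>] qf_vec_eq[OF pvec_comp[OF v]
            pvec_scaleR[OF PT_nth[OF pvec_comp[OF v]] pvec_homog]]]]])
qed

abbreviation "indices n \<equiv> insert \<infinity> (enat ` {..<n})"

lemma cell_indices_dcells: "dcells n P \<Longrightarrow> cell_indices (P e) = indices n"
  by (simp add: dcells_def cell_indices_def)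

lemma dset_sphere: "dset (\<lambda>e. sphere 0 1)"
  by (rule dsetI) (simp add: qf_norm_eq_1)

lemma dset_hat_cell:
  fixes P :: "env \<Rightarrow> (real^'d) set list"
  assumes "dcells n P" "i \<in> indices n"
  shows "dset (\<lambda>e. hat_cell (P e) i)"
proof (cases i)
  case (enat k)
  with assms show ?thesis
    by (auto simp: hat_cell_def dcells_def intro: dset_hat)
next
  case infinity
  have "dset (\<lambda>e. {v. norm v = 1 \<and> v $ None < 0} :: (real^('d option)) set)"
    by (rule dset_Collect) (rule qf.conj[OF qf_norm_eq_1 qf_less[OF PT_nth PT_const]])
  moreover have "hat_cell (P e) i = {v. norm v = 1 \<and> v $ None < 0}" for e
    by (auto simp: hat_cell_def infinity)
  ultimately show ?thesis by simp
qed

lemma dset_cell_cone: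
  assumes "dcells n P" "i \<in> indices n"
  shows "dset (\<lambda>e. cell_cone (P e) i)"
  unfolding cell_cone_def by (intro dset_convex_cone_hull dset_closure dset_hat_cell[OF assms])

lemma qf_cells_at:
  assumes P: "dcells n P" and x: "pvec x"
  shows "qf (\<lambda>e. cells_at (P e) (x e) = I)"
proof (cases "I \<subseteq> indices n")
  case True
  then have "cells_at (P e) (x e) = I \<longleftrightarrow> (\<forall>i\<in>indices n. i \<in> I \<longleftrightarrow> x e \<in> cell_cone (P e) i)" for e
    by (auto simp: cells_at_def cell_indices_dcells[OF P])
  moreover have "qf (\<lambda>e. \<forall>i\<in>indices n. i \<in> I \<longleftrightarrow> x e \<in> cell_cone (P e) i)"
    by (rule qf_ball_finite[OF _ qf_iff[OF qf_const qf_mem[OF dset_cell_cone[OF P] x]]]) auto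
  ultimately show ?thesis by simp
next
  case False
  then have "\<not> cells_at (P e) (x e) = I" for e
    by (auto simp: cells_at_def cell_indices_dcells[OF P])
  then show ?thesis by (simp add: qf_const)
qed

lemma face_indices_subset: "face_indices P \<subseteq> Pow (cell_indices P)"
  by (auto simp: face_indices_def cells_at_def)

lemma qf_face_indices:
  assumes P: "dcells n P"
  shows "qf (\<lambda>e. I \<in> face_indices (P e))"
proof -
  have "I \<in> face_indices (P e) \<longleftrightarrow> I \<noteq> {\<infinity>} \<and> (\<exists>x. cells_at (P e) x = I)" for e
    by (auto simp: face_indices_def)
  moreover have "qf (\<lambda>e. I \<noteq> {\<infinity>} \<and> (\<exists>x. cells_at (P e) x = I))"
    by (rule qf.conj[OF qf_const qf_ex[OF qf_cells_at[OF dcells_comp[OF P]]]])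
  ultimately show ?thesis by simp
qed

lemma dset_face:
  assumes P: "dcells n P" and I: "I \<subseteq> indices n"
  shows "dset (\<lambda>e. face (P e) I)"
  unfolding face_def using I
  by (intro dset_INT_finite dset_closure dset_hat_cell[OF P]) (auto intro: finite_subset[OF I])

lemma cells_at_0: "cells_at P 0 = cell_indices P"
  by (auto simp: cells_at_def cell_cone_def convex_cone_hull_contains_0)

lemma dset_min_face: "dcells n P \<Longrightarrow> dset (\<lambda>e. min_face (P e))"
  unfolding min_face_def cells_at_0 by (simp add: cell_indices_dcells dset_face)

lemma qf_essential: "dcells n P \<Longrightarrow> qf (\<lambda>e. essential (P e))"
  unfolding essential_def by (intro qf_set_eq dset_min_face dset_empty)

text \<open>A convex cone is a subspace as soon as it is closed under negation.\<close>

lemma qf_linear_face: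
  assumes F: "dset F"
  shows "qf (\<lambda>e. linear_face (F e))"
proof -
  have "linear_face (F e) \<longleftrightarrow> (\<forall>x\<in>pos_cone (F e). - x \<in> pos_cone (F e))" for e
    by (simp add: linear_face_def subspace_convex_cone_symmetric convex_cone_convex_cone_hull)
  moreover have "qf (\<lambda>e. \<forall>x\<in>pos_cone (F e). - x \<in> pos_cone (F e))"
    by (rule qf_ball[OF dset_convex_cone_hull[OF F]
          qf_mem[OF dset_convex_cone_hull[OF dset_comp[OF F]] pvec_minus]])
  ultimately show ?thesis by simp
qed

text \<open>The subspace in the definition is forced to be the span of \<open>F\<close>: as
  \<open>L\<close> sticks out of the halfspace, every vector of \<open>L\<close> is a difference of
  two vectors of \<open>L\<close> inside the halfspace. Only the vector \<open>a\<close> remains to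
  be quantified.\<close>

lemma half_linear_iff:
  "half_linear F \<longleftrightarrow> (\<exists>a. (\<exists>x\<in>span F. a \<bullet> x < 0) \<and> F = unit_sphere \<inter> span F \<inter> {x. 0 \<le> a \<bullet> x})"
proof
  assume "half_linear F"
  then obtain L a where L: "subspace L" "\<not> L \<subseteq> {x. a \<bullet> x \<ge> 0}" "F = unit_sphere \<inter> L \<inter> {x. a \<bullet> x \<ge> 0}"
    unfolding half_linear_def by blast
  then obtain u where "u \<in> L" "\<not> 0 \<le> a \<bullet> u" by blast
  then have u: "u \<in> L" "a \<bullet> u < 0" by auto
  have pos: "x \<in> span F" if "x \<in> L" "a \<bullet> x \<ge> 0" for x
  proof (cases "x = 0")
    case False
    then have "x /\<^sub>R norm x \<in> F"
      using that L by (auto simp: subspace_scale)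
    then have "norm x *\<^sub>R (x /\<^sub>R norm x) \<in> span F" by (intro span_scale span_base)
    with False show ?thesis by simp
  qed (simp add: span_zero)
  have "L \<subseteq> span F"
  proof
    fix x assume x: "x \<in> L"
    have nu: "- u \<in> span F" using u L by (intro pos) (auto simp: subspace_neg)
    \<comment> \<open>Large enough for \<open>x\<close>, moved along \<open>- u\<close>, to enter
      the halfspace; the quotient solves the equality case.\<close>
    define t where "t = max 0 ((a \<bullet> x) / (a \<bullet> u))"
    have "t * (a \<bullet> u) \<le> a \<bullet> x" using u by (auto simp: t_def max_def divide_simps)
    then have "a \<bullet> (x + t *\<^sub>R (- u)) \<ge> 0" by (simp add: inner_diff_right)
    then have "x + t *\<^sub>R (- u) \<in> span F"
      using x u L by (intro pos) (simp_all add: subspace_add subspace_scale subspace_neg subspace_diff)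
    then have "x + t *\<^sub>R (- u) - t *\<^sub>R (- u) \<in> span F"
      using nu by (intro span_diff span_scale)
    then show "x \<in> span F" by simp
  qed
  moreover have "span F \<subseteq> L" using L by (intro span_minimal) auto
  ultimately have "span F = L" by simp
  with L u show "\<exists>a. (\<exists>x\<in>span F. a \<bullet> x < 0) \<and> F = unit_sphere \<inter> span F \<inter> {x. 0 \<le> a \<bullet> x}"
    by blast
next
  assume "\<exists>a. (\<exists>x\<in>span F. a \<bullet> x < 0) \<and> F = unit_sphere \<inter> span F \<inter> {x. 0 \<le> a \<bullet> x}"
  then obtain a x where a: "x \<in> span F" "a \<bullet> x < 0" "F = unit_sphere \<inter> span F \<inter> {x. 0 \<le> a \<bullet> x}"
    by blast
  have "\<not> span F \<subseteq> {x. a \<bullet> x \<ge> 0}" using a(1,2) by auto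
  with a(3) subspace_span[of F] show "half_linear F" unfolding half_linear_def by blast
qed

lemma dset_halfspace: "pvec a \<Longrightarrow> dset (\<lambda>e. {x. 0 \<le> a e \<bullet> x})"
  by (rule dset_Collect) (rule qf_le[OF PT_const PT_inner[OF pvec_comp]])

lemma qf_half_linear:
  fixes F :: "env \<Rightarrow> (real^('d::finite option)) set"
  assumes F: "dset F"
  shows "qf (\<lambda>e. half_linear (F e))"
  unfolding half_linear_iff
proof (rule qf_ex)
  fix a \<rho> assume a: "pvec (a :: env \<Rightarrow> real^('d option))" and \<rho>: "denv \<rho>"
  note F\<rho> = dset_comp[OF F \<rho>]
  show "qf (\<lambda>e. (\<exists>x\<in>span (F (\<rho> e)). a e \<bullet> x < 0)
      \<and> F (\<rho> e) = unit_sphere \<inter> span (F (\<rho> e)) \<inter> {x. 0 \<le> a e \<bullet> x})"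
    by (rule qf.conj[OF qf_bex[OF dset_span[OF F\<rho>] qf_less[OF PT_inner[OF pvec_comp[OF a]] PT_const]]
          qf_set_eq[OF F\<rho> dset_Int[OF dset_Int[OF dset_sphere dset_span[OF F\<rho>]] dset_halfspace[OF a]]]])
qed

lemma dim_vec_option_le: "dim S \<le> CARD('d) + 1" for S :: "(real^('d::finite option)) set"
  using dim_subset_UNIV[of S] by simp

text \<open>Only dimensions up to \<open>CARD('d) + 1\<close> occur for the cone, so any condition
  \<open>R\<close> on the dimension is a finite disjunction over values satisfying it.\<close>

lemma qf_sdim:
  fixes F :: "env \<Rightarrow> (real^('d::finite option)) set"
  assumes F: "dset F"
  shows "qf (\<lambda>e. R (sdim (F e)))"
proof -
  have "R (sdim (F e)) \<longleftrightarrow> (\<exists>k\<in>{..CARD('d) + 1}. R (int k - 1) \<and> dim (pos_cone (F e)) = k)" for e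
    using dim_vec_option_le[of "pos_cone (F e)"] by (auto simp: sdim_def)
  moreover have "qf (\<lambda>e. \<exists>k\<in>{..CARD('d) + 1}. R (int k - 1) \<and> dim (pos_cone (F e)) = k)"
    by (intro qf_bex_finite qf.conj qf_const qf_dim_eq dset_convex_cone_hull F) simp
  ultimately show ?thesis by simp
qed

lemma dset_srel_interior: "dset F \<Longrightarrow> dset (\<lambda>e. srel_interior (F e))"
  unfolding srel_interior_def by (intro dset_Int dset_sphere dset_rel_interior_convex_cone_hull)

lemma dset_srel_boundary: "dset F \<Longrightarrow> dset (\<lambda>e. srel_boundary (F e))"
  unfolding srel_boundary_def by (intro dset_Diff dset_srel_interior)

lemma qf_half_linear_indices:
  assumes P: "dcells n P"
  shows "qf (\<lambda>e. I \<in> half_linear_indices (P e))"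
proof (cases "I \<subseteq> indices n")
  case True
  show ?thesis unfolding half_linear_indices_def mem_Collect_eq
    by (rule qf.conj[OF qf_face_indices[OF P] qf_half_linear[OF dset_face[OF P True]]])
next
  case False
  then have "I \<notin> half_linear_indices (P e)" for e
    using face_indices_subset[of "P e"] cell_indices_dcells[OF P, of e]
    by (auto simp: half_linear_indices_def)
  then show ?thesis by (simp add: qf_const)
qed

section \<open>Node labels and node systems\<close>

text \<open>A finite set containing the labels of all partitions with \<open>n\<close> cells. The
  minimal face has dimension at most \<open>D\<close>, the dimension of the ambient sphere, hence at
  most \<open>D + 2\<close> nodes.\<close>

definition possible_labels :: "nat \<Rightarrow> nat \<Rightarrow> node_label set" where
  "possible_labels n D = Half_Node ` Pow (indices n) \<union> Min_Node ` {..<D + 2}"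

lemma finite_possible_labels: "finite (possible_labels n D)"
  by (simp add: possible_labels_def)

lemma min_node_labels_subset:
  "min_node_labels P \<subseteq> possible_labels (length P) CARD('d)" for P :: "(real^'d) set list"
  using dim_vec_option_le[of "pos_cone (min_face P)"]
  by (auto simp: min_node_labels_def possible_labels_def sdim_def)

lemma half_linear_indices_subset: "half_linear_indices P \<subseteq> Pow (indices (length P))"
  using face_indices_subset[of P] by (auto simp: half_linear_indices_def cell_indices_def)

lemma node_labels_subset:
  "node_labels P \<subseteq> possible_labels (length P) CARD('d)" for P :: "(real^'d) set list"
  using min_node_labels_subset[of P] half_linear_indices_subset[of P]
  unfolding node_labels_def possible_labels_def by blast

lemma qf_min_node_labels:
  assumes P: "dcells n P"
  shows "qf (\<lambda>e. l \<in> min_node_labels (P e))"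
proof (cases l)
  case (Min_Node i)
  have "l \<in> min_node_labels (P e) \<longleftrightarrow> \<not> essential (P e) \<and> int i < sdim (min_face (P e)) + 2" for e
    by (auto simp: min_node_labels_def Min_Node)
  then show ?thesis
    by (simp only:) (intro qf.conj qf.neg qf_essential[OF P] qf_sdim dset_min_face[OF P])
next
  case (Half_Node I)
  then have "l \<notin> min_node_labels (P e)" for e by (auto simp: min_node_labels_def)
  then show ?thesis by (simp add: qf_const)
qed

lemma qf_node_labels:
  assumes P: "dcells n P"
  shows "qf (\<lambda>e. l \<in> node_labels (P e))"
proof (cases l)
  case (Min_Node i)
  then have "l \<in> node_labels (P e) \<longleftrightarrow> l \<in> min_node_labels (P e)" for e
    by (auto simp: node_labels_def)
  then show ?thesis by (simp add: qf_min_node_labels[OF P])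
next
  case (Half_Node I)
  then have "l \<in> node_labels (P e) \<longleftrightarrow> I \<in> half_linear_indices (P e)" for e
    by (auto simp: node_labels_def min_node_labels_def)
  then show ?thesis by (simp add: qf_half_linear_indices[OF P])
qed

definition dfun :: "(env \<Rightarrow> 'l \<Rightarrow> 'a::euclidean_space) \<Rightarrow> bool" where
  "dfun N \<longleftrightarrow> (\<forall>l. pvec (\<lambda>e. N e l))"

lemma dfunD: "dfun N \<Longrightarrow> pvec (\<lambda>e. N e l)"
  by (simp add: dfun_def)

lemma dfun_comp: "dfun N \<Longrightarrow> denv \<rho> \<Longrightarrow> dfun (\<lambda>e. N (\<rho> e))"
  unfolding dfun_def using pvec_comp[of "\<lambda>e. N e l" \<rho> for l] by blast

lemma dset_image_labels:
  fixes N :: "env \<Rightarrow> 'l \<Rightarrow> 'a::euclidean_space"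
  assumes N: "dfun N" and L: "finite L" "\<And>e. A e \<subseteq> L" "\<And>l. qf (\<lambda>e. l \<in> A e)"
  shows "dset (\<lambda>e. N e ` A e)"
proof (rule dsetI)
  fix x \<rho> assume x: "pvec (x :: env \<Rightarrow> 'a)" and \<rho>: "denv \<rho>"
  have "x e \<in> N (\<rho> e) ` A (\<rho> e) \<longleftrightarrow> (\<exists>l\<in>L. l \<in> A (\<rho> e) \<and> x e = N (\<rho> e) l)" for e
    using L(2)[of "\<rho> e"] by blast
  moreover have "qf (\<lambda>e. \<exists>l\<in>L. l \<in> A (\<rho> e) \<and> x e = N (\<rho> e) l)"
    by (rule qf_bex_finite[OF L(1) qf.conj[OF qf_comp[OF L(3) \<rho>] qf_vec_eq[OF x dfunD[OF dfun_comp[OF N \<rho>]]]]])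
  ultimately show "qf (\<lambda>e. x e \<in> N (\<rho> e) ` A (\<rho> e))" by simp
qed

lemma qf_node_system:
  fixes P :: "env \<Rightarrow> (real^'d) set list"
  assumes P: "dcells n P" and N: "dfun N"
  shows "qf (\<lambda>e. node_system (P e) (N e))"
proof -
  have n: "length (P e) = n" for e using P by (simp add: dcells_def)
  have "(\<forall>I\<in>half_linear_indices (P e). N e (Half_Node I) \<in> srel_interior (face (P e) I)) \<longleftrightarrow>
      (\<forall>I\<in>Pow (indices n). I \<in> half_linear_indices (P e) \<longrightarrow> N e (Half_Node I) \<in> srel_interior (face (P e) I))" for e
    using half_linear_indices_subset[of "P e"] n[of e] by blast
  moreover have "qf (\<lambda>e. \<forall>I\<in>Pow (indices n). I \<in> half_linear_indices (P e) \<longrightarrow> N e (Half_Node I) \<in> srel_interior (face (P e) I))"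
    by (rule qf_ball_finite[OF _ qf_imp[OF qf_half_linear_indices[OF P]
            qf_mem[OF dset_srel_interior[OF dset_face[OF P]] dfunD[OF N]]]]) auto
  ultimately have 1: "qf (\<lambda>e. \<forall>I\<in>half_linear_indices (P e). N e (Half_Node I) \<in> srel_interior (face (P e) I))"
    by simp
  have sub: "min_node_labels (P e) \<subseteq> possible_labels n CARD('d)" for e
    using min_node_labels_subset[of "P e"] n[of e] by simp
  have im: "dset (\<lambda>e. N e ` min_node_labels (P e))"
    by (rule dset_image_labels[OF N finite_possible_labels[of n "CARD('d)"] sub qf_min_node_labels[OF P]])
  show ?thesis
    unfolding node_system_def
    by (intro qf.conj[OF 1] qf_imp qf.conj qf.neg qf_essential[OF P] qf_subset qf_set_eq
        dset_convex_cone_hull im dset_min_face[OF P])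
qed

section \<open>The complex as a least fixed point over finitely many symbols\<close>

lemma pos_cone_spherical_hull: "pos_cone (spherical_hull X) = pos_cone X"
proof
  show "pos_cone (spherical_hull X) \<subseteq> pos_cone X"
    by (rule hull_minimal) (auto simp: spherical_hull_def convex_cone_convex_cone_hull)
  have "x \<in> pos_cone (spherical_hull X)" if "x \<in> X" for x
  proof (cases "x = 0")
    case False
    have "x /\<^sub>R norm x \<in> pos_cone X"
      using that by (intro convex_cone_hull_mul hull_inc) auto
    then have "x /\<^sub>R norm x \<in> spherical_hull X"
      using False by (simp add: spherical_hull_def)
    then have "norm x *\<^sub>R (x /\<^sub>R norm x) \<in> pos_cone (spherical_hull X)"
      by (intro convex_cone_hull_mul hull_inc) auto
    with False show ?thesis by simp
  qed (simp add: convex_cone_hull_contains_0)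
  then show "pos_cone X \<subseteq> pos_cone (spherical_hull X)"
    by (intro hull_minimal convex_cone_convex_cone_hull) blast
qed

lemma spherical_hull_insert: "spherical_hull (insert v (spherical_hull X)) = spherical_hull (insert v X)"
  using convex_cone_hull_Un[of "{v}" "spherical_hull X"] convex_cone_hull_Un[of "{v}" X]
  by (simp add: spherical_hull_def[of "insert v (spherical_hull X)"] spherical_hull_def[of "insert v X"]
      pos_cone_spherical_hull)

text \<open>Iterated cones collapse, since \<open>spherical_hull (insert v (spherical_hull X)) =
  spherical_hull (insert v X)\<close>. So every face of the complex is the hull of the nodes with labels in
  some set together with at most one face of the partition.\<close>

type_synonym face_symbol = "node_label set \<times> enat set option"

definition symbol_face ::
    "(real^'d) set list \<Rightarrow> (node_label \<Rightarrow> real^('d option)) \<Rightarrow> face_symbol \<Rightarrow> (real^('d option)) set" where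
  "symbol_face P N t = (case snd t of
       None \<Rightarrow> spherical_hull (N ` fst t)
     | Some I \<Rightarrow> if fst t = {} then face P I else spherical_hull (N ` fst t \<union> face P I))"

text \<open>Holds for empty \<open>L\<close> too, where \<open>symbol_face\<close> may return a face
  itself instead of a hull: after a node is added, both alternatives are hulls of the same
  form.\<close>

lemma symbol_face_insert:
  "symbol_face P N (insert l L, b) = spherical_hull (insert (N l) (symbol_face P N (L, b)))"
  by (auto simp: symbol_face_def spherical_hull_insert split: option.split)

definition possible_symbols :: "nat \<Rightarrow> nat \<Rightarrow> face_symbol set" where
  "possible_symbols n D = Pow (possible_labels n D) \<times> insert None (Some ` Pow (indices n))"

lemma finite_possible_symbols: "finite (possible_symbols n D)"
  by (simp add: possible_symbols_def finite_possible_labels)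

text \<open>One clause per introduction rule of \<open>node_complex\<close>. The first one counts
  labels instead of points: a set of points is the image of an equinumerous set of labels, and
  taking images cannot increase the cardinality.\<close>

definition closed_symbols ::
    "(real^'d) set list \<Rightarrow> (node_label \<Rightarrow> real^('d option)) \<Rightarrow> face_symbol set \<Rightarrow> bool" where
  "closed_symbols P N V \<longleftrightarrow>
     (\<forall>L\<in>Pow (possible_labels (length P) CARD('d)).
        (\<forall>l\<in>L. l \<in> node_labels P \<and> N l \<in> min_face P) \<and> int (card L) \<le> sdim (min_face P) + 1
        \<longrightarrow> (L, None) \<in> V)
   \<and> (\<forall>I\<in>Pow (indices (length P)). \<forall>t\<in>V.
        I \<in> half_linear_indices P
        \<and> srel_boundary (face P I) \<subseteq> (\<Union>t\<in>V. symbol_face P N t)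
        \<and> symbol_face P N t \<subseteq> srel_boundary (face P I)
        \<longrightarrow> (insert (Half_Node I) (fst t), snd t) \<in> V)
   \<and> (\<forall>I\<in>Pow (indices (length P)).
        I \<in> face_indices P \<and> \<not> linear_face (face P I) \<and> \<not> half_linear (face P I)
        \<longrightarrow> ({}, Some I) \<in> V)"

text \<open>The least fixed point over a finite set of symbols is the intersection of all closed
  sets, hence a finite condition.\<close>

definition valid_symbol ::
    "(real^'d) set list \<Rightarrow> (node_label \<Rightarrow> real^('d option)) \<Rightarrow> face_symbol \<Rightarrow> bool" where
  "valid_symbol P N t \<longleftrightarrow>
     (\<forall>V\<in>Pow (possible_symbols (length P) CARD('d)). closed_symbols P N V \<longrightarrow> t \<in> V)"

text \<open>Soundness: the possible symbols whose faces belong to the complex form a closed set, and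
  a valid symbol lies in every closed set.\<close>

lemma valid_symbol_face:
  fixes P :: "(real^'d) set list"
  assumes t: "t \<in> possible_symbols (length P) CARD('d)" and valid: "valid_symbol P N t"
  shows "symbol_face P N t \<in> node_complex P N"
proof -
  let ?V = "{t \<in> possible_symbols (length P) CARD('d). symbol_face P N t \<in> node_complex P N}"
  have "closed_symbols P N ?V"
    unfolding closed_symbols_def
  proof (intro conjI ballI impI)
    fix L assume L: "L \<in> Pow (possible_labels (length P) CARD('d))"
      "(\<forall>l\<in>L. l \<in> node_labels P \<and> N l \<in> min_face P) \<and> int (card L) \<le> sdim (min_face P) + 1"
    then have fin: "finite L" using finite_possible_labels by (meson PowD finite_subset)
    have "spherical_hull (N ` L) \<in> node_complex P N"
      using L fin card_image_le[OF fin, of N] by (intro node_complex.minimal) auto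
    with L show "(L, None) \<in> ?V" by (simp add: symbol_face_def possible_symbols_def)
  next
    fix I t assume I: "I \<in> Pow (indices (length P))" and t: "t \<in> ?V"
      and h: "I \<in> half_linear_indices P
        \<and> srel_boundary (face P I) \<subseteq> (\<Union>t\<in>?V. symbol_face P N t)
        \<and> symbol_face P N t \<subseteq> srel_boundary (face P I)"
    have "spherical_hull (insert (N (Half_Node I)) (symbol_face P N t)) \<in> node_complex P N"
      using h t by (intro node_complex.cone_over) blast+
    with t I show "(insert (Half_Node I) (fst t), snd t) \<in> ?V"
      by (auto simp: symbol_face_insert possible_symbols_def possible_labels_def)
  next
    fix I assume I: "I \<in> Pow (indices (length P))"
      "I \<in> face_indices P \<and> \<not> linear_face (face P I) \<and> \<not> half_linear (face P I)"
    then have "face P I \<in> node_complex P N" by (intro node_complex.other) auto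
    with I show "({}, Some I) \<in> ?V" by (simp add: symbol_face_def possible_symbols_def)
  qed
  with valid show ?thesis unfolding valid_symbol_def by blast
qed

lemma closed_symbols_minimal:
  fixes P :: "(real^'d) set list"
  assumes "closed_symbols P N V" "L \<in> Pow (possible_labels (length P) CARD('d))"
    "\<forall>l\<in>L. l \<in> node_labels P \<and> N l \<in> min_face P" "int (card L) \<le> sdim (min_face P) + 1"
  shows "(L, None) \<in> V"
  using assms(1)[unfolded closed_symbols_def, THEN conjunct1, rule_format, OF assms(2)] assms(3,4)
  by simp

lemma closed_symbols_cone_over:
  assumes "closed_symbols P N V" "I \<in> Pow (indices (length P))" "t \<in> V" "I \<in> half_linear_indices P"
    "srel_boundary (face P I) \<subseteq> (\<Union>t\<in>V. symbol_face P N t)"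
    "symbol_face P N t \<subseteq> srel_boundary (face P I)"
  shows "(insert (Half_Node I) (fst t), snd t) \<in> V"
  using assms(1)[unfolded closed_symbols_def, THEN conjunct2, THEN conjunct1, rule_format, OF assms(2,3)]
    assms(4-6) by simp

lemma closed_symbols_other:
  assumes "closed_symbols P N V" "I \<in> Pow (indices (length P))"
    "I \<in> face_indices P" "\<not> linear_face (face P I)" "\<not> half_linear (face P I)"
  shows "({}, Some I) \<in> V"
  using assms(1)[unfolded closed_symbols_def, THEN conjunct2, THEN conjunct2, rule_format, OF assms(2)]
    assms(3-5) by simp

text \<open>Completeness, by rule induction: each rule is matched by the corresponding clause of an
  arbitrary closed set.\<close>

lemma node_complex_symbol:
  fixes P :: "(real^'d) set list"
  assumes "G \<in> node_complex P N"
  shows "\<exists>t\<in>possible_symbols (length P) CARD('d). valid_symbol P N t \<and> symbol_face P N t = G"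
  using assms
proof (induction rule: node_complex.induct)
  case (minimal S)
  \<comment> \<open>One label per point, so that the bound on \<open>card S\<close> carries over to
    \<open>L\<close>; different labels may well have the same node.\<close>
  then obtain L where L: "L \<subseteq> node_labels P" "inj_on N L" "S = N ` L"
    using subset_image_inj[of S N "node_labels P"] by auto
  have Lp: "L \<in> Pow (possible_labels (length P) CARD('d))"
    using L(1) node_labels_subset by blast
  have "card L = card S" using L by (simp add: card_image)
  moreover have "\<forall>l\<in>L. l \<in> node_labels P \<and> N l \<in> min_face P"
    using minimal(1) L(1,3) by blast
  ultimately have "valid_symbol P N (L, None)"
    unfolding valid_symbol_def using minimal(3) closed_symbols_minimal[OF _ Lp] by simp
  with Lp L show ?case
    by (intro bexI[of _ "(L, None)"]) (auto simp: symbol_face_def possible_symbols_def)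
next
  case (cone_over I G)
  then obtain t where t: "t \<in> possible_symbols (length P) CARD('d)" "valid_symbol P N t"
    "symbol_face P N t = G" by blast
  have I: "I \<in> Pow (indices (length P))"
    using cone_over(1) half_linear_indices_subset by blast
  have "valid_symbol P N (insert (Half_Node I) (fst t), snd t)"
    unfolding valid_symbol_def
  proof (intro ballI impI)
    fix V assume V: "V \<in> Pow (possible_symbols (length P) CARD('d))" "closed_symbols P N V"
    then have tV: "t \<in> V" using t unfolding valid_symbol_def by blast
    \<comment> \<open>Covering is monotone: each face used has a valid symbol by the induction
      hypothesis, and \<open>V\<close> contains all valid symbols.\<close>
    have "srel_boundary (face P I) \<subseteq> (\<Union>t\<in>V. symbol_face P N t)"
    proof
      fix x assume "x \<in> srel_boundary (face P I)"
      then obtain t' where "valid_symbol P N t'" "x \<in> symbol_face P N t'"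
        using cone_over.IH cone_over.hyps by blast
      with V show "x \<in> (\<Union>t\<in>V. symbol_face P N t)" unfolding valid_symbol_def by blast
    qed
    moreover have "symbol_face P N t \<subseteq> srel_boundary (face P I)"
      using cone_over.hyps t(3) by simp
    ultimately show "(insert (Half_Node I) (fst t), snd t) \<in> V"
      using closed_symbols_cone_over[OF V(2) I tV] cone_over.hyps by blast
  qed
  moreover have "symbol_face P N (insert (Half_Node I) (fst t), snd t) = spherical_hull (insert (N (Half_Node I)) G)"
    using t(3) by (simp add: symbol_face_insert)
  moreover have "(insert (Half_Node I) (fst t), snd t) \<in> possible_symbols (length P) CARD('d)"
    using t(1) I by (auto simp: possible_symbols_def possible_labels_def)
  ultimately show ?case by blast
next
  case (other I)
  then have I: "I \<in> Pow (indices (length P))"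
    using face_indices_subset[of P] by (auto simp: cell_indices_def)
  then have "valid_symbol P N ({}, Some I)"
    unfolding valid_symbol_def using other closed_symbols_other[OF _ I] by simp
  with I show ?case
    by (intro bexI[of _ "({}, Some I)"]) (auto simp: symbol_face_def possible_symbols_def)
qed

lemma dset_symbol_face:
  assumes P: "dcells n P" and N: "dfun N" and t: "t \<in> possible_symbols n D"
  shows "dset (\<lambda>e. symbol_face (P e) (N e) t)"
proof -
  have "finite (fst t)"
    by (rule finite_subset[OF _ finite_possible_labels[of n D]]) (use t in \<open>auto simp: possible_symbols_def\<close>)
  then have im: "dset (\<lambda>e. N e ` fst t)"
    by (intro dset_image_labels[OF N, of "fst t"]) (auto intro: qf_const)
  have hull: "dset S \<Longrightarrow> dset (\<lambda>e. spherical_hull (S e))" for S :: "env \<Rightarrow> (real^('a option)) set"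
    unfolding spherical_hull_def by (intro dset_Int dset_sphere dset_convex_cone_hull)
  show ?thesis
  proof (cases "snd t")
    case None
    then show ?thesis by (simp add: symbol_face_def hull im)
  next
    case (Some I)
    then have "I \<subseteq> indices n" using t by (auto simp: possible_symbols_def)
    with Some show ?thesis
      by (cases "fst t = {}") (simp_all add: symbol_face_def hull im dset_Un dset_face[OF P])
  qed
qed

lemma qf_closed_symbols:
  fixes P :: "env \<Rightarrow> (real^'d) set list"
  assumes P: "dcells n P" and N: "dfun N" and V: "V \<subseteq> possible_symbols n CARD('d)"
  shows "qf (\<lambda>e. closed_symbols (P e) (N e) V)"
proof -
  have n: "length (P e) = n" for e using P by (simp add: dcells_def)
  have finV: "finite V" using V finite_possible_symbols by (rule finite_subset)
  have S: "dset (\<lambda>e. symbol_face (P e) (N e) t)" if "t \<in> V" for t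
    using dset_symbol_face[OF P N] that V by blast
  have finL: "finite L" if "L \<in> Pow (possible_labels n CARD('d))" for L
    using that finite_possible_labels by (meson PowD finite_subset)
  have F: "dset (\<lambda>e. face (P e) I)" if "I \<in> Pow (indices n)" for I
    using dset_face[OF P] that by blast
  have 1: "qf (\<lambda>e. \<forall>L\<in>Pow (possible_labels n CARD('d)).
        (\<forall>l\<in>L. l \<in> node_labels (P e) \<and> N e l \<in> min_face (P e)) \<and> int (card L) \<le> sdim (min_face (P e)) + 1
        \<longrightarrow> (L, None) \<in> V)"
    by (rule qf_ball_finite[OF _ qf_imp[OF qf.conj[OF qf_ball_finite[OF finL qf.conj[OF
              qf_node_labels[OF P] qf_mem[OF dset_min_face[OF P] dfunD[OF N]]]]
              qf_sdim[OF dset_min_face[OF P]]] qf_const]])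
      (simp_all add: finite_possible_labels)
  have 2: "qf (\<lambda>e. \<forall>I\<in>Pow (indices n). \<forall>t\<in>V.
        I \<in> half_linear_indices (P e)
        \<and> srel_boundary (face (P e) I) \<subseteq> (\<Union>t\<in>V. symbol_face (P e) (N e) t)
        \<and> symbol_face (P e) (N e) t \<subseteq> srel_boundary (face (P e) I)
        \<longrightarrow> (insert (Half_Node I) (fst t), snd t) \<in> V)"
    by (rule qf_ball_finite[OF _ qf_ball_finite[OF finV qf_imp[OF qf.conj[OF qf_half_linear_indices[OF P]
              qf.conj[OF qf_subset[OF dset_srel_boundary[OF F] dset_UN_finite[OF finV S]]
              qf_subset[OF S dset_srel_boundary[OF F]]]] qf_const]]]) simp_all
  have 3: "qf (\<lambda>e. \<forall>I\<in>Pow (indices n).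
        I \<in> face_indices (P e) \<and> \<not> linear_face (face (P e) I) \<and> \<not> half_linear (face (P e) I)
        \<longrightarrow> ({}, Some I) \<in> V)"
    by (rule qf_ball_finite[OF _ qf_imp[OF qf.conj[OF qf_face_indices[OF P] qf.conj[OF
              qf.neg[OF qf_linear_face[OF F]] qf.neg[OF qf_half_linear[OF F]]]] qf_const]]) simp_all
  show ?thesis unfolding closed_symbols_def n
    by (rule qf.conj[OF 1 qf.conj[OF 2 3]])
qed

lemma qf_valid_symbol:
  assumes P: "dcells n P" and N: "dfun N"
  shows "qf (\<lambda>e. valid_symbol (P e) (N e) t)"
proof -
  have n: "length (P e) = n" for e using P by (simp add: dcells_def)
  show ?thesis unfolding valid_symbol_def n
    by (rule qf_ball_finite[OF _ qf_imp[OF qf_closed_symbols[OF P N] qf_const]])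
      (auto simp: finite_possible_symbols)
qed

section \<open>Node frames and orientation\<close>

text \<open>The existential quantifier over chains of point sets becomes a choice among finitely
  many lists of symbols, one symbol for each dimension from 0 to \<open>CARD('d)\<close>.\<close>

lemma node_frame_iff:
  fixes P :: "(real^'d) set list"
  shows "node_frame P N ls \<longleftrightarrow>
     length ls = CARD('d) + 1 \<and> (\<forall>l\<in>set ls. l \<in> node_labels P)
     \<and> (\<forall>i\<in>{..<length ls}. \<forall>j\<in>{..<length ls}. i \<noteq> j \<longrightarrow> N (ls ! i) \<noteq> N (ls ! j))
     \<and> (\<exists>ts\<in>{ts. set ts \<subseteq> possible_symbols (length P) CARD('d) \<and> length ts = CARD('d) + 1}.
          (\<forall>k\<in>{..CARD('d)}. valid_symbol P N (ts ! k) \<and> sdim (symbol_face P N (ts ! k)) = int k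
             \<and> (\<forall>i\<in>{..k}. N (ls ! i) \<in> symbol_face P N (ts ! k)))
          \<and> (\<forall>k\<in>{..<CARD('d)}. symbol_face P N (ts ! k) \<subset> symbol_face P N (ts ! Suc k)))"
    (is "_ \<longleftrightarrow> _ \<and> _ \<and> _ \<and> ?R")
proof -
  have "(\<exists>G :: nat \<Rightarrow> (real^('d option)) set.
          (\<forall>k \<le> CARD('d). G k \<in> node_complex P N \<and> sdim (G k) = int k
             \<and> (\<forall>i \<le> k. N (ls ! i) \<in> G k))
          \<and> (\<forall>k < CARD('d). G k \<subset> G (Suc k))) \<longleftrightarrow> ?R" (is "?L \<longleftrightarrow> _")
  proof
    assume ?L
    then obtain G where G: "\<forall>k \<le> CARD('d). G k \<in> node_complex P N \<and> sdim (G k) = int k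
             \<and> (\<forall>i \<le> k. N (ls ! i) \<in> G k)" "\<forall>k < CARD('d). G k \<subset> G (Suc k)" by blast
    have "\<exists>t\<in>possible_symbols (length P) CARD('d). valid_symbol P N t \<and> symbol_face P N t = G k"
      if "k \<le> CARD('d)" for k
      using node_complex_symbol G(1) that by blast
    then obtain T where T: "\<And>k. k \<le> CARD('d) \<Longrightarrow> T k \<in> possible_symbols (length P) CARD('d)
        \<and> valid_symbol P N (T k) \<and> symbol_face P N (T k) = G k"
      by metis
    define ts where "ts = map T [0..<CARD('d) + 1]"
    have ts: "ts ! k = T k" if "k \<le> CARD('d)" for k
      using that nth_map_upt[of k "CARD('d) + 1" 0 T] by (simp add: ts_def del: upt_Suc)
    have "set ts \<subseteq> possible_symbols (length P) CARD('d)" "length ts = CARD('d) + 1"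
      using T by (auto simp: ts_def)
    moreover have "\<forall>k\<in>{..CARD('d)}. valid_symbol P N (ts ! k) \<and> sdim (symbol_face P N (ts ! k)) = int k
             \<and> (\<forall>i\<in>{..k}. N (ls ! i) \<in> symbol_face P N (ts ! k))"
      using G(1) T ts by simp
    moreover have "\<forall>k\<in>{..<CARD('d)}. symbol_face P N (ts ! k) \<subset> symbol_face P N (ts ! Suc k)"
      using G(2) T ts by simp
    ultimately show ?R by blast
  next
    assume ?R
    then obtain ts where ts: "set ts \<subseteq> possible_symbols (length P) CARD('d)" "length ts = CARD('d) + 1"
      "\<forall>k\<in>{..CARD('d)}. valid_symbol P N (ts ! k) \<and> sdim (symbol_face P N (ts ! k)) = int k
             \<and> (\<forall>i\<in>{..k}. N (ls ! i) \<in> symbol_face P N (ts ! k))"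
      "\<forall>k\<in>{..<CARD('d)}. symbol_face P N (ts ! k) \<subset> symbol_face P N (ts ! Suc k)" by blast
    have "symbol_face P N (ts ! k) \<in> node_complex P N" if "k \<le> CARD('d)" for k
    proof (rule valid_symbol_face)
      show "ts ! k \<in> possible_symbols (length P) CARD('d)"
        using ts(2) that by (intro subsetD[OF ts(1)] nth_mem) simp
      show "valid_symbol P N (ts ! k)" using ts(3) that by simp
    qed
    with ts(3,4) show ?L by (intro exI[of _ "\<lambda>k. symbol_face P N (ts ! k)"]) simp
  qed
  then show ?thesis
    unfolding node_frame_def distinct_conv_nth length_map subset_iff
    by (auto simp: nth_map)
qed

lemma qf_node_frame:
  fixes P :: "env \<Rightarrow> (real^'d) set list"
  assumes P: "dcells n P" and N: "dfun N"
  shows "qf (\<lambda>e. node_frame (P e) (N e) ls)"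
proof -
  have n: "length (P e) = n" for e using P by (simp add: dcells_def)
  have fin: "finite {ts. set ts \<subseteq> possible_symbols n CARD('d) \<and> length ts = CARD('d) + 1}"
    by (intro finite_lists_length_eq finite_possible_symbols)
  have S: "dset (\<lambda>e. symbol_face (P e) (N e) (ts ! k))"
    if "ts \<in> {ts. set ts \<subseteq> possible_symbols n CARD('d) \<and> length ts = CARD('d) + 1}" "k \<le> CARD('d)" for ts k
  proof (rule dset_symbol_face[OF P N])
    have ts: "set ts \<subseteq> possible_symbols n CARD('d)" "k < length ts" using that by auto
    then show "ts ! k \<in> possible_symbols n CARD('d)" by (intro subsetD[OF ts(1)] nth_mem)
  qed
  show ?thesis
    unfolding node_frame_iff n
  proof (intro qf.conj qf_const)
    show "qf (\<lambda>e. \<forall>l\<in>set ls. l \<in> node_labels (P e))"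
      by (rule qf_ball_finite[OF _ qf_node_labels[OF P]]) simp
    show "qf (\<lambda>e. \<forall>i\<in>{..<length ls}. \<forall>j\<in>{..<length ls}. i \<noteq> j \<longrightarrow> N e (ls ! i) \<noteq> N e (ls ! j))"
      by (rule qf_ball_finite[OF _ qf_ball_finite[OF _ qf_imp[OF qf_const
                qf.neg[OF qf_vec_eq[OF dfunD[OF N] dfunD[OF N]]]]]]) simp_all
    show "qf (\<lambda>e. \<exists>ts\<in>{ts. set ts \<subseteq> possible_symbols n CARD('d) \<and> length ts = CARD('d) + 1}.
          (\<forall>k\<in>{..CARD('d)}. valid_symbol (P e) (N e) (ts ! k) \<and> sdim (symbol_face (P e) (N e) (ts ! k)) = int k
             \<and> (\<forall>i\<in>{..k}. N e (ls ! i) \<in> symbol_face (P e) (N e) (ts ! k)))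
          \<and> (\<forall>k\<in>{..<CARD('d)}. symbol_face (P e) (N e) (ts ! k) \<subset> symbol_face (P e) (N e) (ts ! Suc k)))"
    proof (rule qf_bex_finite[OF fin], rule qf.conj)
      fix ts assume ts: "ts \<in> {ts. set ts \<subseteq> possible_symbols n CARD('d) \<and> length ts = CARD('d) + 1}"
      show "qf (\<lambda>e. \<forall>k\<in>{..CARD('d)}. valid_symbol (P e) (N e) (ts ! k) \<and> sdim (symbol_face (P e) (N e) (ts ! k)) = int k
             \<and> (\<forall>i\<in>{..k}. N e (ls ! i) \<in> symbol_face (P e) (N e) (ts ! k)))"
        by (rule qf_ball_finite[OF _ qf.conj[OF qf_valid_symbol[OF P N] qf.conj[OF
                  qf_sdim[OF S[OF ts]] qf_ball_finite[OF _ qf_mem[OF S[OF ts] dfunD[OF N]]]]]]) simp_all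
      show "qf (\<lambda>e. \<forall>k\<in>{..<CARD('d)}. symbol_face (P e) (N e) (ts ! k) \<subset> symbol_face (P e) (N e) (ts ! Suc k))"
        by (rule qf_ball_finite[OF _ qf_psubset[OF S[OF ts] S[OF ts]]]) simp_all
    qed
  qed
qed

lemma PT_list_det:
  assumes N: "dfun N" and len: "length ls = CARD('d) + 1"
  shows "PT (\<lambda>e. list_det (map (N e) ls :: (real^('d::finite option)) list))"
proof -
  have "to_nat_on (UNIV :: 'd option set) l < length ls" for l
    using to_nat_on_less[of "UNIV :: 'd option set" l] len by simp
  then show ?thesis
    unfolding list_det_def det_def
    by (auto simp: nth_map intro!: PT_sum PT_mult PT_prod PT_const PT_nth dfunD[OF N])
qed

lemma sgn_eq_iff: "sgn a = sgn b \<longleftrightarrow> (0 < a \<longleftrightarrow> 0 < b) \<and> (a = 0 \<longleftrightarrow> b = 0)" for a b :: real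
  by (auto simp: sgn_if)

text \<open>This and the two congruences that follow show that a node system matters only through
  its values at the possible labels. That is the independence needed to quantify over node systems
  with \<open>qf_ex_fun\<close>.\<close>

lemma node_system_cong:
  fixes P :: "(real^'d) set list"
  assumes "\<And>l. l \<in> possible_labels (length P) CARD('d) \<Longrightarrow> N l = N' l" "node_system P N"
  shows "node_system P N'"
proof -
  have h: "N (Half_Node I) = N' (Half_Node I)" if "I \<in> half_linear_indices P" for I
    using assms(1) half_linear_indices_subset that unfolding possible_labels_def by blast
  have m: "N ` min_node_labels P = N' ` min_node_labels P"
    using assms(1) min_node_labels_subset by (intro image_cong) auto
  show ?thesis using assms(2) h unfolding node_system_def m by simp
qed

lemma node_complex_cong:
  fixes P :: "(real^'d) set list"
  assumes "\<And>l. l \<in> possible_labels (length P) CARD('d) \<Longrightarrow> N l = N' l" "G \<in> node_complex P N"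
  shows "G \<in> node_complex P N'"
  using assms(2)
proof (induction rule: node_complex.induct)
  case (minimal S)
  have "N ` node_labels P = N' ` node_labels P"
    using assms(1) node_labels_subset by (intro image_cong) auto
  with minimal show ?case by (intro node_complex.minimal) auto
next
  case (cone_over I G)
  have "N (Half_Node I) = N' (Half_Node I)"
    using assms(1) half_linear_indices_subset cone_over(1) unfolding possible_labels_def by blast
  moreover have "spherical_hull (insert (N' (Half_Node I)) G) \<in> node_complex P N'"
    using cone_over by (intro node_complex.cone_over) blast+
  ultimately show ?case by simp
next
  case (other I)
  then show ?case by (rule node_complex.other)
qed

lemma node_frame_cong:
  fixes P :: "(real^'d) set list"
  assumes "\<And>l. l \<in> possible_labels (length P) CARD('d) \<Longrightarrow> N l = N' l"
  shows "node_frame P N ls \<longleftrightarrow> node_frame P N' ls"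
proof -
  have nc: "node_complex P N = node_complex P N'"
    using node_complex_cong[of P N N'] node_complex_cong[of P N' N] assms by auto
  show ?thesis
  proof (cases "length ls = CARD('d) + 1 \<and> set ls \<subseteq> node_labels P")
    case True
    then have N: "N l = N' l" if "l \<in> set ls" for l
      using assms node_labels_subset that by blast
    then have m: "map N ls = map N' ls" by simp
    have nth: "N (ls ! i) = N' (ls ! i)" if "i \<le> CARD('d)" for i
      using that True by (intro N nth_mem) simp
    have "(\<forall>k \<le> CARD('d). G k \<in> node_complex P N' \<and> sdim (G k) = int k \<and> (\<forall>i \<le> k. N (ls ! i) \<in> G k)) \<longleftrightarrow>
      (\<forall>k \<le> CARD('d). G k \<in> node_complex P N' \<and> sdim (G k) = int k \<and> (\<forall>i \<le> k. N' (ls ! i) \<in> G k))" for G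
      by (auto simp: nth)
    then show ?thesis unfolding node_frame_def nc m by simp
  qed (auto simp: node_frame_def)
qed

lemma qf_same_orientation:
  fixes P P' :: "env \<Rightarrow> (real^'d) set list"
  assumes P: "dcells n P" and P': "dcells n P'"
  shows "qf (\<lambda>e. same_orientation (P e) (P' e))"
proof -
  define Lb where "Lb = possible_labels n CARD('d)"
  \<comment> \<open>Contains every node frame of either partition, so the universal quantifier over
    frames is finite.\<close>
  define F where "F = {ls. set ls \<subseteq> Lb \<and> length ls = CARD('d) + 1}"
  have n: "length (P e) = n" "length (P' e) = n" for e using P P' by (simp_all add: dcells_def)
  have finLb: "finite Lb" by (simp add: Lb_def finite_possible_labels)
  have finF: "finite F" unfolding F_def using finLb by (rule finite_lists_length_eq)
  define Q where "Q e N N' \<longleftrightarrow> node_system (P e) N \<and> node_system (P' e) N' \<and>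
      (\<forall>ls\<in>F. node_frame (P e) N ls \<and> node_frame (P' e) N' ls \<longrightarrow>
              sgn (list_det (map N ls)) = sgn (list_det (map N' ls)))" for e N N'
  have "ls \<in> F" if "node_frame (P e) N ls" for ls N e
    using that node_labels_subset[of "P e"] n unfolding node_frame_def F_def Lb_def by auto
  then have iff: "same_orientation (P e) (P' e) \<longleftrightarrow> (\<exists>N N'. Q e N N')" for e
    unfolding same_orientation_def Q_def by blast
  have cong: "Q e M M'" if Q: "Q e N N'" and "\<And>l. l \<in> Lb \<Longrightarrow> N l = M l" "\<And>l. l \<in> Lb \<Longrightarrow> N' l = M' l" for e N N' M M'
  proof -
    have det: "map N ls = map M ls" "map N' ls = map M' ls" if "ls \<in> F" for ls
      using that \<open>\<And>l. l \<in> Lb \<Longrightarrow> N l = M l\<close> \<open>\<And>l. l \<in> Lb \<Longrightarrow> N' l = M' l\<close> by (auto simp: F_def)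
    have frame: "node_frame (P e) N ls = node_frame (P e) M ls" "node_frame (P' e) N' ls = node_frame (P' e) M' ls" for ls
      using that by (intro node_frame_cong; simp add: n Lb_def)+
    have sys: "node_system (P e) M" "node_system (P' e) M'"
      using Q node_system_cong[of "P e" N M] node_system_cong[of "P' e" N' M'] that(2,3)
      by (simp_all add: n Lb_def Q_def)
    have "sgn (list_det (map M ls)) = sgn (list_det (map M' ls))"
      if "ls \<in> F" "node_frame (P e) M ls" "node_frame (P' e) M' ls" for ls
    proof -
      have "sgn (list_det (map N ls)) = sgn (list_det (map N' ls))"
        using Q that frame unfolding Q_def by blast
      then show ?thesis unfolding det[OF that(1)] .
    qed
    with sys show ?thesis unfolding Q_def by blast
  qed
  have "qf (\<lambda>e. \<exists>N N'. Q e N N')"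
  proof (rule qf_ex_fun[OF finLb])
    fix N M e assume "\<And>l. l \<in> Lb \<Longrightarrow> N l = M l" "\<exists>N'. Q e N N'"
    then show "\<exists>N'. Q e M N'" using cong by blast
  next
    fix N :: "env \<Rightarrow> node_label \<Rightarrow> real^('d option)" and \<rho>
    assume N: "\<And>l. pvec (\<lambda>e. N e l)" and \<rho>: "denv \<rho>"
    show "qf (\<lambda>e. \<exists>N'. Q (\<rho> e) (N e) N')"
    proof (rule qf_ex_fun[OF finLb])
      fix N' M' e assume "\<And>l. l \<in> Lb \<Longrightarrow> N' l = M' l" "Q (\<rho> e) (N e) N'"
      then show "Q (\<rho> e) (N e) M'" using cong by blast
    next
      fix N' :: "env \<Rightarrow> node_label \<Rightarrow> real^('d option)" and \<rho>'
      assume N': "\<And>l. pvec (\<lambda>e. N' e l)" and \<rho>': "denv \<rho>'"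
      have dP: "dcells n (\<lambda>e. P (\<rho> (\<rho>' e)))" "dcells n (\<lambda>e. P' (\<rho> (\<rho>' e)))"
        using dcells_comp P P' denv_comp[OF \<rho> \<rho>'] by blast+
      have dN: "dfun (\<lambda>e. N (\<rho>' e))" "dfun N'"
        using N N' dfun_comp[OF _ \<rho>'] by (auto simp: dfun_def)
      have len: "length ls = CARD('d) + 1" if "ls \<in> F" for ls using that by (simp add: F_def)
      show "qf (\<lambda>e. Q (\<rho> (\<rho>' e)) (N (\<rho>' e)) (N' e))"
        unfolding Q_def sgn_eq_iff
        by (intro qf.conj qf_imp qf_iff qf_ball_finite[OF finF] qf_node_system[OF dP(1) dN(1)]
            qf_node_system[OF dP(2) dN(2)] qf_node_frame[OF dP(1) dN(1)] qf_node_frame[OF dP(2) dN(2)]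
            qf_less qf_eq PT_const PT_list_det[OF dN(1)] PT_list_det[OF dN(2)] len)
    qed
  qed
  then show ?thesis by (simp add: iff)
qed

lemma qf_comb_equivalent:
  fixes P P' :: "env \<Rightarrow> (real^'d) set list"
  assumes P: "dcells n P" and P': "dcells n P'"
  shows "qf (\<lambda>e. comb_equivalent (P e) (P' e))"
proof -
  have sub: "face_indices (P e) \<subseteq> Pow (indices n)" "face_indices (P' e) \<subseteq> Pow (indices n)" for e
    using face_indices_subset[of "P e"] face_indices_subset[of "P' e"]
    by (simp_all add: cell_indices_dcells[OF P] cell_indices_dcells[OF P'])
  have "comb_equivalent (P e) (P' e) \<longleftrightarrow>
      (\<forall>I\<in>Pow (indices n). (I \<in> face_indices (P e) \<longleftrightarrow> I \<in> face_indices (P' e))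
        \<and> (I \<in> face_indices (P e) \<longrightarrow> (half_linear (face (P e) I) \<longleftrightarrow> half_linear (face (P' e) I))))
      \<and> same_orientation (P e) (P' e)" for e
    unfolding comb_equivalent_def using sub[of e] by blast
  moreover have "qf (\<lambda>e. (\<forall>I\<in>Pow (indices n). (I \<in> face_indices (P e) \<longleftrightarrow> I \<in> face_indices (P' e))
        \<and> (I \<in> face_indices (P e) \<longrightarrow> (half_linear (face (P e) I) \<longleftrightarrow> half_linear (face (P' e) I))))
      \<and> same_orientation (P e) (P' e))"
    by (rule qf.conj[OF qf_ball_finite[OF _ qf.conj[OF qf_iff[OF qf_face_indices[OF P] qf_face_indices[OF P']]
              qf_imp[OF qf_face_indices[OF P] qf_iff[OF qf_half_linear[OF dset_face[OF P]] qf_half_linear[OF dset_face[OF P']]]]]]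
          qf_same_orientation[OF P P']]) auto
  ultimately show ?thesis by simp
qed

section \<open>Semialgebraic sets\<close>

lemma semialgebraic_Un:
  assumes "semialgebraic J S" "semialgebraic J T"
  shows "semialgebraic J (S \<union> T)"
proof -
  obtain \<S> where \<S>: "finite \<S>" "\<forall>(E, G) \<in> \<S>. finite E \<and> finite G \<and> (\<forall>f \<in> E \<union> G. mpoly_fun J f)"
    "S = (\<Union>(E, G) \<in> \<S>. {x \<in> J \<rightarrow>\<^sub>E UNIV. (\<forall>f \<in> E. f x = 0) \<and> (\<forall>g \<in> G. g x > 0)})"
    using assms(1) unfolding semialgebraic_def by blast
  obtain \<T> where \<T>: "finite \<T>" "\<forall>(E, G) \<in> \<T>. finite E \<and> finite G \<and> (\<forall>f \<in> E \<union> G. mpoly_fun J f)"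
    "T = (\<Union>(E, G) \<in> \<T>. {x \<in> J \<rightarrow>\<^sub>E UNIV. (\<forall>f \<in> E. f x = 0) \<and> (\<forall>g \<in> G. g x > 0)})"
    using assms(2) unfolding semialgebraic_def by blast
  show ?thesis
    unfolding semialgebraic_def using \<S>(1,2) \<T>(1,2)
    by (intro exI[of _ "\<S> \<union> \<T>"]) (auto simp: \<S>(3) \<T>(3))
qed

lemma semialgebraic_Int:
  assumes "semialgebraic J S" "semialgebraic J T"
  shows "semialgebraic J (S \<inter> T)"
proof -
  obtain \<S> where \<S>: "finite \<S>" "\<forall>(E, G) \<in> \<S>. finite E \<and> finite G \<and> (\<forall>f \<in> E \<union> G. mpoly_fun J f)"
    "S = (\<Union>(E, G) \<in> \<S>. {x \<in> J \<rightarrow>\<^sub>E UNIV. (\<forall>f \<in> E. f x = 0) \<and> (\<forall>g \<in> G. g x > 0)})"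
    using assms(1) unfolding semialgebraic_def by blast
  obtain \<T> where \<T>: "finite \<T>" "\<forall>(E, G) \<in> \<T>. finite E \<and> finite G \<and> (\<forall>f \<in> E \<union> G. mpoly_fun J f)"
    "T = (\<Union>(E, G) \<in> \<T>. {x \<in> J \<rightarrow>\<^sub>E UNIV. (\<forall>f \<in> E. f x = 0) \<and> (\<forall>g \<in> G. g x > 0)})"
    using assms(2) unfolding semialgebraic_def by blast
  \<comment> \<open>Distributing the intersection over the unions merges every pair of systems into
    one.\<close>
  define \<U> where "\<U> = (\<lambda>((E, G), (E', G')). (E \<union> E', G \<union> G')) ` (\<S> \<times> \<T>)"
  have "finite \<U>" using \<S>(1) \<T>(1) by (simp add: \<U>_def)
  moreover have "\<forall>(E, G) \<in> \<U>. finite E \<and> finite G \<and> (\<forall>f \<in> E \<union> G. mpoly_fun J f)"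
    using \<S>(2) \<T>(2) unfolding \<U>_def by fastforce
  moreover have "S \<inter> T = (\<Union>(E, G) \<in> \<U>. {x \<in> J \<rightarrow>\<^sub>E UNIV. (\<forall>f \<in> E. f x = 0) \<and> (\<forall>g \<in> G. g x > 0)})"
  proof (intro equalityI subsetI)
    fix x assume "x \<in> S \<inter> T"
    then obtain E G E' G' where EG: "(E, G) \<in> \<S>" "(E', G') \<in> \<T>" and x: "x \<in> J \<rightarrow>\<^sub>E UNIV"
      "\<forall>f\<in>E. f x = 0" "\<forall>f\<in>E'. f x = 0" "\<forall>g\<in>G. g x > 0" "\<forall>g\<in>G'. g x > 0"
      unfolding \<S>(3) \<T>(3) by auto
    have "(E \<union> E', G \<union> G') \<in> \<U>" using EG by (force simp: \<U>_def)
    then show "x \<in> (\<Union>(E, G) \<in> \<U>. {x \<in> J \<rightarrow>\<^sub>E UNIV. (\<forall>f \<in> E. f x = 0) \<and> (\<forall>g \<in> G. g x > 0)})"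
      by (rule UN_I) (use x in auto)
  next
    fix x assume "x \<in> (\<Union>(E, G) \<in> \<U>. {x \<in> J \<rightarrow>\<^sub>E UNIV. (\<forall>f \<in> E. f x = 0) \<and> (\<forall>g \<in> G. g x > 0)})"
    then obtain E G E' G' where EG: "(E, G) \<in> \<S>" "(E', G') \<in> \<T>" and x: "x \<in> J \<rightarrow>\<^sub>E UNIV"
      "\<forall>f\<in>E. f x = 0" "\<forall>f\<in>E'. f x = 0" "\<forall>g\<in>G. g x > 0" "\<forall>g\<in>G'. g x > 0"
      unfolding \<U>_def by auto
    have "x \<in> S" unfolding \<S>(3) by (rule UN_I[OF EG(1)]) (use x in auto)
    moreover have "x \<in> T" unfolding \<T>(3) by (rule UN_I[OF EG(2)]) (use x in auto)
    ultimately show "x \<in> S \<inter> T" by blast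
  qed
  ultimately show ?thesis unfolding semialgebraic_def by blast
qed

lemma semialgebraic_pos:
  assumes "mpoly_fun J f"
  shows "semialgebraic J {x \<in> J \<rightarrow>\<^sub>E UNIV. f x > 0}"
  unfolding semialgebraic_def using assms
  by (intro exI[of _ "{({}, {f})}"]) auto

lemma semialgebraic_zero:
  assumes "mpoly_fun J f"
  shows "semialgebraic J {x \<in> J \<rightarrow>\<^sub>E UNIV. f x = 0}"
  unfolding semialgebraic_def using assms
  by (intro exI[of _ "{({f}, {})}"]) auto

lemma mpoly_fun_subst:
  assumes "PT g" "\<And>k. mpoly_fun J (s k)"
  shows "mpoly_fun J (\<lambda>x. g (\<lambda>k. s k x))"
  using assms(1) by (induction rule: mpoly_fun.induct) (auto intro: mpoly_fun.intros assms(2))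

text \<open>The normal form has no negation, so the induction carries a predicate together with its
  complement. At an atom, the complement of f > 0 splits into f = 0 and - f > 0; conjunctions are
  complemented by De Morgan.\<close>

lemma semialgebraic_qf:
  assumes "qf A" and s: "\<And>k. mpoly_fun J (s k)"
  shows "semialgebraic J {x \<in> J \<rightarrow>\<^sub>E UNIV. A (\<lambda>k. s k x)}"
proof -
  have "semialgebraic J {x \<in> J \<rightarrow>\<^sub>E UNIV. A (\<lambda>k. s k x)} \<and> semialgebraic J {x \<in> J \<rightarrow>\<^sub>E UNIV. \<not> A (\<lambda>k. s k x)}"
    using assms(1)
  proof (induction rule: qf.induct)
    case (pos f)
    have f: "mpoly_fun J (\<lambda>x. f (\<lambda>k. s k x))" by (rule mpoly_fun_subst[OF pos s])
    have mf: "mpoly_fun J (\<lambda>x. - f (\<lambda>k. s k x))"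
      using mpoly_fun.mult[OF mpoly_fun.const[of J "-1"] f] by simp
    have "{x \<in> J \<rightarrow>\<^sub>E UNIV. \<not> 0 < f (\<lambda>k. s k x)} = {x \<in> J \<rightarrow>\<^sub>E UNIV. f (\<lambda>k. s k x) = 0}
        \<union> {x \<in> J \<rightarrow>\<^sub>E UNIV. 0 < - f (\<lambda>k. s k x)}" by auto
    then show ?case
      using semialgebraic_pos[OF f] semialgebraic_Un[OF semialgebraic_zero[OF f] semialgebraic_pos[OF mf]]
      by (simp only:)
  next
    case (neg A)
    then show ?case by simp
  next
    case (conj A B)
    have "{x \<in> J \<rightarrow>\<^sub>E UNIV. A (\<lambda>k. s k x) \<and> B (\<lambda>k. s k x)}
        = {x \<in> J \<rightarrow>\<^sub>E UNIV. A (\<lambda>k. s k x)} \<inter> {x \<in> J \<rightarrow>\<^sub>E UNIV. B (\<lambda>k. s k x)}"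
      "{x \<in> J \<rightarrow>\<^sub>E UNIV. \<not> (A (\<lambda>k. s k x) \<and> B (\<lambda>k. s k x))}
        = {x \<in> J \<rightarrow>\<^sub>E UNIV. \<not> A (\<lambda>k. s k x)} \<union> {x \<in> J \<rightarrow>\<^sub>E UNIV. \<not> B (\<lambda>k. s k x)}"
      by blast+
    with conj show ?case by (simp only: semialgebraic_Int semialgebraic_Un)
  qed
  then show ?thesis ..
qed

section \<open>Partitions parametrized by separating vectors\<close>

lemma inner_homog: "c \<bullet> homog x = c $ None + (\<chi> k. c $ Some k) \<bullet> x"
  by (simp add: inner_vec_def UNIV_option_conv homog_nth sum.reindex)

text \<open>No relation between \<open>a (i, j)\<close> and \<open>a (j, i)\<close> is built in;
  that the cells form a partition is imposed as a separate definable condition.\<close>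

definition halfspace_cell ::
    "nat \<Rightarrow> (nat \<times> nat \<Rightarrow> real^('d option)) \<Rightarrow> nat \<Rightarrow> (real^'d) set" where
  "halfspace_cell n a i = {x. \<forall>j\<in>{..<n}. j \<noteq> i \<longrightarrow> a (i, j) \<bullet> homog x < 0}"

definition halfspace_cells ::
    "nat \<Rightarrow> (nat \<times> nat \<Rightarrow> real^('d option)) \<Rightarrow> (real^'d) set list" where
  "halfspace_cells n a = map (halfspace_cell n a) [0..<n]"

lemma halfspace_cells_simps [simp]:
  "length (halfspace_cells n a) = n"
  "i < n \<Longrightarrow> halfspace_cells n a ! i = halfspace_cell n a i"
  by (simp_all add: halfspace_cells_def)

lemma halfspace_cells_cong:
  assumes "\<And>l. l \<in> {..<n} \<times> {..<n} \<Longrightarrow> a l = b l"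
  shows "halfspace_cells n a = halfspace_cells n b"
  using assms by (auto simp: halfspace_cells_def halfspace_cell_def)

lemma halfspace_cell_Inter:
  "halfspace_cell n a i = (\<Inter>j\<in>{..<n} - {i}. {x. (\<chi> k. a (i, j) $ Some k) \<bullet> x < - a (i, j) $ None})"
proof -
  have "p + q < 0 \<longleftrightarrow> q < - p" for p q :: real by linarith
  then show ?thesis by (auto simp: halfspace_cell_def inner_homog)
qed

lemma open_halfspace_cell: "open (halfspace_cell n a i)"
  unfolding halfspace_cell_Inter by (intro open_INT ballI open_halfspace_lt) auto

lemma convex_halfspace_cell: "convex (halfspace_cell n a i)"
  unfolding halfspace_cell_Inter by (intro convex_INT convex_halfspace_lt)

text \<open>Convexity gives a weakly separating hyperplane. A point of an open set lying on it could
  be pushed across along the normal without leaving the set, so the separation is strict.\<close>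

lemma strict_separation_open:
  fixes S T :: "(real^'d) set"
  assumes "open S" "open T" "convex S" "convex T" "S \<noteq> {}" "T \<noteq> {}" "S \<inter> T = {}"
  shows "\<exists>c. (\<forall>x\<in>S. c \<bullet> homog x < 0) \<and> (\<forall>x\<in>T. c \<bullet> homog x > 0)"
proof -
  obtain a b where ab: "a \<noteq> 0" "\<forall>x\<in>S. a \<bullet> x \<le> b" "\<forall>x\<in>T. b \<le> a \<bullet> x"
    using separating_hyperplane_sets[OF assms(3-7)] by blast
  have strict: "\<exists>\<epsilon>>0. x + \<epsilon> *\<^sub>R v \<in> U" if "open U" "x \<in> U" for U and x v :: "real^'d"
  proof -
    have "((\<lambda>\<epsilon>. x + \<epsilon> *\<^sub>R v) \<longlongrightarrow> x + 0 *\<^sub>R v) (at_right 0)"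
      by (intro tendsto_intros)
    then have "\<forall>\<^sub>F \<epsilon> in at_right 0. x + \<epsilon> *\<^sub>R v \<in> U"
      using topological_tendstoD that by fastforce
    then have "\<exists>\<epsilon>. 0 < \<epsilon> \<and> x + \<epsilon> *\<^sub>R v \<in> U"
      unfolding eventually_at_right_field by (metis dense)
    then show ?thesis by blast
  qed
  have aa: "a \<bullet> a > 0" using ab(1) by simp
  have S: "a \<bullet> x < b" if x: "x \<in> S" for x
  proof -
    obtain \<epsilon> where "\<epsilon> > 0" "x + \<epsilon> *\<^sub>R a \<in> S" using strict[OF assms(1) x] by blast
    then have "a \<bullet> x + \<epsilon> * (a \<bullet> a) \<le> b" "\<epsilon> * (a \<bullet> a) > 0" using ab(2) aa by (auto simp: inner_add_right)
    then show ?thesis by linarith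
  qed
  have T: "b < a \<bullet> x" if x: "x \<in> T" for x
  proof -
    obtain \<epsilon> where "\<epsilon> > 0" "x + \<epsilon> *\<^sub>R (- a) \<in> T" using strict[OF assms(2) x] by blast
    then have "b \<le> a \<bullet> (x + \<epsilon> *\<^sub>R (- a))" "\<epsilon> * (a \<bullet> a) > 0" using ab(3) aa by auto
    moreover have "a \<bullet> (x + \<epsilon> *\<^sub>R (- a)) = a \<bullet> x - \<epsilon> * (a \<bullet> a)" by (simp add: inner_diff_right)
    ultimately show ?thesis by linarith
  qed
  \<comment> \<open>The affine function \<open>a \<bullet> x - b\<close> in homogeneous form, with
    the constant term as 0-th coordinate.\<close>
  define c :: "real^('d option)" where "c = (\<chi> l. case l of None \<Rightarrow> - b | Some k \<Rightarrow> a $ k)"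
  have "c \<bullet> homog x = a \<bullet> x - b" for x
    by (simp add: inner_homog c_def)
  with S T show ?thesis by (intro exI[of _ c]) auto
qed

lemma convex_partition_separation:
  assumes P: "P \<in> convex_partitions n" and ij: "i < n" "j < n" "i \<noteq> j"
  shows "\<exists>c. (\<forall>x\<in>P ! i. c \<bullet> homog x < 0) \<and> (\<forall>x\<in>P ! j. c \<bullet> homog x > 0)"
  using P ij by (intro strict_separation_open) (auto simp: convex_partitions_def)

text \<open>Every point of the halfspace cell lies in the closure of the original cell, since it avoids
  all the others; an open convex set is the interior of its closure.\<close>

lemma convex_partition_halfspace_cells:
  fixes P :: "(real^'d) set list"
  assumes P: "P \<in> convex_partitions n"
  shows "\<exists>a. P = halfspace_cells n a"
proof -
  have "\<exists>c. (\<forall>x\<in>P ! i. c \<bullet> homog x < 0) \<and> (\<forall>x\<in>P ! j. c \<bullet> homog x > 0)"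
    if "i < n \<and> j < n \<and> i \<noteq> j" for i j
    using convex_partition_separation[OF P] that by blast
  then obtain A where A: "\<And>i j. i < n \<and> j < n \<and> i \<noteq> j \<Longrightarrow>
      (\<forall>x\<in>P ! i. A i j \<bullet> homog x < 0) \<and> (\<forall>x\<in>P ! j. A i j \<bullet> homog x > 0)"
    by metis
  define a where "a = (\<lambda>(i, j). A i j)"
  have "P ! i = halfspace_cell n a i" if i: "i < n" for i
  proof
    show sub: "P ! i \<subseteq> halfspace_cell n a i"
      using A i by (auto simp: halfspace_cell_def a_def)
    have disj: "halfspace_cell n a i \<inter> closure (P ! j) = {}" if j: "j < n" "j \<noteq> i" for j
    proof -
      have "halfspace_cell n a i \<inter> P ! j = {}"
        using A[of i j] i j by (force simp: halfspace_cell_def a_def)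
      then show ?thesis
        by (simp add: open_Int_closure_eq_empty open_halfspace_cell)
    qed
    have "halfspace_cell n a i \<subseteq> closure (P ! i)"
    proof
      fix x assume x: "x \<in> halfspace_cell n a i"
      have "x \<in> (\<Union>i<n. closure (P ! i))" using P by (auto simp: convex_partitions_def)
      then obtain j where "j < n" "x \<in> closure (P ! j)" by blast
      with disj[of j] x show "x \<in> closure (P ! i)" by (cases "j = i") auto
    qed
    then have "halfspace_cell n a i \<subseteq> interior (closure (P ! i))"
      by (intro interior_maximal open_halfspace_cell)
    also have "\<dots> = P ! i"
      using P i by (simp add: convex_partitions_def convex_interior_closure interior_open)
    finally show "halfspace_cell n a i \<subseteq> P ! i" .
  qed
  moreover have "length P = n" using P by (simp add: convex_partitions_def)
  ultimately have "P = halfspace_cells n a" by (intro nth_equalityI) auto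
  then show ?thesis by blast
qed

lemma dset_halfspace_cell:
  assumes a: "dfun a"
  shows "dset (\<lambda>e. halfspace_cell n (a e) i)"
  unfolding halfspace_cell_def
  by (rule dset_Collect, rule qf_ball_finite[OF _ qf_imp[OF qf_const qf_less[OF
            PT_inner[OF pvec_comp[OF dfunD[OF a]] pvec_homog] PT_const]]]) simp_all

lemma dcells_halfspace_cells: "dfun a \<Longrightarrow> dcells n (\<lambda>e. halfspace_cells n (a e))"
  by (simp add: dcells_def dset_halfspace_cell)

text \<open>Openness and convexity hold for every choice of \<open>a\<close>, which leaves
  non-emptiness, disjointness and covering to be expressed.\<close>

lemma qf_convex_partition:
  fixes a :: "env \<Rightarrow> nat \<times> nat \<Rightarrow> real^('d::finite option)"
  assumes a: "dfun a"
  shows "qf (\<lambda>e. halfspace_cells n (a e) \<in> convex_partitions n)"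
proof -
  note C = dset_halfspace_cell[OF a]
  have "halfspace_cells n (a e) \<in> convex_partitions n \<longleftrightarrow>
      (\<forall>i\<in>{..<n}. halfspace_cell n (a e) i \<noteq> {})
      \<and> (\<forall>i\<in>{..<n}. \<forall>j\<in>{..<n}. i \<noteq> j \<longrightarrow> halfspace_cell n (a e) i \<inter> halfspace_cell n (a e) j = {})
      \<and> (\<Union>i\<in>{..<n}. closure (halfspace_cell n (a e) i)) = UNIV" for e
    by (simp add: convex_partitions_def open_halfspace_cell convex_halfspace_cell Ball_def cong: SUP_cong_simp)
  moreover have "qf (\<lambda>e. (\<forall>i\<in>{..<n}. halfspace_cell n (a e) i \<noteq> {})
      \<and> (\<forall>i\<in>{..<n}. \<forall>j\<in>{..<n}. i \<noteq> j \<longrightarrow> halfspace_cell n (a e) i \<inter> halfspace_cell n (a e) j = {})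
      \<and> (\<Union>i\<in>{..<n}. closure (halfspace_cell n (a e) i)) = UNIV)"
    by (intro qf.conj qf_ball_finite qf_imp qf_const qf.neg qf_set_eq dset_Int dset_UN_finite dset_closure
        C dset_empty dset_UNIV finite_lessThan)
  ultimately show ?thesis by simp
qed

section \<open>Existence and uniqueness of wall normals\<close>

text \<open>Equator vectors are limits of vectors pushed slightly below the equator and normalized.
  Used contrapositively: a vector outside this cone has a positive 0-th coordinate and hence comes
  from a point of the affine space.\<close>

lemma cell_cone_infinity:
  fixes v :: "real^('d::finite option)" and P :: "(real^('d::finite)) set list"
  assumes "v $ None \<le> 0"
  shows "v \<in> cell_cone P \<infinity>"
proof (cases "v = 0")
  case False
  define e0 :: "real^('d option)" where "e0 = axis None 1"
  define u where "u = (\<lambda>n. v - inverse (real (Suc n)) *\<^sub>R e0)"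
  have neg: "u n $ None < 0" for n
    using assms by (simp add: u_def e0_def) (smt (verit) inverse_positive_iff_positive of_nat_0_less_iff of_nat_Suc zero_less_Suc)
  then have nz: "u n \<noteq> 0" for n by (metis less_irrefl zero_index)
  have "u \<longlonglongrightarrow> v - 0 *\<^sub>R e0"
    unfolding u_def by (intro tendsto_intros LIMSEQ_inverse_real_of_nat)
  then have "(\<lambda>n. u n /\<^sub>R norm (u n)) \<longlonglongrightarrow> v /\<^sub>R norm v"
    using False by (intro tendsto_intros) auto
  moreover have "u n /\<^sub>R norm (u n) \<in> hat_cell P \<infinity>" for n
    using neg[of n] nz[of n] by (simp add: hat_cell_def divide_simps mult_less_0_iff)
  ultimately have "v /\<^sub>R norm v \<in> closure (hat_cell P \<infinity>)"
    unfolding closure_sequential by (intro exI[of _ "\<lambda>n. u n /\<^sub>R norm (u n)"]) simp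
  then have "norm v *\<^sub>R (v /\<^sub>R norm v) \<in> cell_cone P \<infinity>"
    unfolding cell_cone_def by (intro convex_cone_hull_mul hull_inc) auto
  with False show ?thesis by simp
qed (simp add: cell_cone_def convex_cone_hull_contains_0)

lemma homog_decompose: "v $ None \<noteq> 0 \<Longrightarrow> v = v $ None *\<^sub>R homog (\<chi> k. v $ Some k / v $ None)"
  by (auto simp: vec_eq_iff homog_def split: option.split)

lemma continuous_on_homog: "continuous_on A (homog :: real^'d \<Rightarrow> _)"
proof -
  have "continuous_on A (\<lambda>x :: real^'d. homog x $ i)" for i
    by (cases i) (auto simp: homog_nth intro!: continuous_intros)
  then have "continuous_on A (\<lambda>x :: real^'d. \<chi> i. homog x $ i)"
    by (rule continuous_on_vec_lambda)
  then show ?thesis by simp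
qed

lemma hat_closure: "y \<in> closure S \<Longrightarrow> hat y \<in> closure (hat ` S)" for S :: "(real^'d) set"
proof -
  have "norm (homog x) \<noteq> 0" for x :: "real^'d" using homog_nonzero[of x] by linarith
  then have "continuous_on UNIV (\<lambda>x :: real^'d. homog x /\<^sub>R norm (homog x))"
    by (intro continuous_intros continuous_on_homog) blast
  then have "continuous_on UNIV (hat :: real^'d \<Rightarrow> _)"
    by (simp add: hat_altdef[abs_def])
  then have "continuous_on (closure S) hat"
    by (rule continuous_on_subset) simp
  then have "hat ` closure S \<subseteq> closure (hat ` S)"
    by (intro image_closure_subset) (auto intro: closure_subset[THEN subsetD])
  then show "y \<in> closure S \<Longrightarrow> hat y \<in> closure (hat ` S)" by blast
qed

lemma homog_in_cell_cone:
  assumes "y \<in> closure (P ! k)" "0 \<le> t"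
  shows "t *\<^sub>R homog y \<in> cell_cone P (enat k)"
proof -
  have "hat y \<in> closure (hat_cell P (enat k))"
    using hat_closure[OF assms(1)] by (simp add: hat_cell_def)
  then have "(t * norm (homog y)) *\<^sub>R hat y \<in> cell_cone P (enat k)"
    unfolding cell_cone_def using assms(2) by (intro convex_cone_hull_mul hull_inc) auto
  then show ?thesis using homog_nonzero[of y] by (simp add: hat_altdef mult.assoc)
qed

text \<open>A homogeneous weak inequality survives positive scaling, closure and conic hulls; only
  strictness is lost.\<close>

lemma cell_cone_halfspace:
  assumes "\<forall>x\<in>P ! k. c \<bullet> homog x < 0" "v \<in> cell_cone P (enat k)"
  shows "c \<bullet> v \<le> 0"
proof -
  have "hat ` (P ! k) \<subseteq> {x. c \<bullet> x \<le> 0}"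
  proof
    fix v assume "v \<in> hat ` (P ! k)"
    then obtain x where x: "x \<in> P ! k" "v = hat x" by blast
    have "c \<bullet> v = inverse (norm (homog x)) * (c \<bullet> homog x)" by (simp add: x hat_altdef)
    also have "\<dots> \<le> 0" using assms(1) x(1) by (intro mult_nonneg_nonpos) (auto simp: less_imp_le)
    finally show "v \<in> {x. c \<bullet> x \<le> 0}" by simp
  qed
  then have "closure (hat ` (P ! k)) \<subseteq> {x. c \<bullet> x \<le> 0}"
    by (intro closure_minimal closed_halfspace_le)
  then have "cell_cone P (enat k) \<subseteq> {x. c \<bullet> x \<le> 0}"
    unfolding cell_cone_def by (intro hull_minimal convex_cone_halfspace_le) (simp add: hat_cell_def)
  with assms(2) show ?thesis by blast
qed

text \<open>Near a point lying in no cell cone but those of \<open>i\<close> and \<open>j\<close>, moving in direction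
  \<open>c - c'\<close> leads to points on the wrong side for both cells.\<close>

lemma separating_vector_unique:
  fixes P :: "(real^'d) set list"
  assumes P: "P \<in> convex_partitions n" and ij: "(i, j) \<in> adjacent_pairs P"
    and c: "norm c = 1" "\<forall>x\<in>P ! i. c \<bullet> homog x < 0" "\<forall>x\<in>P ! j. c \<bullet> homog x > 0"
    and c': "norm c' = 1" "\<forall>x\<in>P ! i. c' \<bullet> homog x < 0" "\<forall>x\<in>P ! j. c' \<bullet> homog x > 0"
  shows "c = c'"
proof (rule ccontr)
  assume neq: "c \<noteq> c'"
  have len: "length P = n" using P by (simp add: convex_partitions_def)
  \<comment> \<open>Adjacency supplies a vector lying in the cones of \<open>i\<close> and
    \<open>j\<close> and in no other, not even the one at infinity.\<close>
  obtain v where v: "cells_at P v = {enat i, enat j}"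
    using ij by (auto simp: adjacent_pairs_def face_indices_def)
  have vC: "v \<in> cell_cone P (enat k) \<longleftrightarrow> k = i \<or> k = j" if "k < n" for k
  proof -
    have "enat k \<in> cell_indices P" using that len by (simp add: cell_indices_def)
    then have "v \<in> cell_cone P (enat k) \<longleftrightarrow> enat k \<in> cells_at P v" by (simp add: cells_at_def)
    then show ?thesis by (simp add: v)
  qed
  have "\<infinity> \<notin> cells_at P v" by (simp add: v)
  then have "v \<notin> cell_cone P \<infinity>" by (simp add: cells_at_def cell_indices_def)
  then have v0: "v $ None > 0" using cell_cone_infinity[of v P] by (simp add: not_le[symmetric] del: not_le) (meson not_le)
  have lt: "i < n" "j < n" using ij len by (auto simp: adjacent_pairs_def)
  \<comment> \<open>Lying in both cones, \<open>v\<close> satisfies the opposite weak inequalities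
    at once.\<close>
  have zero: "c \<bullet> v = 0" if "\<forall>x\<in>P ! i. c \<bullet> homog x < 0" "\<forall>x\<in>P ! j. c \<bullet> homog x > 0" for c
  proof -
    have "c \<bullet> v \<le> 0" using cell_cone_halfspace[OF that(1)] vC lt by blast
    moreover have "\<forall>x\<in>P ! j. (- c) \<bullet> homog x < 0" using that(2) by simp
    then have "(- c) \<bullet> v \<le> 0" using cell_cone_halfspace[of P j "- c" v] vC lt by blast
    ultimately show ?thesis by simp
  qed
  define w where "w = c - c'"
  have cc: "c \<bullet> c = 1" "c' \<bullet> c' = 1" using c(1) c'(1) by (simp_all add: norm_eq_1)
  \<comment> \<open>Distinct unit vectors have inner product less than 1, so \<open>w\<close> has
    positive inner product with \<open>c\<close> and negative with \<open>c'\<close>.\<close>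
  have "w \<bullet> w > 0" using neq by (simp add: w_def)
  then have "c \<bullet> c' < 1" using cc by (simp add: w_def inner_diff_left inner_diff_right inner_commute)
  then have cw: "c \<bullet> w > 0" "c' \<bullet> w < 0" using cc by (simp_all add: w_def inner_diff_right inner_commute)
  \<comment> \<open>A closed set missing the projection of \<open>v\<close>. Points close to that
    projection can therefore only be covered by the closures of the cells \<open>i\<close> and
    \<open>j\<close>.\<close>
  define K where "K = (\<Union>k\<in>{..<n} - {i, j}. closure (P ! k))"
  define proj where "proj = (\<lambda>u :: real^('d option). \<chi> k. u $ Some k / u $ None)"
  have vK: "proj v \<notin> K"
  proof
    assume "proj v \<in> K"
    then obtain k where k: "k < n" "k \<noteq> i" "k \<noteq> j" "proj v \<in> closure (P ! k)" by (auto simp: K_def)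
    have "v $ None *\<^sub>R homog (proj v) \<in> cell_cone P (enat k)"
      using homog_in_cell_cone[OF k(4)] v0 by simp
    then have "v \<in> cell_cone P (enat k)"
      using homog_decompose[of v] v0 by (simp add: proj_def)
    with vC k show False by blast
  qed
  have "closed K" unfolding K_def by (intro closed_UN) auto
  then have "open (- K)" by (rule open_Compl)
  define u where "u = (\<lambda>m. v + inverse (real (Suc m)) *\<^sub>R w)"
  have ulim: "u \<longlonglongrightarrow> v + 0 *\<^sub>R w"
    unfolding u_def by (intro tendsto_intros LIMSEQ_inverse_real_of_nat)
  then have "(\<lambda>m. proj (u m)) \<longlonglongrightarrow> proj v"
    unfolding proj_def using v0 by (intro tendsto_vec_lambda tendsto_intros) (auto intro!: tendsto_vec_nth)
  then have "\<forall>\<^sub>F m in sequentially. proj (u m) \<in> - K"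
    by (rule topological_tendstoD) (use vK \<open>open (- K)\<close> in auto)
  moreover have "(\<lambda>m. u m $ None) \<longlonglongrightarrow> v $ None"
    using ulim by (auto intro!: tendsto_vec_nth)
  then have "\<forall>\<^sub>F m in sequentially. u m $ None > 0"
    using v0 by (intro order_tendstoD)
  ultimately have "\<forall>\<^sub>F m in sequentially. proj (u m) \<in> - K \<and> u m $ None > 0"
    by (rule eventually_conj)
  then obtain m where m: "proj (u m) \<notin> K" "u m $ None > 0"
    by (auto simp: eventually_sequentially)
  define z where "z = proj (u m)"
  have uz: "u m = u m $ None *\<^sub>R homog z"
    unfolding z_def proj_def using m(2) by (intro homog_decompose) simp
  have "z \<in> (\<Union>k<n. closure (P ! k))" using P by (simp add: convex_partitions_def)
  then have "z \<in> closure (P ! i) \<or> z \<in> closure (P ! j)"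
    using m(1) unfolding z_def[symmetric] K_def by blast
  then have "u m \<in> cell_cone P (enat i) \<or> u m \<in> cell_cone P (enat j)"
    using homog_in_cell_cone[of z P] m(2) uz by (metis less_imp_le)
  \<comment> \<open>The first inequality excludes the cone of \<open>i\<close>, the second that of
    \<open>j\<close>.\<close>
  moreover have "c \<bullet> u m > 0" "c' \<bullet> u m < 0"
    using cw zero[OF c(2,3)] zero[OF c'(2,3)] by (simp_all add: u_def inner_add_right mult_pos_neg)
  moreover have "\<forall>x\<in>P ! j. (- c') \<bullet> homog x < 0" using c'(3) by simp
  ultimately show False
    using cell_cone_halfspace[OF c(2), of "u m"] cell_cone_halfspace[of P j "- c'" "u m"] by auto
qed

lemma wall_normal_eqI:
  assumes "P \<in> convex_partitions n" "(i, j) \<in> adjacent_pairs P"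
    and "norm c = 1" "\<forall>x\<in>P ! i. c \<bullet> homog x < 0" "\<forall>x\<in>P ! j. c \<bullet> homog x > 0"
  shows "wall_normal P i j = c"
  unfolding wall_normal_def
  using assms separating_vector_unique[OF assms(1,2)] by (intro the_equality) blast+

lemma wall_normal_props:
  assumes P: "P \<in> convex_partitions n" and ij: "(i, j) \<in> adjacent_pairs P"
  shows "norm (wall_normal P i j) = 1 \<and> (\<forall>x\<in>P ! i. wall_normal P i j \<bullet> homog x < 0)
    \<and> (\<forall>x\<in>P ! j. wall_normal P i j \<bullet> homog x > 0)"
proof -
  have lt: "i < n" "j < n" "i \<noteq> j" using P ij by (auto simp: adjacent_pairs_def convex_partitions_def)
  obtain c where c: "\<forall>x\<in>P ! i. c \<bullet> homog x < 0" "\<forall>x\<in>P ! j. c \<bullet> homog x > 0"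
    using convex_partition_separation[OF P lt] by blast
  have "P ! i \<noteq> {}" using P lt by (auto simp: convex_partitions_def)
  \<comment> \<open>On a point of the non-empty cell \<open>P ! i\<close> the zero vector would
    violate the strict inequality.\<close>
  with c have "norm c > 0" by (metis all_not_in_conv inner_zero_left less_irrefl zero_less_norm_iff)
  define c' where "c' = c /\<^sub>R norm c"
  have c': "norm c' = 1" "\<forall>x\<in>P ! i. c' \<bullet> homog x < 0" "\<forall>x\<in>P ! j. c' \<bullet> homog x > 0"
    using c \<open>norm c > 0\<close> by (auto simp: c'_def divide_simps mult_less_0_iff)
  then show ?thesis using wall_normal_eqI[OF P ij c'] by simp
qed

lemma adjacent_pairs_subset: "adjacent_pairs P \<subseteq> {..<length P} \<times> {..<length P}"
  by (auto simp: adjacent_pairs_def)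

lemma finite_coord_set: "finite (coord_set P)"
  unfolding coord_set_def using finite_subset[OF adjacent_pairs_subset[of P]] by simp

section \<open>The realization space as a projection\<close>

text \<open>Adjacency is read off from the face indices, which equivalent partitions share. All
  members of the realization space therefore live in one coordinate space.\<close>

lemma adjacent_pairs_realization:
  assumes "P' \<in> realization_space n P" "P \<in> convex_partitions n"
  shows "adjacent_pairs P' = adjacent_pairs P"
  using assms by (simp add: realization_space_def comb_equivalent_def adjacent_pairs_def convex_partitions_def)

theorem theorem4p36:
  fixes P :: "(real^'d) set list" and n :: nat
  assumes "P \<in> convex_partitions n"
  shows "semialgebraic (coord_set P) (coords P ` realization_space n P)"
proof -
  define J where "J = coord_set P"
  \<comment> \<open>Turns a coordinate tuple into an environment, filled up with zeros beyond the
    coordinates; \<open>c\<close> reads the normals back from it.\<close>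
  define s where "s k f = (if k < card J then f (from_nat_into J k) else 0)"
    for k :: nat and f :: "(nat \<times> nat) \<times> 'd option \<Rightarrow> real"
  define c where "c e ij = (\<chi> l. e (to_nat_on J (ij, l)))" for e :: env and ij
  \<comment> \<open>The last conjunct characterizes the wall normals, which avoids expressing the
    description operator in \<open>wall_normal\<close>. It ranges over the adjacent pairs of the
    fixed \<open>P\<close>, a constant finite set.\<close>
  define Q where "Q a e \<longleftrightarrow> halfspace_cells n a \<in> convex_partitions n
      \<and> comb_equivalent P (halfspace_cells n a)
      \<and> (\<forall>ij\<in>adjacent_pairs P. norm (c e ij) = 1
          \<and> (\<forall>x\<in>halfspace_cell n a (fst ij). c e ij \<bullet> homog x < 0)
          \<and> (\<forall>x\<in>halfspace_cell n a (snd ij). 0 < c e ij \<bullet> homog x))"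
    for a :: "nat \<times> nat \<Rightarrow> real^('d option)" and e
  have finJ: "finite J" by (simp add: J_def finite_coord_set)
  have len: "length P = n" using assms by (simp add: convex_partitions_def)
  have finadj: "finite (adjacent_pairs P)" using finite_subset[OF adjacent_pairs_subset[of P]] by simp
  have adj_lt: "i < n" "j < n" if "(i, j) \<in> adjacent_pairs P" for i j
    using that len by (auto simp: adjacent_pairs_def)
  obtain a0 where a0: "P = halfspace_cells n a0"
    using convex_partition_halfspace_cells[OF assms] by blast
  \<comment> \<open>The given partition enters as a constant family: its separating vectors are
    allowed as real coefficients of the polynomials.\<close>
  have dP: "dcells n (\<lambda>e. P)"
    unfolding a0 by (rule dcells_halfspace_cells) (simp add: dfun_def pvec_const)
  have dc: "dfun c"
    unfolding dfun_def c_def by (intro allI pvec_vecI) (simp add: PT_var)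
  have "qf (\<lambda>e. \<exists>a. Q a e)"
  proof (rule qf_ex_fun[of "{..<n} \<times> {..<n}"])
    show "Q b e" if "\<And>l. l \<in> {..<n} \<times> {..<n} \<Longrightarrow> a l = b l" "Q a e" for a b e
    proof -
      have "halfspace_cells n a = halfspace_cells n b"
        using that(1) by (rule halfspace_cells_cong)
      moreover from this have "halfspace_cell n a i = halfspace_cell n b i" if "i < n" for i
        using that by (metis halfspace_cells_simps(2))
      ultimately show ?thesis using that(2) adj_lt unfolding Q_def by auto
    qed
    fix a :: "env \<Rightarrow> nat \<times> nat \<Rightarrow> real^('d option)" and \<rho>
    assume a: "\<And>l. pvec (\<lambda>e. a e l)" and \<rho>: "denv \<rho>"
    then have da: "dfun a" by (simp add: dfun_def)
    note dc' = dfun_comp[OF dc \<rho>]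
    show "qf (\<lambda>e. Q (a e) (\<rho> e))"
      unfolding Q_def
      by (rule qf.conj[OF qf_convex_partition[OF da] qf.conj[OF
              qf_comb_equivalent[OF dP dcells_halfspace_cells[OF da]]
              qf_ball_finite[OF finadj qf.conj[OF qf_norm_eq_1[OF dfunD[OF dc']] qf.conj[OF
                qf_ball[OF dset_halfspace_cell[OF da] qf_less[OF PT_inner[OF pvec_comp[OF dfunD[OF dc']] pvec_homog] PT_const]]
                qf_ball[OF dset_halfspace_cell[OF da] qf_less[OF PT_const PT_inner[OF pvec_comp[OF dfunD[OF dc']] pvec_homog]]]]]]]])
  qed simp
  moreover have "mpoly_fun J (s k)" for k
  proof (cases "k < card J")
    case True
    then have "J \<noteq> {}" by auto
    then have "from_nat_into J k \<in> J" by (rule from_nat_into)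
    with True show ?thesis by (simp add: s_def[abs_def] mpoly_fun.var)
  qed (simp add: s_def[abs_def] mpoly_fun.const)
  ultimately have "semialgebraic J {f \<in> J \<rightarrow>\<^sub>E UNIV. \<exists>a. Q a (\<lambda>k. s k f)}"
    by (rule semialgebraic_qf)
  moreover have "coords P ` realization_space n P = {f \<in> J \<rightarrow>\<^sub>E UNIV. \<exists>a. Q a (\<lambda>k. s k f)}"
  proof -
    have sJ: "s (to_nat_on J p) f = f p" if "p \<in> J" for p f
      using that to_nat_on_less[OF finJ that] finJ by (simp add: s_def countable_finite)
    have cf: "c (\<lambda>k. s k f) (i, j) = (\<chi> l. f ((i, j), l))" if "(i, j) \<in> adjacent_pairs P" for f i j
    proof -
      have "((i, j), l) \<in> J" for l using that by (simp add: J_def coord_set_def)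
      then show ?thesis by (simp add: c_def sJ)
    qed
    show ?thesis
    proof (intro equalityI subsetI)
      fix f assume "f \<in> coords P ` realization_space n P"
      then obtain P' where P': "P' \<in> realization_space n P" "f = coords P P'" by blast
      then have cp: "P' \<in> convex_partitions n" "comb_equivalent P P'" by (auto simp: realization_space_def)
      obtain a where a: "P' = halfspace_cells n a"
        using convex_partition_halfspace_cells[OF cp(1)] by blast
      have "c (\<lambda>k. s k f) (i, j) = wall_normal P' i j" if "(i, j) \<in> adjacent_pairs P" for i j
        using that by (simp add: cf P'(2) coords_def coord_set_def)
      then have "Q a (\<lambda>k. s k f)"
        unfolding Q_def using cp wall_normal_props[OF cp(1)] adjacent_pairs_realization[OF P'(1) assms] adj_lt
        by (auto simp: a)
      moreover have "f \<in> J \<rightarrow>\<^sub>E UNIV" by (simp add: P'(2) coords_def J_def)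
      ultimately show "f \<in> {f \<in> J \<rightarrow>\<^sub>E UNIV. \<exists>a. Q a (\<lambda>k. s k f)}" by blast
    next
      fix f assume "f \<in> {f \<in> J \<rightarrow>\<^sub>E UNIV. \<exists>a. Q a (\<lambda>k. s k f)}"
      then obtain a where f: "f \<in> J \<rightarrow>\<^sub>E UNIV" and Q: "Q a (\<lambda>k. s k f)" by blast
      define P' where "P' = halfspace_cells n a"
      have cp: "P' \<in> convex_partitions n" and P': "P' \<in> realization_space n P"
        using Q by (simp_all add: Q_def P'_def realization_space_def)
      \<comment> \<open>By uniqueness, vectors satisfying the conditions in \<open>Q\<close> are the
        wall normals, so the tuple \<open>f\<close> consists of the coordinates of
        \<open>P'\<close>.\<close>
      have wall: "wall_normal P' i j = (\<chi> l. f ((i, j), l))" if ij: "(i, j) \<in> adjacent_pairs P" for i j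
      proof (rule wall_normal_eqI[OF cp])
        show "(i, j) \<in> adjacent_pairs P'" using ij adjacent_pairs_realization[OF P' assms] by simp
        have "norm (c (\<lambda>k. s k f) (i, j)) = 1
          \<and> (\<forall>x\<in>halfspace_cell n a i. c (\<lambda>k. s k f) (i, j) \<bullet> homog x < 0)
          \<and> (\<forall>x\<in>halfspace_cell n a j. 0 < c (\<lambda>k. s k f) (i, j) \<bullet> homog x)"
          using Q ij unfolding Q_def by fastforce
        then show "norm (\<chi> l. f ((i, j), l)) = 1" "\<forall>x\<in>P' ! i. (\<chi> l. f ((i, j), l)) \<bullet> homog x < 0"
          "\<forall>x\<in>P' ! j. 0 < (\<chi> l. f ((i, j), l)) \<bullet> homog x"
          using adj_lt[OF ij] by (simp_all add: P'_def cf[OF ij])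
      qed
      have "coords P P' = f"
      proof
        fix p :: "(nat \<times> nat) \<times> 'd option"
        obtain i j l where p: "p = ((i, j), l)" by (metis surj_pair)
        show "coords P P' p = f p"
        proof (cases "p \<in> J")
          case True
          then have "(i, j) \<in> adjacent_pairs P" by (simp add: J_def coord_set_def p)
          then show ?thesis using True wall by (simp add: p coords_def J_def)
        next
          case False
          \<comment> \<open>Outside the index set both functions have the default value of
            extensional functions.\<close>
          then have "f p = undefined" using PiE_arb[OF f] by blast
          with False show ?thesis by (simp add: coords_def J_def)
        qed
      qed
      with P' show "f \<in> coords P ` realization_space n P" by blast
    qed
  qed
  ultimately show ?thesis by (simp add: J_def)
qed

end
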